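(* Let $K$ be a number field of degree $r\ge2$ with ring of integers $\mathcal O_K$. Let $A\subseteq\mathcal O_K$ be finite with at least two elements, and suppose that $R_{A,K}(q)\le B$ for every $q\in\mathbb Z$. Put $$L:=\max\{|N_{K/\mathbb Q}(a-b)|: a,b\in A,\ a\ne b\}$$ and assume $L\ge3$. Then there exists a constant $c_K>0$, depending only on $K$, such that $$|A|\ll_K\sqrt{BL}\,\exp\left(-c_K\frac{\log L}{\log\log L}\right).$$
   Context: $N_{K/\mathbb Q}$ is the field norm. For finite $A\subseteq\mathcal O_K$ and $q\in\mathbb Z$, $R_{A,K}(q):=\#\{(a,b)\in A^2: a\ne b,\ N_{K/\mathbb Q}(a-b)=q\}$. $X\ll_K Y$ means $X\le CY$ with $C>0$ depending only on $K$. The constants are independent of $A$, $B$ and $L$. *)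

theory Defs
  imports
    Complex_Main
    "HOL-Computational_Algebra.Polynomial"
    "Jordan_Normal_Form.Determinant"
begin

global_interpretation rat_vs: vector_space "\<lambda>q (x :: 'a :: field_char_0). of_rat q * x"
  by standard (simp_all add: algebra_simps of_rat_add of_rat_mult)

text \<open>
  A number field is a subfield of an arbitrary ambient field of characteristic 0 that is
  finite-dimensional over the rationals; the ambient field may be the number field itself
  (\<open>K = UNIV\<close>) or, for instance, \<open>complex\<close>.  Since \<open>inverse 0 = 0\<close>, closure under \<open>inverse\<close> needs
  no exception for 0.
\<close>

definition number_field :: "'a :: field_char_0 set \<Rightarrow> bool" where
  "number_field K \<longleftrightarrow>
     1 \<in> K \<and> (\<forall>x\<in>K. \<forall>y\<in>K. x - y \<in> K \<and> x * y \<in> K) \<and> (\<forall>x\<in>K. inverse x \<in> K) \<and>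
     (\<exists>S. finite S \<and> rat_vs.span S = K)"

definition field_degree :: "'a :: field_char_0 set \<Rightarrow> nat" where
  "field_degree K = rat_vs.dim K"

definition ring_of_integers :: "'a :: field_char_0 set \<Rightarrow> 'a set" where
  "ring_of_integers K = {x \<in> K. algebraic_int x}"

definition is_rat_basis :: "'a :: field_char_0 set \<Rightarrow> 'a list \<Rightarrow> bool" where
  "is_rat_basis K bs \<longleftrightarrow>
     distinct bs \<and> rat_vs.independent (set bs) \<and> rat_vs.span (set bs) = K"

text \<open>Column \<open>j\<close> holds the coordinates of \<open>x * bs ! j\<close> with respect to \<open>bs\<close>.\<close>

definition mult_matrix :: "'a :: field_char_0 list \<Rightarrow> 'a \<Rightarrow> rat mat" where
  "mult_matrix bs x = mat (length bs) (length bs)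
     (\<lambda>(i, j). rat_vs.representation (set bs) (x * bs ! j) (bs ! i))"

text \<open>
  The norm is the determinant of multiplication by \<open>x\<close> on \<open>K\<close>.  Lemmas \<open>ex_rat_basis\<close> and
  \<open>field_norm_eq\<close> below show that a basis exists and that its choice is irrelevant.
\<close>

definition field_norm :: "'a :: field_char_0 set \<Rightarrow> 'a \<Rightarrow> rat" where
  "field_norm K x = det (mult_matrix (SOME bs. is_rat_basis K bs) x)"

definition norm_rep_count :: "'a :: field_char_0 set \<Rightarrow> 'a set \<Rightarrow> int \<Rightarrow> nat" where
  "norm_rep_count K A q =
     card {(a, b). a \<in> A \<and> b \<in> A \<and> a \<noteq> b \<and> field_norm K (a - b) = of_int q}"

lemma ex_rat_basis:
  assumes "number_field K"
  shows "\<exists>bs. is_rat_basis K bs"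
proof -
  from assms obtain S where S: "finite S" "rat_vs.span S = K"
    by (auto simp: number_field_def)
  obtain B where B: "B \<subseteq> S" "rat_vs.independent B" "S \<subseteq> rat_vs.span B"
    using rat_vs.maximal_independent_subset[of S] by blast
  have "finite B" using B(1) S(1) finite_subset by blast
  then obtain bs where bs: "set bs = B" "distinct bs"
    using finite_distinct_list by blast
  have "rat_vs.span B = K"
    using B S(2) rat_vs.span_mono[OF B(1)] rat_vs.span_minimal[OF B(3)] by auto
  with bs B show ?thesis by (auto simp: is_rat_basis_def)
qed

lemma field_degree_eq:
  assumes "is_rat_basis K bs"
  shows "field_degree K = length bs"
  using assms rat_vs.dim_span_eq_card_independent[of "set bs"]
  unfolding is_rat_basis_def field_degree_def by (metis distinct_card)

context
  fixes K :: "'a :: field_char_0 set"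
begin

private abbreviation coord :: "'a list \<Rightarrow> 'a \<Rightarrow> nat \<Rightarrow> rat" where
  "coord bs v i \<equiv> rat_vs.representation (set bs) v (bs ! i)"

private lemma coord_expand:
  assumes "is_rat_basis K bs" "v \<in> K"
  shows "(\<Sum>i<length bs. of_rat (coord bs v i) * bs ! i) = v"
proof -
  have "(\<Sum>i<length bs. of_rat (coord bs v i) * bs ! i) =
        (\<Sum>b\<in>set bs. of_rat (rat_vs.representation (set bs) v b) * b)"
    using assms(1)
    by (intro sum.reindex_bij_betw[of "\<lambda>i. bs ! i"] bij_betw_nth) (auto simp: is_rat_basis_def)
  also have "\<dots> = v"
    using assms by (intro rat_vs.sum_representation_eq) (auto simp: is_rat_basis_def)
  finally show ?thesis .
qed

private lemma coord_sum:
  assumes bs: "is_rat_basis K bs" and w: "\<And>k. k < m \<Longrightarrow> w k \<in> K"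
  shows "coord bs (\<Sum>k<m. of_rat (c k) * w k) i = (\<Sum>k<m. c k * coord bs (w k) i)"
proof -
  have "coord bs (\<Sum>k<m. of_rat (c k) * w k) i = (\<Sum>k<m. coord bs (of_rat (c k) * w k) i)"
    using assms
    by (subst rat_vs.representation_sum) (auto simp: is_rat_basis_def intro!: rat_vs.span_scale)
  also have "\<dots> = (\<Sum>k<m. c k * coord bs (w k) i)"
    using assms
    by (intro sum.cong refl) (subst rat_vs.representation_scale, auto simp: is_rat_basis_def)
  finally show ?thesis .
qed

private lemma coord_trans:
  assumes bs: "is_rat_basis K bs" and cs: "is_rat_basis K cs" and v: "v \<in> K"
    and mult: "\<And>y. y \<in> K \<Longrightarrow> x * y \<in> K"
  shows "(\<Sum>k<length cs. coord cs v k * coord bs (x * cs ! k) i) = coord bs (x * v) i"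
proof -
  have mem: "cs ! k \<in> K" if "k < length cs" for k
    using cs that rat_vs.span_base[of "cs ! k" "set cs"] by (auto simp: is_rat_basis_def)
  have "x * v = x * (\<Sum>k<length cs. of_rat (coord cs v k) * cs ! k)"
    using coord_expand[OF cs v] by simp
  also have "\<dots> = (\<Sum>k<length cs. of_rat (coord cs v k) * (x * cs ! k))"
    by (simp add: sum_distrib_left algebra_simps)
  finally show ?thesis
    using coord_sum[OF bs, of "length cs" "\<lambda>k. x * cs ! k" "coord cs v" i] mem mult by simp
qed

lemma det_mult_matrix_unique:
  assumes K: "number_field K" and bs: "is_rat_basis K bs" and cs: "is_rat_basis K cs"
    and x: "x \<in> K"
  shows "det (mult_matrix bs x) = det (mult_matrix cs x)"
proof -
  define n where "n = length bs"
  have n: "length bs = n" by (simp add: n_def)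
  have n': "length cs = n"
    using field_degree_eq[OF bs] field_degree_eq[OF cs] by (simp add: n)
  have mult: "y * z \<in> K" if "y \<in> K" "z \<in> K" for y z
    using K that by (auto simp: number_field_def)
  have memb: "bs ! k \<in> K" if "k < n" for k
    using bs that rat_vs.span_base[of "bs ! k" "set bs"] by (auto simp: is_rat_basis_def n)
  have memc: "cs ! k \<in> K" if "k < n" for k
    using cs that rat_vs.span_base[of "cs ! k" "set cs"] by (auto simp: is_rat_basis_def n')
  define P where "P = mat n n (\<lambda>(i, j). coord bs (cs ! j) i)"
  define Q where "Q = mat n n (\<lambda>(i, j). coord cs (bs ! j) i)"
  let ?B = "mult_matrix bs x" and ?C = "mult_matrix cs x"
  have carrier: "P \<in> carrier_mat n n" "Q \<in> carrier_mat n n"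
      "?B \<in> carrier_mat n n" "?C \<in> carrier_mat n n"
    by (simp_all add: P_def Q_def mult_matrix_def n n')
  have delta: "coord bs (bs ! j) i = (if i = j then 1 else 0)" if "i < n" "j < n" for i j
  proof -
    have "rat_vs.representation (set bs) (bs ! j) = (\<lambda>v. if v = bs ! j then 1 else 0)"
      using bs that by (intro rat_vs.representation_basis) (auto simp: is_rat_basis_def n)
    thus ?thesis using bs that by (simp add: is_rat_basis_def nth_eq_iff_index_eq n)
  qed
  have "P * Q = 1\<^sub>m n"
  proof (rule eq_matI)
    fix i j assume ij: "i < dim_row (1\<^sub>m n :: rat mat)" "j < dim_col (1\<^sub>m n :: rat mat)"
    have "(P * Q) $$ (i, j) = (\<Sum>k<n. coord cs (bs ! j) k * coord bs (1 * cs ! k) i)"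
      using ij by (simp add: P_def Q_def scalar_prod_def mult.commute atLeast0LessThan)
    also have "\<dots> = coord bs (1 * bs ! j) i"
      using coord_trans[OF bs cs, of "bs ! j" 1 i] memb ij by (simp add: n')
    finally show "(P * Q) $$ (i, j) = 1\<^sub>m n $$ (i, j)"
      using ij by (simp add: delta)
  qed (use carrier in auto)
  hence "det P * det Q = 1" using carrier by (metis det_mult det_one)
  hence P0: "det P \<noteq> 0" by auto
  have "?B * P = P * ?C"
  proof (rule eq_matI)
    fix i j assume "i < dim_row (P * ?C)" "j < dim_col (P * ?C)"
    hence ij: "i < n" "j < n" using carrier by auto
    have "(?B * P) $$ (i, j) = (\<Sum>k<n. coord bs (cs ! j) k * coord bs (x * bs ! k) i)"
      using ij by (simp add: P_def mult_matrix_def n scalar_prod_def mult.commute atLeast0LessThan)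
    also have "\<dots> = coord bs (x * cs ! j) i"
      using coord_trans[OF bs bs, of "cs ! j" x i] memc ij mult x by (simp add: n)
    also have "\<dots> = (\<Sum>k<n. coord cs (x * cs ! j) k * coord bs (1 * cs ! k) i)"
      using coord_trans[OF bs cs, of "x * cs ! j" 1 i] memc ij mult x by (simp add: n')
    also have "\<dots> = (P * ?C) $$ (i, j)"
      using ij by (simp add: P_def mult_matrix_def n' scalar_prod_def mult.commute atLeast0LessThan)
    finally show "(?B * P) $$ (i, j) = (P * ?C) $$ (i, j)" .
  qed (use carrier in auto)
  hence "det ?B * det P = det P * det ?C" using carrier by (metis det_mult)
  thus ?thesis using P0 by simp
qed

end

lemma field_norm_eq:
  assumes "number_field K" "is_rat_basis K bs" "x \<in> K"
  shows "field_norm K x = det (mult_matrix bs x)"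
  unfolding field_norm_def
  using assms by (intro det_mult_matrix_unique[of K] someI_ex[OF ex_rat_basis])

end

theory Submission
  imports
    Defs
    "HOL-Algebra.Algebraic_Closure_Type"
    "HOL-Analysis.Convex"
    "HOL-Number_Theory.Cong"
    "HOL-Real_Asymp.Real_Asymp"
    "Jordan_Normal_Form.Char_Poly"
begin

text \<open>
The idea is to play many ideals of equal norm against each other.  Write \<open>K\<close> as the field
generated over the rationals by an algebraic integer \<open>\<theta>\<close> with minimal polynomial \<open>g\<close>, and let \<open>p\<close>
be a prime (outside a finite set) for which \<open>g\<close> has two different roots \<open>n1\<close>, \<open>n2\<close> modulo \<open>p\<close>.
Sending \<open>\<theta>\<close> to \<open>n1\<close> or to \<open>n2\<close> gives two different ring homomorphisms from the integers of \<open>K\<close> to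
the field with \<open>p\<close> elements.  An integer of \<open>K\<close> in the kernel of one of them has norm divisible by
\<open>p\<close>, and an integer in both kernels has norm divisible by \<open>p\<^sup>2\<close> (\<open>number_field_model\<close>).

Take a set \<open>T\<close> of \<open>k\<close> such primes, with product \<open>P\<close>.  Choosing one of the two homomorphisms for
every \<open>p\<close> in \<open>T\<close> partitions \<open>A\<close> into at most \<open>P\<close> classes, so by Cauchy's inequality at least
\<open>\<bar>A\<bar>\<^sup>2 / P\<close> ordered pairs lie in a common class.  There are \<open>2 ^ k\<close> choices.  Conversely, a pair
whose difference has norm \<open>q\<close> can be in a common class only if \<open>P\<close> divides \<open>q\<close>, and then for at
most \<open>2 ^ j\<close> of the choices, where \<open>j\<close> counts the \<open>p\<close> in \<open>T\<close> with \<open>p\<^sup>2\<close> dividing \<open>q\<close>; that is, at most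
once for every \<open>V \<subseteq> T\<close> with \<open>P * \<Prod>V\<close> dividing \<open>q\<close>.  As every \<open>q\<close> has at most \<open>B\<close>
representations, the total is at most \<open>2 B L / P\<close> times \<open>\<Prod>p\<in>T. (1 + 1 / p) \<le> (3 / 2) ^ k\<close>, up to
the diagonal.  Comparing the two counts gives \<open>\<bar>A\<bar>\<^sup>2 \<le> P \<bar>A\<bar> + 2 B L (3 / 4) ^ k\<close>
(\<open>two_class_sieve\<close>).

It remains to find \<open>k\<close> of order \<open>log L / log log L\<close> with \<open>P \<le> L powr (1 / 4)\<close>
(\<open>bound_from_sieve\<close>).  Primes up to any fixed power of \<open>log L\<close> serve, so it is
enough that at least \<open>x powr \<delta>\<close> of the primes up to \<open>x\<close> are suitable, for some \<open>\<delta> > 0\<close>.  Let \<open>\<alpha> \<noteq> \<beta>\<close> be complex roots of \<open>g\<close>, and let \<open>\<eta>\<close> generate the field of \<open>\<alpha>\<close> and \<open>\<beta>\<close>, say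
\<open>\<alpha> = f(\<eta>)\<close>, \<open>\<beta> = h(\<eta>)\<close>, with minimal polynomial \<open>F\<close>.  If \<open>p\<close> divides \<open>F(n)\<close>, then, apart from
finitely many \<open>p\<close>, the residues \<open>f(n)\<close> and \<open>h(n)\<close> are different roots of \<open>g\<close> modulo \<open>p\<close>
(\<open>two_roots_mod_prime\<close>).  And the values of a monic polynomial have many prime divisors: the
logarithm of the product of \<open>F(n)\<close> over \<open>y\<close> consecutive \<open>n\<close> is at least \<open>y log y - O(y)\<close>, whereas
a single prime contributes only \<open>O(y log p / p + log y)\<close>, so that \<open>y powr \<delta>\<close> primes contribute at
most \<open>O(\<delta> y log y)\<close> (\<open>many_prime_divisors_of_values\<close>).

The algebraic groundwork is that algebraic integers form a ring, that number fields have
primitive elements, and that one integer \<open>D\<close> clears the denominators of all integers of \<open>K\<close> in the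
power basis of \<open>\<theta>\<close>.
\<close>

hide_const (open) up_ring.coeff up_ring.monom Polynomials.degree Polynomials.lead_coeff
  Divisibility.prime

section \<open>Algebraic integers form a ring\<close>

text \<open>
The additive group generated by a finite family; closure properties of algebraic integers come
from multiplication operators that preserve such a group.
\<close>

definition int_span :: "'i set \<Rightarrow> ('i \<Rightarrow> 'a :: field_char_0) \<Rightarrow> 'a set" where
  "int_span I b = range (\<lambda>c. \<Sum>i\<in>I. of_int (c i) * b i)"

lemma int_span_add:
  fixes b :: "'b \<Rightarrow> 'a :: field_char_0"
  shows "u \<in> int_span I b \<Longrightarrow> v \<in> int_span I b \<Longrightarrow> u + v \<in> int_span I b"
  unfolding int_span_def
proof (clarsimp simp: image_iff)
  fix c d :: "'b \<Rightarrow> int"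
  show "\<exists>e. (\<Sum>i\<in>I. of_int (c i) * b i) + (\<Sum>i\<in>I. of_int (d i) * b i) = (\<Sum>i\<in>I. of_int (e i) * b i)"
    by (rule exI[of _ "\<lambda>i. c i + d i"]) (simp add: algebra_simps sum.distrib)
qed

lemma int_span_scale:
  fixes b :: "'b \<Rightarrow> 'a :: field_char_0"
  shows "u \<in> int_span I b \<Longrightarrow> of_int k * u \<in> int_span I b"
  unfolding int_span_def
proof (clarsimp simp: image_iff)
  fix c :: "'b \<Rightarrow> int"
  show "\<exists>e. of_int k * (\<Sum>i\<in>I. of_int (c i) * b i) = (\<Sum>i\<in>I. of_int (e i) * b i)"
    by (rule exI[of _ "\<lambda>i. k * c i"]) (simp add: algebra_simps sum_distrib_left)
qed

lemma int_span_0: "0 \<in> int_span I b"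
  unfolding int_span_def image_iff by (rule bexI[of _ "\<lambda>_. 0"]) auto

lemma int_span_sum: "(\<And>k. k \<in> J \<Longrightarrow> f k \<in> int_span I b) \<Longrightarrow> sum f J \<in> int_span I b"
  by (induction J rule: infinite_finite_induct) (auto simp: int_span_0 int_span_add)

lemma int_span_base:
  assumes "finite I" "i \<in> I"
  shows "b i \<in> int_span I b"
proof -
  have "b i = (\<Sum>k\<in>I. of_int (if k = i then 1 else 0) * b k)"
    using assms by (subst sum.remove[of I i]) (auto intro!: sum.neutral)
  thus ?thesis unfolding int_span_def image_iff
    by (intro bexI[of _ "\<lambda>k. if k = i then 1 else 0"]) auto
qed

lemma int_span_stable:
  assumes "\<And>i. i \<in> I \<Longrightarrow> z * b i \<in> int_span I b" "u \<in> int_span I b"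
  shows "z * u \<in> int_span I b"
proof -
  from assms(2) obtain c where "u = (\<Sum>i\<in>I. of_int (c i) * b i)"
    by (auto simp: int_span_def)
  hence "z * u = (\<Sum>i\<in>I. of_int (c i) * (z * b i))"
    by (simp add: sum_distrib_left mult.left_commute)
  thus ?thesis using assms(1) by (auto intro!: int_span_sum int_span_scale)
qed

text \<open>
The family is an eigenvector, with eigenvalue \<open>z\<close>, of the integer matrix of multiplication by \<open>z\<close>;
the characteristic polynomial of that matrix is monic with integer coefficients.
\<close>

lemma algebraic_int_if_stable_nat:
  fixes z :: "'a :: field_char_0" and b :: "nat \<Rightarrow> 'a"
  assumes st: "\<And>i. i < n \<Longrightarrow> z * b i \<in> int_span {..<n} b" and k: "k < n" "b k \<noteq> 0"
  shows "algebraic_int z"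
proof -
  have "\<forall>i. \<exists>c. i < n \<longrightarrow> z * b i = (\<Sum>j<n. of_int (c j) * b j)"
    using st unfolding int_span_def by auto
  then obtain M where M: "\<And>i. i < n \<Longrightarrow> z * b i = (\<Sum>j<n. of_int (M i j) * b j)"
    by metis
  define A :: "int mat" where "A = mat n n (\<lambda>(i, j). M i j)"
  have A: "A \<in> carrier_mat n n" by (simp add: A_def)
  hence A': "of_int_hom.mat_hom A \<in> carrier_mat n n" by simp
  \<comment> \<open>The vector is nonzero because of its entry \<open>b k\<close>.\<close>
  have "eigenvector (of_int_hom.mat_hom A) (vec n b) z"
    unfolding eigenvector_def
  proof (intro conjI)
    show "vec n b \<in> carrier_vec (dim_row (of_int_hom.mat_hom A))" by (simp add: A_def)
    show "vec n b \<noteq> 0\<^sub>v (dim_row (of_int_hom.mat_hom A))"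
      using k A by (auto simp: vec_eq_iff)
    show "of_int_hom.mat_hom A *\<^sub>v vec n b = z \<cdot>\<^sub>v vec n b"
      by (rule eq_vecI) (auto simp: A_def scalar_prod_def M atLeast0LessThan)
  qed
  hence "poly (char_poly (of_int_hom.mat_hom A)) z = 0"
    using eigenvalue_root_char_poly[OF A'] by (auto simp: eigenvalue_def)
  hence "poly (of_int_poly (char_poly A)) z = 0"
    by (simp add: of_int_hom.char_poly_hom[OF A])
  moreover have "lead_coeff (char_poly A) = 1"
    using degree_monic_char_poly[OF A] by simp
  ultimately show ?thesis unfolding algebraic_int_altdef_ipoly by blast
qed

lemma algebraic_int_if_stable:
  fixes z :: "'a :: field_char_0"
  assumes "finite I" and st: "\<And>i. i \<in> I \<Longrightarrow> z * b i \<in> int_span I b" and k: "k \<in> I" "b k \<noteq> 0"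
  shows "algebraic_int z"
proof -
  obtain h where h: "bij_betw h {..<card I} I"
    using ex_bij_betw_nat_finite[OF assms(1)] by (auto simp: atLeast0LessThan)
  have sub: "int_span I b \<subseteq> int_span {..<card I} (b \<circ> h)"
  proof
    fix u assume "u \<in> int_span I b"
    then obtain c where u: "u = (\<Sum>i\<in>I. of_int (c i) * b i)" by (auto simp: int_span_def)
    have "u = (\<Sum>i<card I. of_int ((c \<circ> h) i) * (b \<circ> h) i)"
      unfolding u by (subst sum.reindex_bij_betw[OF h, symmetric]) simp
    thus "u \<in> int_span {..<card I} (b \<circ> h)" unfolding int_span_def by blast
  qed
  obtain k' where "k' < card I" "h k' = k"
    using h k(1) by (metis bij_betw_imp_surj_on imageE lessThan_iff)
  moreover have "z * (b \<circ> h) i \<in> int_span {..<card I} (b \<circ> h)" if "i < card I" for i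
    using st[of "h i"] sub h that by (auto simp: bij_betw_def)
  ultimately show ?thesis
    using k(2) by (intro algebraic_int_if_stable_nat[of "card I" z "b \<circ> h" k']) auto
qed

lemma algebraic_int_power_reduce:
  fixes x :: "'a :: field_char_0"
  assumes "algebraic_int x"
  obtains m c where "m > 0" "x ^ m = (\<Sum>i<m. of_int (c i) * x ^ i)"
proof -
  obtain p :: "int poly" where p: "poly (of_int_poly p) x = 0" "lead_coeff p = 1"
    using assms unfolding algebraic_int_altdef_ipoly by auto
  have "degree p > 0"
  proof (rule ccontr)
    assume "\<not> degree p > 0"
    hence "p = [:1:]" using p(2) by (auto elim!: degree_eq_zeroE)
    thus False using p(1) by simp
  qed
  have "0 = (\<Sum>i\<le>degree p. of_int (coeff p i) * x ^ i)"
    using p(1) by (simp add: poly_altdef degree_map_poly coeff_map_poly)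
  also have "\<dots> = x ^ degree p + (\<Sum>i<degree p. of_int (coeff p i) * x ^ i)"
    using p(2) by (simp add: lessThan_Suc_atMost[symmetric])
  finally have "x ^ degree p = (\<Sum>i<degree p. of_int (- coeff p i) * x ^ i)"
    by (simp add: sum_negf eq_neg_iff_add_eq_0)
  thus ?thesis by (rule that[OF \<open>degree p > 0\<close>])
qed

text \<open>
The group generated by the products \<open>x ^ i * y ^ j\<close>, with exponents below the degrees of monic
equations for \<open>x\<close> and \<open>y\<close>, is stable under multiplication by \<open>x\<close> and by \<open>y\<close>, hence also by their
sum and product.
\<close>

lemma
  fixes x y :: "'a :: field_char_0"
  assumes x: "algebraic_int x" and y: "algebraic_int y"
  shows algebraic_int_add: "algebraic_int (x + y)"
    and algebraic_int_mult: "algebraic_int (x * y)"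
proof -
  obtain m c where m: "m > 0" "x ^ m = (\<Sum>i<m. of_int (c i) * x ^ i)"
    using algebraic_int_power_reduce[OF x] .
  obtain n d where n: "n > 0" "y ^ n = (\<Sum>i<n. of_int (d i) * y ^ i)"
    using algebraic_int_power_reduce[OF y] .
  define I where "I = {..<m} \<times> {..<n}"
  define b where "b = (\<lambda>(i, j). x ^ i * y ^ j)"
  have fin: "finite I" by (simp add: I_def)
  have xb: "x * b k \<in> int_span I b" if "k \<in> I" for k
  proof -
    obtain i j where k: "k = (i, j)" "i < m" "j < n" using \<open>k \<in> I\<close> by (auto simp: I_def)
    show ?thesis
    proof (cases "Suc i < m")
      case True
      thus ?thesis using int_span_base[OF fin, of "(Suc i, j)" b] k
        by (simp add: I_def b_def mult.assoc)
    next
      case False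
      hence i: "Suc i = m" using k by simp
      have "x * b k = x ^ m * y ^ j" by (simp add: b_def k i[symmetric] mult.assoc)
      also have "\<dots> = (\<Sum>i<m. of_int (c i) * b (i, j))"
        by (simp add: m(2) b_def sum_distrib_right mult.assoc)
      also have "\<dots> \<in> int_span I b"
        using k by (intro int_span_sum int_span_scale int_span_base fin) (auto simp: I_def)
      finally show ?thesis .
    qed
  qed
  have yb: "y * b k \<in> int_span I b" if "k \<in> I" for k
  proof -
    obtain i j where k: "k = (i, j)" "i < m" "j < n" using \<open>k \<in> I\<close> by (auto simp: I_def)
    show ?thesis
    proof (cases "Suc j < n")
      case True
      thus ?thesis using int_span_base[OF fin, of "(i, Suc j)" b] k
        by (simp add: I_def b_def mult.left_commute)
    next
      case False
      hence j: "Suc j = n" using k by simp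
      have "y * b k = x ^ i * y ^ n" by (simp add: b_def k j[symmetric] mult.left_commute)
      also have "\<dots> = (\<Sum>j<n. of_int (d j) * b (i, j))"
        by (simp add: n(2) b_def sum_distrib_left mult_ac)
      also have "\<dots> \<in> int_span I b"
        using k by (intro int_span_sum int_span_scale int_span_base fin) (auto simp: I_def)
      finally show ?thesis .
    qed
  qed
  have one: "(0, 0) \<in> I" "b (0, 0) \<noteq> 0" using m n by (auto simp: I_def b_def)
  show "algebraic_int (x + y)"
    by (rule algebraic_int_if_stable[where b = b, OF fin _ one])
       (auto simp: distrib_right intro!: int_span_add xb yb)
  show "algebraic_int (x * y)"
  proof (rule algebraic_int_if_stable[where b = b, OF fin _ one])
    fix k assume "k \<in> I"
    hence "x * (y * b k) \<in> int_span I b" by (intro int_span_stable[OF xb yb])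
    thus "x * y * b k \<in> int_span I b" by (simp add: mult.assoc)
  qed
qed

lemma algebraic_int_diff:
  fixes x y :: "'a :: field_char_0"
  shows "algebraic_int x \<Longrightarrow> algebraic_int y \<Longrightarrow> algebraic_int (x - y)"
  using algebraic_int_add[of x "- y"] by (simp add: algebraic_int_minus)

lemma algebraic_int_power:
  fixes x :: "'a :: field_char_0"
  shows "algebraic_int x \<Longrightarrow> algebraic_int (x ^ k)"
  by (induction k) (simp_all add: algebraic_int_mult int_imp_algebraic_int)

lemma algebraic_int_prod:
  fixes f :: "'i \<Rightarrow> 'a :: field_char_0"
  shows "(\<And>i. i \<in> I \<Longrightarrow> algebraic_int (f i)) \<Longrightarrow> algebraic_int (prod f I)"
  by (induction I rule: infinite_finite_induct) (simp_all add: algebraic_int_mult int_imp_algebraic_int)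

lemma algebraic_int_sum:
  fixes f :: "'i \<Rightarrow> 'a :: field_char_0"
  shows "(\<And>i. i \<in> I \<Longrightarrow> algebraic_int (f i)) \<Longrightarrow> algebraic_int (sum f I)"
  by (induction I rule: infinite_finite_induct) (simp_all add: algebraic_int_add)

lemma algebraic_int_coeff_mult:
  fixes p q :: "'a :: field_char_0 poly"
  assumes "\<And>i. algebraic_int (coeff p i)" "\<And>i. algebraic_int (coeff q i)"
  shows "algebraic_int (coeff (p * q) i)"
  unfolding coeff_mult using assms by (intro algebraic_int_sum algebraic_int_mult)

lemma algebraic_int_coeff_prod:
  fixes f :: "'i \<Rightarrow> 'a :: field_char_0 poly"
  assumes "\<And>k i. k \<in> I \<Longrightarrow> algebraic_int (coeff (f k) i)"
  shows "algebraic_int (coeff (prod f I) i)"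
  using assms
proof (induction I arbitrary: i rule: infinite_finite_induct)
  case (insert x F)
  have "algebraic_int (coeff (f x * prod f F) i)" for i
    using insert.prems by (intro algebraic_int_coeff_mult insert.IH) simp_all
  thus ?case using insert.hyps by simp
qed (simp_all add: of_bool_def)

section \<open>Minimal polynomials over the rationals\<close>

text \<open>
Division with remainder stays inside any subring \<open>S\<close> that contains the coefficients.  It is used
for integer polynomials and for polynomials over a subfield.
\<close>

lemma monic_division:
  fixes d p :: "'a :: comm_ring_1 poly"
  assumes S0: "0 \<in> S" and Sd: "\<And>x y. x \<in> S \<Longrightarrow> y \<in> S \<Longrightarrow> x - y \<in> S"
    and Sm: "\<And>x y. x \<in> S \<Longrightarrow> y \<in> S \<Longrightarrow> x * y \<in> S"
    and d: "lead_coeff d = 1" "\<And>i. coeff d i \<in> S" and p: "\<And>i. coeff p i \<in> S"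
  shows "\<exists>q r. p = q * d + r \<and> (r = 0 \<or> degree r < degree d) \<and> (\<forall>i. coeff r i \<in> S)"
  using p
proof (induction "degree p" arbitrary: p rule: less_induct)
  case less
  show ?case
  proof (cases "degree p < degree d")
    case True
    thus ?thesis using less.prems by (intro exI[of _ 0] exI[of _ p]) auto
  next
    case False
    define m where "m = monom (lead_coeff p) (degree p - degree d)"
    define p' where "p' = p - m * d"
    have S: "coeff p' i \<in> S" for i
      unfolding p'_def m_def coeff_diff coeff_monom_mult
      using less.prems d S0 by (auto intro!: Sd Sm)
    have c0: "coeff p' (degree p) = 0"
      unfolding p'_def m_def coeff_diff coeff_monom_mult using False d(1) by auto
    have "degree (m * d) \<le> degree p"
      using degree_mult_le[of m d] degree_monom_le[of "lead_coeff p" "degree p - degree d"] False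
      unfolding m_def by linarith
    hence "degree p' \<le> degree p" unfolding p'_def by (intro degree_diff_le) auto
    hence "p' = 0 \<or> degree p' < degree p" using c0 eq_zero_or_degree_less by blast
    thus ?thesis
    proof
      assume "p' = 0"
      thus ?thesis using S0 by (intro exI[of _ m] exI[of _ 0]) (auto simp: p'_def)
    next
      assume "degree p' < degree p"
      from less.hyps[OF this S] obtain q r where
        "p' = q * d + r" "r = 0 \<or> degree r < degree d" "\<forall>i. coeff r i \<in> S" by blast
      thus ?thesis by (intro exI[of _ "q + m"] exI[of _ r]) (auto simp: p'_def algebra_simps)
    qed
  qed
qed

text \<open>
Evaluation of a rational polynomial in an arbitrary field of characteristic 0, so that one
polynomial can be compared at conjugates living in different fields.
\<close>

definition rpoly :: "rat poly \<Rightarrow> 'a :: field_char_0 \<Rightarrow> 'a" where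
  "rpoly p x = poly (map_poly of_rat p) x"

lemma rpoly_pCons [simp]: "rpoly (pCons c p) x = of_rat c + x * rpoly p x"
  by (simp add: rpoly_def of_rat_hom.map_poly_pCons_hom)

lemma rpoly_0 [simp]: "rpoly 0 x = 0"
  by (simp add: rpoly_def)

lemma rpoly_1 [simp]: "rpoly 1 x = 1"
  by (simp add: rpoly_def)

lemma rpoly_add [simp]: "rpoly (p + q) x = rpoly p x + rpoly q x"
  by (simp add: rpoly_def of_rat_hom.map_poly_hom_add)

lemma rpoly_minus [simp]: "rpoly (- p) x = - rpoly p x"
  by (induction p) (auto simp: of_rat_minus)

lemma rpoly_diff [simp]: "rpoly (p - q) x = rpoly p x - rpoly q x"
  using rpoly_add[of p "- q" x] by (simp del: rpoly_add)

lemma rpoly_smult [simp]: "rpoly (Polynomial.smult c p) x = of_rat c * rpoly p x"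
  by (induction p) (auto simp: of_rat_mult algebra_simps)

lemma rpoly_mult [simp]: "rpoly (p * q) x = rpoly p x * rpoly q x"
  by (induction p) (auto simp: algebra_simps)

lemma rpoly_sum: "rpoly (sum f A) x = (\<Sum>k\<in>A. rpoly (f k) x)"
  by (induction A rule: infinite_finite_induct) auto

lemma rpoly_monom [simp]: "rpoly (monom c n) x = of_rat c * x ^ n"
  by (simp add: rpoly_def map_poly_monom poly_monom)

lemma rpoly_pcompose [simp]: "rpoly (pcompose p q) x = rpoly p (rpoly q x)"
  by (induction p) (auto simp: pcompose_pCons)

lemma rpoly_of_int_poly: "rpoly (of_int_poly p) x = poly (of_int_poly p) x"
  by (induction p) (auto simp: map_poly_pCons)

lemma rpoly_altdef: "rpoly p x = (\<Sum>i\<le>degree p. of_rat (coeff p i) * x ^ i)"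
  by (simp add: rpoly_def poly_altdef degree_map_poly coeff_map_poly)

definition is_minpoly :: "rat poly \<Rightarrow> 'a :: field_char_0 \<Rightarrow> bool" where
  "is_minpoly M x \<longleftrightarrow> lead_coeff M = 1 \<and> (\<forall>h. rpoly h x = 0 \<longleftrightarrow> M dvd h)"

lemma is_minpolyD:
  assumes "is_minpoly M x"
  shows "lead_coeff M = 1" "rpoly h x = 0 \<longleftrightarrow> M dvd h" "rpoly M x = 0" "M \<noteq> 0" "degree M > 0"
proof -
  show M: "lead_coeff M = 1" "rpoly h x = 0 \<longleftrightarrow> M dvd h" "rpoly M x = 0"
    using assms by (auto simp: is_minpoly_def)
  show "M \<noteq> 0" using M(1) by auto
  show "degree M > 0"
  proof (rule ccontr)
    assume "\<not> degree M > 0"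
    hence "M = 1" using M(1) by (auto elim!: degree_eq_zeroE simp: one_pCons)
    thus False using M(3) by simp
  qed
qed

lemma ex_minpoly:
  fixes x :: "'a :: field_char_0"
  assumes "algebraic_int x"
  shows "\<exists>M. is_minpoly M x"
proof -
  obtain p :: "int poly" where p: "poly (of_int_poly p) x = 0" "lead_coeff p = 1"
    using assms unfolding algebraic_int_altdef_ipoly by auto
  define P where "P = (\<lambda>h :: rat poly. h \<noteq> 0 \<and> rpoly h x = 0)"
  have "P (of_int_poly p)" using p by (auto simp: P_def rpoly_of_int_poly)
  define h where "h = (ARG_MIN degree h. P h)"
  have h: "P h" "\<And>h'. P h' \<Longrightarrow> degree h \<le> degree h'"
    unfolding h_def using arg_min_natI[of P _ degree] arg_min_nat_le[of P _ degree] \<open>P (of_int_poly p)\<close>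
    by blast+
  define M where "M = Polynomial.smult (inverse (lead_coeff h)) h"
  have M: "M \<noteq> 0" "rpoly M x = 0" "degree M = degree h" "lead_coeff M = 1"
    using h(1) by (auto simp: M_def P_def)
  have "M dvd q" if "rpoly q x = 0" for q
  proof (rule ccontr)
    assume "\<not> M dvd q"
    hence "q mod M \<noteq> 0" by (simp add: mod_eq_0_iff_dvd)
    moreover have "rpoly (q mod M) x = 0"
      using that M(2) by (simp add: minus_mult_div_eq_mod[symmetric])
    ultimately have "degree h \<le> degree (q mod M)" by (intro h(2)) (simp add: P_def)
    thus False using degree_mod_less[OF M(1), of q] \<open>q mod M \<noteq> 0\<close> M(3) by simp
  qed
  hence "is_minpoly M x" using M by (auto simp: is_minpoly_def elim!: dvdE)
  thus ?thesis ..
qed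

text \<open>
A minimal polynomial is irreducible, so it is coprime to every polynomial that does not vanish
at \<open>x\<close>.
\<close>

lemma is_minpoly_bezout:
  assumes M: "is_minpoly M x" and h: "rpoly h x \<noteq> 0"
  obtains s t where "s * M + t * h = 1"
proof -
  have "is_unit c" if cM: "c dvd M" and ch: "c dvd h" for c
  proof -
    obtain q where q: "M = c * q" using cM by (elim dvdE)
    have "rpoly c x \<noteq> 0" using h ch by (auto elim!: dvdE)
    hence "rpoly q x = 0" using is_minpolyD(3)[OF M] q by simp
    hence "M dvd q" using is_minpolyD(2)[OF M] by blast
    then obtain w where "q = M * w" by blast
    hence "M * (c * w) = M * 1" using q by (simp add: mult_ac)
    hence "c * w = 1" using is_minpolyD(4)[OF M] by (metis mult_cancel_left)
    thus ?thesis by (metis dvdI)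
  qed
  hence "gcd M h = 1" using is_unit_gcd_iff[of M h] by simp
  hence "fst (bezout_coefficients M h) * M + snd (bezout_coefficients M h) * h = 1"
    by (simp add: bezout_coefficients_fst_snd)
  thus ?thesis using that by blast
qed

text \<open>
Conjugates share their minimal polynomial, even across different fields: a relation at \<open>y\<close> that
fails at \<open>x\<close> would contradict the Bezout identity evaluated at \<open>y\<close>.
\<close>

lemma is_minpoly_conjugate:
  fixes x :: "'a :: field_char_0" and y :: "'b :: field_char_0"
  assumes M: "is_minpoly M x" and y: "rpoly M y = 0"
  shows "is_minpoly M y"
  unfolding is_minpoly_def
proof (intro conjI allI iffI)
  show "lead_coeff M = 1" by (rule is_minpolyD(1)[OF M])
  fix h
  show "rpoly h y = 0" if "M dvd h" using that y by (auto elim!: dvdE)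
  show "M dvd h" if h: "rpoly h y = 0"
  proof (rule ccontr)
    assume "\<not> M dvd h"
    hence "rpoly h x \<noteq> 0" using is_minpolyD(2)[OF M] by blast
    then obtain s t where "s * M + t * h = 1" using is_minpoly_bezout[OF M] by blast
    hence "rpoly (s * M + t * h) y = 1" by simp
    thus False using y h by simp
  qed
qed

lemma is_minpoly_simple_root:
  assumes M: "is_minpoly M x"
  shows "rpoly (pderiv M) x \<noteq> 0"
proof
  assume "rpoly (pderiv M) x = 0"
  hence "M dvd pderiv M" using is_minpolyD(2)[OF M] by blast
  moreover have "pderiv M \<noteq> 0" using is_minpolyD(5)[OF M] by (simp add: pderiv_eq_0_iff)
  ultimately have "degree M \<le> degree (pderiv M)" by (rule dvd_imp_degree_le)
  thus False using is_minpolyD(5)[OF M] by (simp add: degree_pderiv)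
qed

lemma rpoly_pderiv: "poly (pderiv (map_poly of_rat p)) x = rpoly (pderiv p) x"
  by (induction p) (auto simp: rpoly_def pderiv_pCons of_rat_hom.map_poly_pCons_hom of_rat_hom.map_poly_hom_add)

lemma is_minpoly_inverse:
  assumes M: "is_minpoly M x" and h: "rpoly h x \<noteq> 0"
  shows "\<exists>s. rpoly s x = inverse (rpoly h x)"
proof -
  obtain s t where "s * M + t * h = 1" using is_minpoly_bezout[OF M h] by blast
  hence "rpoly (s * M + t * h) x = 1" by simp
  hence "rpoly t x * rpoly h x = 1" using is_minpolyD(3)[OF M] by simp
  thus ?thesis using h by (intro exI[of _ t]) (simp add: field_simps)
qed

text \<open>
Over an algebraically closed field the minimal polynomial is the product over its distinct roots:
a repeated root would be a common root with the derivative, and every root has the same minimal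
polynomial.
\<close>

lemma is_minpoly_split:
  fixes x :: "'a :: field_char_0"
  assumes M: "is_minpoly M x"
  defines "R \<equiv> {y :: 'b :: {alg_closed_field, field_char_0}. rpoly M y = 0}"
  shows "finite R" "card R = degree M" "map_poly of_rat M = (\<Prod>y\<in>R. [:- y, 1:])"
proof -
  define P where "P = (map_poly of_rat M :: 'b poly)"
  have P0: "P \<noteq> 0" using is_minpolyD(4)[OF M] by (simp add: P_def)
  have deg: "degree P = degree M" by (simp add: P_def)
  have lc: "lead_coeff P = 1" using is_minpolyD(1)[OF M] by (simp add: P_def coeff_map_poly)
  obtain A where A: "size A = degree P" "P = (\<Prod>x\<in>#A. [:- x, 1:])"
    using alg_closed_imp_factorization[OF P0] lc by auto
  have root: "poly P y = 0 \<longleftrightarrow> y \<in># A" for y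
    unfolding A(2) by (induction A) auto
  have RA: "R = set_mset A" using root by (auto simp: R_def rpoly_def P_def)
  have "count A y \<le> 1" for y
  proof (rule ccontr)
    assume c: "\<not> count A y \<le> 1"
    hence "y \<in># A" by (simp add: count_greater_zero_iff[symmetric] del: count_greater_zero_iff)
    then obtain B where B: "A = add_mset y B" by (meson multi_member_split)
    hence "y \<in># B" using c by (simp add: count_greater_zero_iff[symmetric] del: count_greater_zero_iff)
    then obtain C where C: "A = add_mset y (add_mset y C)" using B by (metis multi_member_split)
    define Q where "Q = (\<Prod>x\<in>#C. [:- x, 1:])"
    have "P = [:- y, 1:] * ([:- y, 1:] * Q)" unfolding A(2) C Q_def by simp
    hence "poly (pderiv P) y = 0"
      by (simp add: pderiv_mult pderiv_pCons del: mult_pCons_left)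
    moreover have "rpoly M y = 0" using \<open>y \<in># A\<close> root by (simp add: rpoly_def P_def)
    ultimately show False using is_minpoly_simple_root[OF is_minpoly_conjugate[OF M, of y]]
      by (simp add: P_def rpoly_pderiv)
  qed
  hence "A = mset_set R"
    unfolding RA by (intro multiset_eqI) (metis One_nat_def count_eq_zero_iff count_mset_set(1,3) finite_set_mset le_Suc_eq le_zero_eq)
  moreover from this have "size A = card R" by (metis size_mset_set)
  ultimately show "finite R" "card R = degree M" "map_poly of_rat M = (\<Prod>y\<in>R. [:- y, 1:])"
    using A deg RA by (auto simp: prod_unfold_prod_mset P_def)
qed

text \<open>
An integral equation for \<open>u(x)\<close> is a polynomial relation at \<open>x\<close>, so it transfers to every conjugate.
\<close>

lemma is_minpoly_conjugate_int:
  fixes x :: "'a :: field_char_0" and y :: "'b :: field_char_0"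
  assumes M: "is_minpoly M x" and y: "rpoly M y = 0" and u: "algebraic_int (rpoly u x)"
  shows "algebraic_int (rpoly u y)"
proof -
  obtain p :: "int poly" where p: "poly (of_int_poly p) (rpoly u x) = 0" "lead_coeff p = 1"
    using u unfolding algebraic_int_altdef_ipoly by auto
  have "rpoly (pcompose (of_int_poly p) u) x = 0" using p by (simp add: rpoly_of_int_poly)
  hence "M dvd pcompose (of_int_poly p) u" using is_minpolyD(2)[OF M] by blast
  then obtain k where "pcompose (of_int_poly p) u = M * k" by (elim dvdE)
  hence "rpoly (pcompose (of_int_poly p) u) y = rpoly (M * k) y" by simp
  hence "rpoly (of_int_poly p) (rpoly u y) = 0" using y by simp
  thus ?thesis using p unfolding algebraic_int_altdef_ipoly by (auto simp: rpoly_of_int_poly)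
qed

lemma of_rat_algebraic_int_imp_Ints:
  assumes "algebraic_int (of_rat q :: complex)"
  shows "\<exists>k. q = of_int k"
proof -
  have "(of_rat q :: complex) \<in> \<int>"
    using rational_algebraic_int_is_int[OF assms] by simp
  then obtain k where "of_rat q = (of_int k :: complex)" by (auto elim: Ints_cases)
  hence "of_rat q = (of_rat (of_int k) :: complex)" by simp
  thus ?thesis by (simp only: of_rat_eq_iff) blast
qed

lemma ex_int_poly:
  assumes "\<And>i. \<exists>k. coeff (p :: rat poly) i = of_int k"
  shows "\<exists>g. p = of_int_poly g"
  by (rule exI[of _ "map_poly floor p"], rule poly_eqI)
     (use assms in \<open>auto simp: coeff_map_poly\<close>, metis floor_of_int)

text \<open>
The coefficients are polynomials in the complex conjugates of \<open>x\<close>, which are algebraic integers;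
being rational as well, they are integers.
\<close>

lemma minpoly_integral:
  fixes x :: "'a :: field_char_0"
  assumes M: "is_minpoly M x" and x: "algebraic_int x"
  shows "\<exists>g. M = of_int_poly g \<and> lead_coeff g = 1"
proof -
  note sp = is_minpoly_split[OF M, where ?'b = complex]
  have "algebraic_int (coeff (map_poly of_rat M :: complex poly) i)" for i
  proof -
    have "algebraic_int y" if "rpoly M y = 0" for y :: complex
      using is_minpoly_conjugate_int[OF M that, of "[:0, 1:]"] x by simp
    thus ?thesis unfolding sp(3)
      by (intro algebraic_int_coeff_prod) (auto simp: coeff_pCons split: nat.splits)
  qed
  hence "\<exists>k. coeff M i = of_int k" for i
    by (intro of_rat_algebraic_int_imp_Ints) (simp add: coeff_map_poly)
  then obtain g where g: "M = of_int_poly g" using ex_int_poly[of M] by blast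
  moreover have "lead_coeff g = 1" using is_minpolyD(1)[OF M] unfolding g by (simp add: coeff_map_poly)
  ultimately show ?thesis by blast
qed

section \<open>Primitive elements\<close>

text \<open>
The classical argument.  For all but finitely many \<open>m\<close>, the number \<open>b\<close> is the only common root of
its own minimal polynomial and of \<open>Ma (\<eta> - m t)\<close>, where \<open>\<eta> = a + m b\<close> and \<open>Ma\<close> is the minimal
polynomial of \<open>a\<close>.  Hence the minimal polynomial of \<open>b\<close> over the field generated by \<open>\<eta>\<close>, which
divides both, is \<open>t - b\<close>.
\<close>

lemma primitive_element_alg_closed:
  fixes a b :: "'a :: {alg_closed_field, field_char_0}"
  assumes a: "algebraic_int a" and b: "algebraic_int b"
  shows "\<exists>m :: nat. \<exists>f h. a = rpoly f (a + of_nat m * b) \<and> b = rpoly h (a + of_nat m * b)"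
proof -
  obtain Ma where Ma: "is_minpoly Ma a" using ex_minpoly[OF a] by blast
  obtain Mb where Mb: "is_minpoly Mb b" using ex_minpoly[OF b] by blast
  define Ra where "Ra = {y :: 'a. rpoly Ma y = 0}"
  define Rb where "Rb = {y :: 'a. rpoly Mb y = 0}"
  have fin: "finite Ra" "finite Rb"
    using is_minpoly_split(1)[OF Ma, where ?'b = 'a] is_minpoly_split(1)[OF Mb, where ?'b = 'a]
    by (simp_all add: Ra_def Rb_def)
  define bad where "bad = (\<lambda>(\<alpha>, \<beta>). (\<alpha> - a) / (b - \<beta>)) ` (Ra \<times> Rb)"
  have "finite bad" using fin by (simp add: bad_def)
  moreover have "infinite (range (of_nat :: nat \<Rightarrow> 'a))" by (simp add: finite_image_iff inj_of_nat)
  ultimately have "\<not> range (of_nat :: nat \<Rightarrow> 'a) \<subseteq> bad" using finite_subset by blast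
  then obtain m :: nat where m: "of_nat m \<notin> bad" by blast
  define \<eta> where "\<eta> = a + of_nat m * b"
  have "algebraic_int \<eta>" unfolding \<eta>_def
    using a b by (intro algebraic_int_add algebraic_int_mult) (auto intro: int_imp_algebraic_int)
  then obtain M where M: "is_minpoly M \<eta>" using ex_minpoly by blast
  define k where "k = range (\<lambda>h. rpoly h \<eta>)"
  have kI: "rpoly h \<eta> \<in> k" for h by (simp add: k_def)
  have k_add: "x + y \<in> k" and k_diff: "x - y \<in> k" and k_mult: "x * y \<in> k"
    if "x \<in> k" "y \<in> k" for x y
    using that kI[of "_ + _"] kI[of "_ - _"] kI[of "_ * _"] unfolding k_def by auto
  have k_rat: "of_rat q \<in> k" for q using kI[of "[:q:]"] by simp
  have k_inv: "inverse x \<in> k" if "x \<in> k" for x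
  proof (cases "x = 0")
    case True
    thus ?thesis using k_rat[of 0] by simp
  next
    case False
    from that obtain h where "x = rpoly h \<eta>" by (auto simp: k_def)
    thus ?thesis using is_minpoly_inverse[OF M, of h] False kI by metis
  qed
  have k0: "0 \<in> k" and \<eta>k: "\<eta> \<in> k" using kI[of 0] kI[of "[:0, 1:]"] by simp_all
  define Kp where "Kp = {p :: 'a poly. \<forall>i. coeff p i \<in> k}"
  have Kp_pcompose: "pcompose p q \<in> Kp" if "p \<in> Kp" "q \<in> Kp" for p q
  proof -
    have mult: "u * v \<in> Kp" if "u \<in> Kp" "v \<in> Kp" for u v
    proof -
      have "(\<Sum>j\<in>J. coeff u j * coeff v (i - j)) \<in> k" for i and J :: "nat set"
        using that by (induction J rule: infinite_finite_induct)
          (auto simp: Kp_def k0 intro!: k_add k_mult)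
      thus ?thesis by (auto simp: Kp_def coeff_mult)
    qed
    show ?thesis using that(1)
    proof (induction p)
      case (pCons c p)
      have "c \<in> k" using pCons.prems by (auto simp: Kp_def dest: spec[of _ 0])
      have "coeff p i \<in> k" for i using pCons.prems by (auto simp: Kp_def dest: spec[of _ "Suc i"])
      hence "q * pcompose p q \<in> Kp" using pCons.IH that(2) by (intro mult) (auto simp: Kp_def)
      thus ?case using \<open>c \<in> k\<close> k0
        by (auto simp: Kp_def pcompose_pCons coeff_pCons intro!: k_add split: nat.splits)
    qed (simp add: Kp_def k0)
  qed
  have Kp_rat: "map_poly of_rat p \<in> Kp" for p by (simp add: Kp_def coeff_map_poly k_rat)
  \<comment> \<open>The minimal polynomial \<open>d\<close> of \<open>b\<close> over the field \<open>k\<close> generated by \<open>\<eta>\<close>.\<close>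
  define P where "P = (\<lambda>p :: 'a poly. p \<in> Kp \<and> p \<noteq> 0 \<and> poly p b = 0)"
  have "P (map_poly of_rat Mb)"
    using is_minpolyD(3,4)[OF Mb] Kp_rat[of Mb] by (simp add: P_def rpoly_def)
  define e where "e = (ARG_MIN degree p. P p)"
  have e: "P e" "\<And>p. P p \<Longrightarrow> degree e \<le> degree p"
    unfolding e_def using arg_min_natI[of P _ degree] arg_min_nat_le[of P _ degree] \<open>P (map_poly of_rat Mb)\<close>
    by blast+
  define d where "d = Polynomial.smult (inverse (lead_coeff e)) e"
  have d: "lead_coeff d = 1" "degree d = degree e" "poly d b = 0" "d \<in> Kp" "d \<noteq> 0"
    using e(1) by (auto simp: d_def P_def Kp_def intro!: k_mult k_inv)
  have d_dvd: "d dvd p" if "p \<in> Kp" "poly p b = 0" for p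
  proof -
    have "\<exists>q r. p = q * d + r \<and> (r = 0 \<or> degree r < degree d) \<and> (\<forall>i. coeff r i \<in> k)"
      using that d by (intro monic_division k0 k_diff k_mult) (auto simp: Kp_def)
    then obtain q r where qr: "p = q * d + r" "r = 0 \<or> degree r < degree d" "\<forall>i. coeff r i \<in> k"
      by blast
    have "r = 0"
    proof (rule ccontr)
      assume "r \<noteq> 0"
      moreover have "poly r b = 0" using that(2) qr(1) d(3) by simp
      ultimately have "P r" using qr(3) by (simp add: P_def Kp_def)
      from e(2)[OF this] show False using qr(2) \<open>r \<noteq> 0\<close> d(2) by simp
    qed
    thus ?thesis using qr(1) by simp
  qed
  have dvd1: "d dvd map_poly of_rat Mb"
    using is_minpolyD(3)[OF Mb] by (intro d_dvd Kp_rat) (simp add: rpoly_def)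
  have dvd2: "d dvd pcompose (map_poly of_rat Ma) [:\<eta>, - of_nat m:]"
  proof (rule d_dvd)
    have "- of_nat m \<in> k" using k_rat[of "- of_nat m"] by (simp add: of_rat_minus)
    thus "pcompose (map_poly of_rat Ma) [:\<eta>, - of_nat m:] \<in> Kp"
      using \<eta>k k0 by (intro Kp_pcompose Kp_rat) (auto simp: Kp_def coeff_pCons split: nat.splits)
    show "poly (pcompose (map_poly of_rat Ma) [:\<eta>, - of_nat m:]) b = 0"
      using is_minpolyD(3)[OF Ma] by (simp add: poly_pcompose \<eta>_def rpoly_def algebra_simps)
  qed
  have root: "\<beta> = b" if "poly d \<beta> = 0" for \<beta>
  proof (rule ccontr)
    assume "\<beta> \<noteq> b"
    have "rpoly Mb \<beta> = 0" using dvd1 that by (auto simp: rpoly_def elim!: dvdE)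
    hence "\<beta> \<in> Rb" by (simp add: Rb_def)
    have "poly (pcompose (map_poly of_rat Ma) [:\<eta>, - of_nat m:]) \<beta> = 0"
      using dvd2 that by (auto elim!: dvdE)
    hence "\<eta> - of_nat m * \<beta> \<in> Ra" by (simp add: poly_pcompose Ra_def rpoly_def algebra_simps)
    moreover have "of_nat m = (\<eta> - of_nat m * \<beta> - a) / (b - \<beta>)"
      using \<open>\<beta> \<noteq> b\<close> by (simp add: \<eta>_def field_simps)
    ultimately have "of_nat m \<in> bad" using \<open>\<beta> \<in> Rb\<close> unfolding bad_def by force
    thus False using m by simp
  qed
  obtain A where A: "size A = degree d" "d = (\<Prod>x\<in>#A. [:- x, 1:])"
    using alg_closed_imp_factorization[OF d(5)] d(1) by auto
  have Ab: "y = b" if "y \<in># A" for y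
    using that by (intro root, subst A(2)) (auto dest!: multi_member_split)
  have "size A \<noteq> 0"
  proof
    assume "size A = 0"
    hence "d = 1" using A(2) by simp
    thus False using d(3) by simp
  qed
  then obtain y B where "A = add_mset y B" by (metis multiset_cases size_empty)
  hence B: "A = add_mset b B" using Ab by auto
  have "B = {#}"
  proof (rule ccontr)
    assume "B \<noteq> {#}"
    then obtain z C where "B = add_mset z C" by (metis multiset_cases)
    hence C: "A = add_mset b (add_mset b C)" using B Ab by auto
    obtain Q where "map_poly of_rat Mb = d * Q" using dvd1 by (elim dvdE)
    hence "map_poly of_rat Mb = [:- b, 1:] * ([:- b, 1:] * ((\<Prod>x\<in>#C. [:- x, 1:]) * Q))"
      unfolding A(2) C by (simp add: mult_ac del: mult_pCons_left mult_pCons_right)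
    hence "poly (pderiv (map_poly of_rat Mb)) b = 0"
      by (simp add: pderiv_mult pderiv_pCons del: mult_pCons_left)
    thus False using is_minpoly_simple_root[OF Mb] by (simp add: rpoly_pderiv)
  qed
  hence "d = [:- b, 1:]" using A(2) B by simp
  hence "- b \<in> k" using d(4) by (auto simp: Kp_def dest: spec[of _ 0])
  hence bk: "b \<in> k" using k_diff[OF k0] by fastforce
  moreover have "of_nat m * b \<in> k" using k_mult[OF k_rat[of "of_nat m"] bk] by simp
  hence "a \<in> k" using k_diff[OF \<eta>k] by (fastforce simp: \<eta>_def)
  ultimately show ?thesis unfolding k_def \<eta>_def by blast
qed

lemma to_ac_of_rat: "to_ac (of_rat q :: 'a :: field_char_0) = of_rat q"
proof -
  obtain r s where q: "q = Rat.Fract r s" "s > 0" by (cases q) auto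
  thus ?thesis by (simp add: of_rat_rat)
qed

lemma to_ac_rpoly: "to_ac (rpoly p (x :: 'a :: field_char_0)) = rpoly p (to_ac x)"
  by (induction p) (auto simp: to_ac_of_rat)

lemma algebraic_int_to_ac:
  assumes "algebraic_int (x :: 'a :: field_char_0)"
  shows "algebraic_int (to_ac x)"
proof -
  obtain p :: "int poly" where p: "poly (of_int_poly p) x = 0" "lead_coeff p = 1"
    using assms unfolding algebraic_int_altdef_ipoly by auto
  have "poly (of_int_poly p) (to_ac x) = to_ac (poly (of_int_poly p) x)"
    by (simp add: rpoly_of_int_poly[symmetric] to_ac_rpoly)
  thus ?thesis using p unfolding algebraic_int_altdef_ipoly by (intro exI[of _ p]) simp
qed

text \<open>
Descends from the algebraic closure of the ambient field, because the embedding into the closure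
is injective and commutes with rational polynomials.
\<close>

lemma primitive_element:
  fixes a b :: "'a :: field_char_0"
  assumes a: "algebraic_int a" and b: "algebraic_int b"
  obtains m :: nat and f h
  where "a = rpoly f (a + of_nat m * b)" "b = rpoly h (a + of_nat m * b)"
proof -
  obtain m :: nat and f h where
    "to_ac a = rpoly f (to_ac a + of_nat m * to_ac b)" "to_ac b = rpoly h (to_ac a + of_nat m * to_ac b)"
    using primitive_element_alg_closed[OF algebraic_int_to_ac[OF a] algebraic_int_to_ac[OF b]] by blast
  moreover have "to_ac a + of_nat m * to_ac b = to_ac (a + of_nat m * b)" by simp
  ultimately have "a = rpoly f (a + of_nat m * b)" "b = rpoly h (a + of_nat m * b)"
    by (metis to_ac_rpoly to_ac_eq_iff)+
  thus ?thesis using that by blast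
qed

lemma common_denominator:
  assumes "finite (Q :: rat set)"
  shows "\<exists>n :: nat. n > 0 \<and> (\<forall>q\<in>Q. \<exists>k :: int. of_nat n * q = of_int k)"
  using assms
proof (induction Q)
  case (insert q Q)
  then obtain n :: nat where n: "n > 0" "\<forall>q\<in>Q. \<exists>k :: int. of_nat n * q = of_int k" by blast
  obtain r s where q: "q = Rat.Fract r s" "s > 0" by (cases q) auto
  have "\<exists>k :: int. of_nat (n * nat s) * x = of_int k" if "x \<in> insert q Q" for x
  proof (cases "x = q")
    case True
    have "of_nat (n * nat s) * q = of_int (int n * r)"
      using q by (simp add: Fract_of_int_quotient)
    thus ?thesis using True by blast
  next
    case False
    hence "x \<in> Q" using that by simp
    then obtain k :: int where "of_nat n * x = of_int k" using n(2) by blast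
    hence "of_nat (n * nat s) * x = of_int (int (nat s) * k)" by (simp add: mult_ac)
    thus ?thesis by blast
  qed
  thus ?case using n(1) q(2) by (intro exI[of _ "n * nat s"]) auto
qed (auto intro: exI[of _ 1])

lemma number_field_closed:
  assumes "number_field K"
  shows "1 \<in> K" "0 \<in> K" "of_rat q \<in> K" "x \<in> K \<Longrightarrow> y \<in> K \<Longrightarrow> x + y \<in> K"
    "x \<in> K \<Longrightarrow> y \<in> K \<Longrightarrow> x - y \<in> K" "x \<in> K \<Longrightarrow> y \<in> K \<Longrightarrow> x * y \<in> K"
    "x \<in> K \<Longrightarrow> inverse x \<in> K"
proof -
  obtain S where S: "rat_vs.span S = K" using assms by (auto simp: number_field_def)
  show one: "1 \<in> K" using assms by (simp add: number_field_def)
  show "0 \<in> K" using rat_vs.span_zero[of S] S by simp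
  show "of_rat q \<in> K" using rat_vs.span_scale[of 1 S q] one S by simp
  show "x \<in> K \<Longrightarrow> y \<in> K \<Longrightarrow> x + y \<in> K" using rat_vs.span_add[of x S y] S by simp
  show "x \<in> K \<Longrightarrow> y \<in> K \<Longrightarrow> x - y \<in> K" "x \<in> K \<Longrightarrow> y \<in> K \<Longrightarrow> x * y \<in> K"
    "x \<in> K \<Longrightarrow> inverse x \<in> K"
    using assms by (simp_all add: number_field_def)
qed

lemma number_field_rpoly:
  assumes "number_field K" "x \<in> K"
  shows "rpoly h x \<in> K"
  by (induction h) (auto intro!: number_field_closed[OF assms(1)] assms(2))

text \<open>
After multiplication by a common denominator \<open>n\<close> of the matrix of \<open>x\<close>, the group generated by a
basis becomes stable under \<open>n * x\<close>.
\<close>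

lemma number_field_scaled_integral:
  assumes K: "number_field K" and x: "x \<in> K"
  shows "\<exists>n :: nat. n > 0 \<and> algebraic_int (of_nat n * x)"
proof -
  obtain bs where bs: "is_rat_basis K bs" using ex_rat_basis[OF K] by blast
  define B where "B = set bs"
  have B: "finite B" "rat_vs.independent B" "rat_vs.span B = K"
    using bs by (auto simp: is_rat_basis_def B_def)
  define c where "c = (\<lambda>b. rat_vs.representation B (x * b))"
  have xb: "x * b = (\<Sum>i\<in>B. of_rat (c b i) * i)" if "b \<in> B" for b
  proof -
    have "x * b \<in> K" using that B(3) rat_vs.span_base[of b B] x by (intro number_field_closed[OF K]) auto
    thus ?thesis unfolding c_def using B rat_vs.sum_representation_eq[of B "x * b" B] by simp
  qed
  obtain n :: nat where n: "n > 0" "\<forall>q\<in>(\<lambda>(b, i). c b i) ` (B \<times> B). \<exists>k :: int. of_nat n * q = of_int k"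
    using common_denominator[of "(\<lambda>(b, i). c b i) ` (B \<times> B)"] B(1) by auto
  hence "\<forall>b i. \<exists>k :: int. b \<in> B \<and> i \<in> B \<longrightarrow> of_nat n * c b i = of_int k" by auto
  then obtain k where k: "\<And>b i. b \<in> B \<Longrightarrow> i \<in> B \<Longrightarrow> of_nat n * c b i = of_int (k b i)" by metis
  have "of_nat n * x * b \<in> int_span B (\<lambda>b. b)" if b: "b \<in> B" for b
  proof -
    have "of_nat n * x * b = (\<Sum>i\<in>B. of_rat (of_nat n * c b i) * i)"
      using xb[OF b] by (simp add: sum_distrib_left of_rat_mult mult.assoc)
    also have "\<dots> = (\<Sum>i\<in>B. of_int (k b i) * i)" using k[OF b] by simp
    finally show ?thesis unfolding int_span_def by (intro image_eqI) auto
  qed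
  moreover have "B \<noteq> {}" using B(3) number_field_closed(1)[OF K] by auto
  then obtain b where "b \<in> B" by blast
  moreover have "b \<noteq> 0" using \<open>b \<in> B\<close> B(2) rat_vs.dependent_zero by blast
  ultimately have "algebraic_int (of_nat n * x)"
    by (intro algebraic_int_if_stable[where I = B and b = "\<lambda>b. b" and k = b] B(1)) auto
  thus ?thesis using n(1) by blast
qed

text \<open>
The elements of a basis are adjoined one at a time, each scaled to an algebraic integer first.
\<close>

lemma number_field_primitive_element:
  assumes K: "number_field K"
  obtains \<theta> where "algebraic_int \<theta>" "\<theta> \<in> K" "K = range (\<lambda>h. rpoly h \<theta>)"
proof -
  obtain bs where bs: "is_rat_basis K bs" using ex_rat_basis[OF K] by blast
  define B where "B = set bs"
  have B: "finite B" "rat_vs.span B = K" using bs by (auto simp: is_rat_basis_def B_def)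
  have BK: "B \<subseteq> K" using B(2) rat_vs.span_superset by blast
  have "\<exists>\<theta>. algebraic_int \<theta> \<and> \<theta> \<in> K \<and> T \<subseteq> range (\<lambda>h. rpoly h \<theta>)" if "finite T" "T \<subseteq> K" for T
    using that
  proof (induction T)
    case empty
    thus ?case using number_field_closed(2)[OF K] by auto
  next
    case (insert b T)
    then obtain \<theta> where \<theta>: "algebraic_int \<theta>" "\<theta> \<in> K" "T \<subseteq> range (\<lambda>h. rpoly h \<theta>)" by auto
    obtain n :: nat where n: "n > 0" "algebraic_int (of_nat n * b)"
      using number_field_scaled_integral[OF K, of b] insert.prems by auto
    obtain m :: nat and f h where fh: "\<theta> = rpoly f (\<theta> + of_nat m * (of_nat n * b))"
       "of_nat n * b = rpoly h (\<theta> + of_nat m * (of_nat n * b))"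
      using primitive_element[OF \<theta>(1) n(2)] .
    define \<eta> where "\<eta> = \<theta> + of_nat m * (of_nat n * b)"
    have of_nat_K: "of_nat k \<in> K" for k using number_field_closed(3)[OF K, of "of_nat k"] by simp
    have "algebraic_int \<eta>" unfolding \<eta>_def
      using \<theta>(1) n(2) by (intro algebraic_int_add algebraic_int_mult[of "of_nat m"]) (auto intro: int_imp_algebraic_int)
    moreover have "\<eta> \<in> K" unfolding \<eta>_def using \<theta>(2) insert.prems
      by (intro number_field_closed[OF K] of_nat_K) auto
    moreover have "T \<subseteq> range (\<lambda>h. rpoly h \<eta>)"
    proof
      fix t assume "t \<in> T"
      then obtain g where "t = rpoly g \<theta>" using \<theta>(3) by blast
      also have "\<dots> = rpoly (pcompose g f) \<eta>" using fh(1) by (simp add: \<eta>_def)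
      finally show "t \<in> range (\<lambda>h. rpoly h \<eta>)" by blast
    qed
    moreover have "b = rpoly (Polynomial.smult (1 / of_nat n) h) \<eta>"
      using fh(2) n(1) unfolding \<eta>_def[symmetric]
      by (simp add: of_rat_divide nonzero_eq_divide_eq mult.commute)
    hence "b \<in> range (\<lambda>h. rpoly h \<eta>)" by blast
    ultimately show ?case by blast
  qed
  from this[OF B(1) BK] obtain \<theta> where
    \<theta>: "algebraic_int \<theta>" "\<theta> \<in> K" "B \<subseteq> range (\<lambda>h. rpoly h \<theta>)" by blast
  have "rat_vs.subspace (range (\<lambda>h. rpoly h \<theta>))"
    unfolding rat_vs.subspace_def
  proof (intro conjI ballI allI)
    show "0 \<in> range (\<lambda>h. rpoly h \<theta>)" by (rule image_eqI[of _ _ 0]) auto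
  next
    fix x y assume "x \<in> range (\<lambda>h. rpoly h \<theta>)" "y \<in> range (\<lambda>h. rpoly h \<theta>)"
    then obtain f h where "x = rpoly f \<theta>" "y = rpoly h \<theta>" by auto
    thus "x + y \<in> range (\<lambda>h. rpoly h \<theta>)" by (intro image_eqI[of _ _ "f + h"]) auto
  next
    fix c x assume "x \<in> range (\<lambda>h. rpoly h \<theta>)"
    then obtain f where "x = rpoly f \<theta>" by auto
    thus "of_rat c * x \<in> range (\<lambda>h. rpoly h \<theta>)"
      by (intro image_eqI[of _ _ "Polynomial.smult c f"]) auto
  qed
  hence "K \<subseteq> range (\<lambda>h. rpoly h \<theta>)" using rat_vs.span_minimal[OF \<theta>(3)] B(2) by simp
  moreover have "range (\<lambda>h. rpoly h \<theta>) \<subseteq> K" using number_field_rpoly[OF K \<theta>(2)] by auto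
  ultimately show ?thesis using that[OF \<theta>(1,2)] by blast
qed

section \<open>Integral coordinates with bounded denominator\<close>

lemma algebraic_int_ipoly:
  fixes x :: "'a :: field_char_0"
  shows "algebraic_int x \<Longrightarrow> algebraic_int (poly (of_int_poly p) x)"
  by (induction p)
     (simp_all add: of_int_hom.map_poly_pCons_hom algebraic_int_add algebraic_int_mult int_imp_algebraic_int)

text \<open>
Split the constant term off a monic integral equation for \<open>w\<close>, after cancelling powers of \<open>w\<close>.
\<close>

lemma algebraic_int_divides_int:
  fixes w :: "'a :: field_char_0"
  assumes w: "algebraic_int w" "w \<noteq> 0"
  obtains N v where "N \<noteq> 0" "algebraic_int v" "of_int N = w * v"
proof -
  obtain p :: "int poly" where "poly (of_int_poly p) w = 0" "lead_coeff p = 1"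
    using w(1) unfolding algebraic_int_altdef_ipoly by auto
  hence "poly (of_int_poly p) w = 0" "p \<noteq> 0" by auto
  hence "\<exists>N v. N \<noteq> 0 \<and> algebraic_int v \<and> of_int N = w * v"
  proof (induction p)
    case (pCons c p)
    show ?case
    proof (cases "c = 0")
      case True
      thus ?thesis using pCons w(2) by (auto simp: of_int_hom.map_poly_pCons_hom)
    next
      case False
      have "of_int (- c) = w * poly (of_int_poly p) w"
        using pCons.prems by (simp add: of_int_hom.map_poly_pCons_hom add_eq_0_iff2)
      thus ?thesis using False algebraic_int_ipoly[OF w(1)] by (intro exI[of _ "- c"]) auto
    qed
  qed auto
  thus ?thesis using that by blast
qed

text \<open>
Interpolation at the complex conjugates \<open>R\<close> of \<open>\<theta>\<close> recovers a polynomial \<open>w\<close> of degree below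
\<open>card R\<close> from its values there.  If these are algebraic integers, then so are the coefficients of
\<open>W * w\<close>, where \<open>W\<close> is the product of all differences of conjugates.  Replacing \<open>W\<close> by a nonzero
integer multiple \<open>N\<close> makes the coefficients rational as well, hence integers.  The integer \<open>N\<close>
depends only on \<open>\<theta>\<close>.
\<close>

lemma integral_coordinates:
  fixes \<theta> :: "'a :: field_char_0"
  assumes M: "is_minpoly M \<theta>" and \<theta>: "algebraic_int \<theta>"
  shows "\<exists>D :: int. D \<noteq> 0 \<and> (\<forall>h. algebraic_int (rpoly h \<theta>) \<longrightarrow>
           (\<exists>u. degree u < degree M \<and> of_int D * rpoly h \<theta> = poly (of_int_poly u) \<theta>))"
proof -
  define R where "R = {y :: complex. rpoly M y = 0}"
  note sp = is_minpoly_split[OF M, where ?'b = complex, folded R_def]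
  have degM: "degree M > 0" by (rule is_minpolyD(5)[OF M])
  have int_R: "algebraic_int y" if "y \<in> R" for y
    using is_minpoly_conjugate_int[OF M, of y "[:0, 1:]"] \<theta> that by (simp add: R_def)
  \<comment> \<open>\<open>V y\<close> is the derivative of the minimal polynomial at \<open>y\<close>, the denominator in Lagrange interpolation.\<close>
  define V where "V = (\<lambda>y. \<Prod>z\<in>R - {y}. y - z)"
  define W where "W = (\<Prod>y\<in>R. V y)"
  have V0: "V y \<noteq> 0" if "y \<in> R" for y using sp(1) by (auto simp: V_def)
  have intV: "algebraic_int (V y)" if "y \<in> R" for y
    unfolding V_def using that int_R by (intro algebraic_int_prod algebraic_int_diff) auto
  have "algebraic_int W" unfolding W_def by (intro algebraic_int_prod intV)
  moreover have "W \<noteq> 0" using V0 sp(1) by (simp add: W_def)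
  ultimately obtain N v where N: "N \<noteq> 0" "algebraic_int v" "of_int N = W * v"
    using algebraic_int_divides_int by blast
  have "\<exists>u. degree u < degree M \<and> of_int N * rpoly h \<theta> = poly (of_int_poly u) \<theta>"
    if h: "algebraic_int (rpoly h \<theta>)" for h
  proof -
    define w where "w = h mod M"
    have "rpoly h \<theta> = rpoly (M * (h div M) + h mod M) \<theta>" by simp
    also have "\<dots> = rpoly w \<theta>"
      unfolding rpoly_add rpoly_mult is_minpolyD(3)[OF M] w_def by simp
    finally have hw: "rpoly h \<theta> = rpoly w \<theta>" .
    have degw: "degree w < degree M"
      using degree_mod_less[OF is_minpolyD(4)[OF M], of h] degM by (auto simp: w_def)
    define P where "P = (map_poly of_rat w :: complex poly)"
    define Z where "Z = (\<lambda>y. \<Prod>z\<in>R - {y}. [:- z, 1:])"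
    define Q where "Q = (\<Sum>y\<in>R. Polynomial.smult (rpoly w y * (\<Prod>z\<in>R - {y}. V z)) (Z y))"
    \<comment> \<open>Both sides have degree below \<open>card R\<close> and agree on \<open>R\<close>.\<close>
    have "Polynomial.smult W P = Q"
    proof (rule poly_eqI_degree)
      fix y assume y: "y \<in> R"
      have "poly Q y = (\<Sum>x\<in>R. rpoly w x * (\<Prod>z\<in>R - {x}. V z) * (\<Prod>z\<in>R - {x}. y - z))"
        by (simp add: Q_def Z_def poly_sum poly_prod)
      also have "\<dots> = (\<Sum>x\<in>{y}. rpoly w x * (\<Prod>z\<in>R - {x}. V z) * (\<Prod>z\<in>R - {x}. y - z))"
        using y sp(1) by (intro sum.mono_neutral_right) auto
      also have "\<dots> = rpoly w y * ((\<Prod>z\<in>R - {y}. V z) * V y)" by (simp add: V_def)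
      also have "(\<Prod>z\<in>R - {y}. V z) * V y = W"
        unfolding W_def using y sp(1) by (subst prod.remove[of R y]) (auto simp: mult.commute)
      finally show "poly (Polynomial.smult W P) y = poly Q y" by (simp add: P_def rpoly_def)
    next
      show "degree (Polynomial.smult W P) < card R"
        using degw degree_smult_le[of W P] by (simp add: P_def sp(2))
    next
      have "degree (Z y) \<le> card R - 1" if "y \<in> R" for y
        using degree_prod_sum_le[of "R - {y}" "\<lambda>z. [:- z, 1:]"] sp(1) that
        by (simp add: Z_def)
      hence "degree Q \<le> card R - 1"
        unfolding Q_def using sp(1) by (intro degree_sum_le) (auto intro: order.trans[OF degree_smult_le])
      thus "degree Q < card R" using degM sp(2) by simp
    qed
    have intQ: "algebraic_int (coeff Q i)" for i
    proof -
      have Z: "algebraic_int (coeff (Z y) i)" for y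
        unfolding Z_def
      proof (rule algebraic_int_coeff_prod)
        fix z i assume "z \<in> R - {y}"
        thus "algebraic_int (coeff [:- z, 1:] i)"
          using int_R[of z] by (simp add: coeff_pCons split: nat.splits)
      qed
      have "algebraic_int (rpoly w y)" if "y \<in> R" for y
        using is_minpoly_conjugate_int[OF M, of y w] that h hw by (simp add: R_def)
      thus ?thesis unfolding Q_def coeff_sum coeff_smult
        by (intro algebraic_int_sum algebraic_int_mult algebraic_int_prod Z intV) auto
    qed
    have "\<exists>k. coeff (Polynomial.smult (of_int N) w) i = of_int k" for i
    proof (rule of_rat_algebraic_int_imp_Ints)
      have "of_rat (coeff (Polynomial.smult (of_int N) w) i) = v * coeff (Polynomial.smult W P) i"
        by (simp add: P_def coeff_map_poly of_rat_mult N(3) mult_ac)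
      also have "algebraic_int \<dots>" unfolding \<open>Polynomial.smult W P = Q\<close>
        by (intro algebraic_int_mult N intQ)
      finally show "algebraic_int (of_rat (coeff (Polynomial.smult (of_int N) w) i) :: complex)" .
    qed
    then obtain u where u: "Polynomial.smult (of_int N) w = of_int_poly u" using ex_int_poly by blast
    have "degree (of_int_poly u :: rat poly) < degree M"
      using degw degree_smult_le[of "of_int N" w] by (simp add: u[symmetric])
    moreover have "poly (of_int_poly u) \<theta> = of_int N * rpoly h \<theta>"
      unfolding rpoly_of_int_poly[symmetric] u[symmetric] hw by simp
    ultimately show ?thesis by (intro exI[of _ u]) simp
  qed
  thus ?thesis using N(1) by blast
qed

section \<open>The norm in the power basis\<close>

lemma dvd_det_column:
  fixes B :: "int mat"
  assumes B: "B \<in> carrier_mat r r" and k: "k < r" and p: "\<And>i. i < r \<Longrightarrow> p dvd B $$ (i, k)"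
  shows "p dvd det B"
  unfolding laplace_expansion_column[OF B k] using p by (intro dvd_sum) auto

lemma sq_dvd_det_two_columns:
  fixes B :: "int mat"
  assumes B: "B \<in> carrier_mat r r" and r: "r \<ge> 2"
    and p0: "\<And>i. i < r \<Longrightarrow> p dvd B $$ (i, 0)" and p1: "\<And>i. i < r \<Longrightarrow> p dvd B $$ (i, 1)"
  shows "p\<^sup>2 dvd det B"
proof -
  have "p\<^sup>2 dvd B $$ (i, 0) * cofactor B i 0" if i: "i < r" for i
  proof -
    have "p dvd det (mat_delete B i 0)"
      by (rule dvd_det_column[of _ "r - 1" 0])
         (use B r i p1 in \<open>auto simp: mat_delete_def\<close>)
    hence "p dvd cofactor B i 0" by (simp add: cofactor_def)
    thus ?thesis using p0[OF i] by (simp add: power2_eq_square mult_dvd_mono)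
  qed
  moreover have "0 < r" using r by simp
  ultimately show ?thesis unfolding laplace_expansion_column[OF B \<open>0 < r\<close>] by (intro dvd_sum) auto
qed

text \<open>
Replacing a column of \<open>B\<close> by \<open>B v\<close> multiplies the determinant by the corresponding entry of \<open>v\<close>
(Cramer's rule), which is normalised to 1 here.
\<close>

lemma dvd_det_of_kernel:
  fixes B :: "int mat" and v :: "int vec"
  assumes B: "B \<in> carrier_mat r r" and r: "r > 0"
    and v: "v \<in> carrier_vec r" "v $ 0 = 1" "\<And>i. i < r \<Longrightarrow> p dvd (B *\<^sub>v v) $ i"
  shows "p dvd det B"
proof -
  have "p dvd det (replace_col B (B *\<^sub>v v) 0)"
    by (rule dvd_det_column[of _ r 0]) (use B r v in \<open>auto simp: replace_col_def\<close>)
  thus ?thesis using cramer_lemma_mat[OF B v(1) r] v(2) by simp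
qed

text \<open>
Two independent vectors in the kernel modulo \<open>p\<close> allow two columns to be replaced by multiples of
\<open>p\<close>, one after the other.  The entry \<open>w $ 0 = 0\<close> makes the second replacement insensitive to the
first.
\<close>

lemma sq_dvd_det_of_kernel:
  fixes B :: "int mat" and v w :: "int vec"
  assumes B: "B \<in> carrier_mat r r" and r: "r \<ge> 2"
    and v: "v \<in> carrier_vec r" "v $ 0 = 1" "\<And>i. i < r \<Longrightarrow> p dvd (B *\<^sub>v v) $ i"
    and w: "w \<in> carrier_vec r" "w $ 0 = 0" "coprime (w $ 1) p" "\<And>i. i < r \<Longrightarrow> p dvd (B *\<^sub>v w) $ i"
  shows "p\<^sup>2 dvd det B"
proof -
  define C where "C = replace_col B (B *\<^sub>v v) 0"
  have C: "C \<in> carrier_mat r r" using B by (simp add: C_def replace_col_def)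
  have Cw: "C *\<^sub>v w = B *\<^sub>v w"
  proof (rule eq_vecI)
    fix i assume "i < dim_vec (B *\<^sub>v w)"
    hence i: "i < r" using B by simp
    have "(\<Sum>j<r. C $$ (i, j) * w $ j) = (\<Sum>j<r. B $$ (i, j) * w $ j)"
      using B i w(2) by (intro sum.cong) (auto simp: C_def replace_col_def)
    thus "(C *\<^sub>v w) $ i = (B *\<^sub>v w) $ i"
      using B C i w(1) by (simp add: scalar_prod_def atLeast0LessThan)
  qed (use B C in auto)
  have "p\<^sup>2 dvd det (replace_col C (C *\<^sub>v w) 1)"
  proof (rule sq_dvd_det_two_columns[of _ r])
    show "replace_col C (C *\<^sub>v w) 1 \<in> carrier_mat r r" using C by (simp add: replace_col_def)
    fix i assume i: "i < r"
    show "p dvd replace_col C (C *\<^sub>v w) 1 $$ (i, 0)"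
      using B C r v(3)[OF i] i by (simp add: replace_col_def C_def)
    show "p dvd replace_col C (C *\<^sub>v w) 1 $$ (i, 1)"
      using B C r w(4)[OF i] i unfolding Cw by (simp add: replace_col_def)
  qed (rule r)
  also have "\<dots> = w $ 1 * det C" using cramer_lemma_mat[OF C w(1), of 1] r by simp
  also have "det C = det B" using cramer_lemma_mat[OF B v(1), of 0] r v(2) by (simp add: C_def)
  finally show ?thesis using w(3)
    by (subst (asm) coprime_dvd_mult_right_iff) (auto simp: coprime_commute)
qed

lemma mult_matrix_mult:
  assumes K: "number_field K" and bs: "is_rat_basis K bs" and x: "x \<in> K" and y: "y \<in> K"
  shows "mult_matrix bs (x * y) = mult_matrix bs x * mult_matrix bs y"
proof (rule eq_matI)
  define rep where "rep = rat_vs.representation (set bs)"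
  have ind: "rat_vs.independent (set bs)" and sp: "rat_vs.span (set bs) = K" and dist: "distinct bs"
    using bs by (auto simp: is_rat_basis_def)
  have mem: "bs ! k \<in> K" if "k < length bs" for k
    using sp that rat_vs.span_base[of "bs ! k" "set bs"] by auto
  fix i j assume "i < dim_row (mult_matrix bs x * mult_matrix bs y)"
    "j < dim_col (mult_matrix bs x * mult_matrix bs y)"
  hence ij: "i < length bs" "j < length bs" by (simp_all add: mult_matrix_def)
  have yb: "y * bs ! j \<in> K" using y mem ij by (intro number_field_closed[OF K])
  define c where "c = (\<lambda>k. rep (y * bs ! j) (bs ! k))"
  have "y * bs ! j = (\<Sum>b\<in>set bs. of_rat (rep (y * bs ! j) b) * b)"
    unfolding rep_def by (rule rat_vs.sum_representation_eq[symmetric]) (use ind sp yb in auto)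
  also have "\<dots> = (\<Sum>k<length bs. of_rat (c k) * bs ! k)"
    unfolding c_def by (rule sum.reindex_bij_betw[symmetric]) (use dist in \<open>auto intro!: bij_betw_nth\<close>)
  finally have "x * (y * bs ! j) = x * (\<Sum>k<length bs. of_rat (c k) * bs ! k)" by (rule arg_cong)
  also have "\<dots> = (\<Sum>k<length bs. of_rat (c k) * (x * bs ! k))"
    by (simp add: sum_distrib_left mult.left_commute)
  finally have "x * (y * bs ! j) = (\<Sum>k<length bs. of_rat (c k) * (x * bs ! k))" .
  moreover have xb: "x * bs ! k \<in> K" if "k < length bs" for k
    using x mem that by (intro number_field_closed[OF K])
  ultimately have "rep (x * (y * bs ! j)) (bs ! i) =
      (\<Sum>k<length bs. rep (of_rat (c k) * (x * bs ! k)) (bs ! i))"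
    using ind sp unfolding rep_def
    by (simp only:) (subst rat_vs.representation_sum, auto intro!: rat_vs.span_scale)
  also have "\<dots> = (\<Sum>k<length bs. c k * rep (x * bs ! k) (bs ! i))"
    using ind sp xb unfolding rep_def
    by (intro sum.cong refl) (simp add: rat_vs.representation_scale)
  finally show "mult_matrix bs (x * y) $$ (i, j) = (mult_matrix bs x * mult_matrix bs y) $$ (i, j)"
    using ij by (simp add: mult_matrix_def scalar_prod_def rep_def c_def mult.assoc atLeast0LessThan
        mult.commute[of "rat_vs.representation (set bs) (x * _) _"])
qed (simp_all add: mult_matrix_def)

lemma field_norm_mult:
  assumes K: "number_field K" and x: "x \<in> K" and y: "y \<in> K"
  shows "field_norm K (x * y) = field_norm K x * field_norm K y"
proof -
  obtain bs where bs: "is_rat_basis K bs" using ex_rat_basis[OF K] by blast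
  have c: "mult_matrix bs z \<in> carrier_mat (length bs) (length bs)" for z
    by (simp add: mult_matrix_def)
  show ?thesis
    using det_mult[OF c c, of x y] x y
    by (simp add: field_norm_eq[OF K bs] number_field_closed[OF K] mult_matrix_mult[OF K bs])
qed

lemma field_norm_of_rat:
  assumes K: "number_field K"
  shows "field_norm K (of_rat c) = c ^ field_degree K"
proof -
  obtain bs where bs: "is_rat_basis K bs" using ex_rat_basis[OF K] by blast
  have ind: "rat_vs.independent (set bs)" and sp: "rat_vs.span (set bs) = K" and dist: "distinct bs"
    using bs by (auto simp: is_rat_basis_def)
  have "mult_matrix bs (of_rat c) = c \<cdot>\<^sub>m 1\<^sub>m (length bs)"
  proof (rule eq_matI)
    fix i j assume "i < dim_row (c \<cdot>\<^sub>m 1\<^sub>m (length bs))" "j < dim_col (c \<cdot>\<^sub>m 1\<^sub>m (length bs))"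
    hence ij: "i < length bs" "j < length bs" by auto
    have "bs ! j \<in> rat_vs.span (set bs)" using ij by (intro rat_vs.span_base) auto
    hence "rat_vs.representation (set bs) (of_rat c * bs ! j) (bs ! i) =
        c * (if i = j then 1 else 0)"
      using ij ind dist
      by (simp add: rat_vs.representation_scale rat_vs.representation_basis nth_eq_iff_index_eq)
    thus "mult_matrix bs (of_rat c) $$ (i, j) = (c \<cdot>\<^sub>m 1\<^sub>m (length bs)) $$ (i, j)"
      using ij by (simp add: mult_matrix_def)
  qed (simp_all add: mult_matrix_def)
  thus ?thesis
    using field_norm_eq[OF K bs number_field_closed(3)[OF K]] field_degree_eq[OF bs]
    by (simp add: det_smult)
qed

lemma field_norm_power:
  assumes "number_field K" "x \<in> K"
  shows "x ^ j \<in> K \<and> field_norm K (x ^ j) = field_norm K x ^ j"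
proof (induction j)
  case 0
  thus ?case using field_norm_of_rat[OF assms(1), of 1] number_field_closed(1)[OF assms(1)] by simp
next
  case (Suc j)
  thus ?case using field_norm_mult[OF assms(1,2), of "x ^ j"] number_field_closed(6)[OF assms(1,2)] by simp
qed

lemma field_norm_nonzero:
  assumes K: "number_field K" and x: "x \<in> K" "x \<noteq> 0"
  shows "field_norm K x \<noteq> 0"
proof
  assume "field_norm K x = 0"
  hence "field_norm K (x * inverse x) = 0"
    using field_norm_mult[OF K x(1) number_field_closed(7)[OF K x(1)]] by simp
  thus False using field_norm_of_rat[OF K, of 1] x(2) by simp
qed

text \<open>
A denominator greater than 1 would have powers exceeding every fixed multiple \<open>d\<close>.
\<close>

lemma rat_bounded_powers_imp_int:
  assumes d: "d \<noteq> 0" and q: "\<And>j. \<exists>k. of_int d * q ^ j = (of_int k :: rat)"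
  shows "\<exists>k. q = of_int k"
proof -
  obtain a b where ab: "q = Rat.Fract a b" "b > 0" "coprime a b" by (cases q) auto
  have "b ^ j dvd d" for j
  proof -
    obtain k where "of_int d * q ^ j = (of_int k :: rat)" using q by blast
    hence "(of_int (d * a ^ j) :: rat) = of_int (k * b ^ j)"
      using ab(2) by (simp add: ab(1) Fract_of_int_quotient field_simps)
    hence "d * a ^ j = k * b ^ j" by (simp only: of_int_eq_iff)
    hence "b ^ j dvd d * a ^ j" by simp
    moreover have "coprime (b ^ j) (a ^ j)" using ab(3) by (simp add: coprime_commute)
    ultimately show ?thesis by (simp add: coprime_dvd_mult_left_iff)
  qed
  from dvd_imp_le_int[OF d this[of "nat \<bar>d\<bar>"]] have le: "b ^ nat \<bar>d\<bar> \<le> \<bar>d\<bar>" using ab(2) by simp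
  have "b = 1"
  proof (rule ccontr)
    assume "b \<noteq> 1"
    hence "2 ^ nat \<bar>d\<bar> \<le> b ^ nat \<bar>d\<bar>" using ab(2) by (intro power_mono) auto
    moreover have "int (nat \<bar>d\<bar>) < 2 ^ nat \<bar>d\<bar>" by (metis of_nat_less_two_power)
    ultimately show False using le by simp
  qed
  thus ?thesis using ab(1) by (auto simp: Fract_of_int_quotient)
qed

lemma power_basis:
  assumes K: "number_field K" and \<theta>: "\<theta> \<in> K" "K = range (\<lambda>h. rpoly h \<theta>)" and M: "is_minpoly M \<theta>"
  shows "is_rat_basis K (map (\<lambda>i. \<theta> ^ i) [0..<degree M])"
proof -
  define r where "r = degree M"
  have small: "h = 0" if "rpoly h \<theta> = 0" "degree h < r" for h
    using is_minpolyD(2)[OF M] that dvd_imp_degree_le[of M h] by (auto simp: r_def)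
  have inj: "inj_on (\<lambda>i. \<theta> ^ i) {..<r}"
  proof (rule inj_onI)
    fix i j assume ij: "i \<in> {..<r}" "j \<in> {..<r}" "\<theta> ^ i = \<theta> ^ j"
    have "degree (monom 1 i - monom 1 j :: rat poly) < r"
      using ij by (intro degree_diff_less) (auto simp: degree_monom_eq)
    hence "monom 1 i - monom (1 :: rat) j = 0" using ij(3) by (intro small) auto
    hence "coeff (monom (1 :: rat) i) j = 1" by simp
    thus "i = j" by (simp split: if_splits)
  qed
  let ?B = "(\<lambda>i. \<theta> ^ i) ` {..<r}"
  have "rat_vs.independent ?B"
  proof
    assume "rat_vs.dependent ?B"
    then obtain u where u: "\<exists>v\<in>?B. u v \<noteq> 0" "(\<Sum>v\<in>?B. of_rat (u v) * v) = 0"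
      by (subst (asm) rat_vs.dependent_finite) auto
    define h where "h = (\<Sum>i<r. monom (u (\<theta> ^ i)) i)"
    have "rpoly h \<theta> = 0" using u(2) inj by (simp add: h_def rpoly_sum sum.reindex)
    moreover have "degree h < r"
      unfolding h_def using is_minpolyD(5)[OF M]
      by (intro degree_sum_less) (auto simp: r_def intro: le_less_trans[OF degree_monom_le])
    ultimately have "h = 0" by (rule small)
    hence "coeff h i = 0" for i by simp
    moreover obtain i where i: "i < r" "u (\<theta> ^ i) \<noteq> 0" using u(1) by auto
    have "coeff h i = u (\<theta> ^ i)" using i by (simp add: h_def coeff_sum)
    ultimately show False using i by simp
  qed
  moreover have "rat_vs.span ?B = K"
  proof
    have "rpoly (monom 1 i) \<theta> \<in> K" for i using \<theta>(2) by blast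
    hence "?B \<subseteq> K" by auto
    moreover have "rat_vs.subspace K"
      unfolding rat_vs.subspace_def by (auto intro!: number_field_closed[OF K])
    ultimately show "rat_vs.span ?B \<subseteq> K" by (rule rat_vs.span_minimal)
  next
    show "K \<subseteq> rat_vs.span ?B"
    proof
      fix x assume "x \<in> K"
      then obtain h where h: "x = rpoly h \<theta>" using \<theta>(2) by blast
      have "rpoly h \<theta> = rpoly (M * (h div M) + h mod M) \<theta>" by simp
      also have "\<dots> = rpoly (h mod M) \<theta>"
        unfolding rpoly_add rpoly_mult is_minpolyD(3)[OF M] by simp
      also have "\<dots> = (\<Sum>i\<le>degree (h mod M). of_rat (coeff (h mod M) i) * \<theta> ^ i)"
        by (rule rpoly_altdef)
      finally have "x = (\<Sum>i\<le>degree (h mod M). of_rat (coeff (h mod M) i) * \<theta> ^ i)" using h by simp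
      moreover have "degree (h mod M) < r"
        using degree_mod_less[OF is_minpolyD(4)[OF M], of h] is_minpolyD(5)[OF M] by (auto simp: r_def)
      ultimately show "x \<in> rat_vs.span ?B"
        by (simp only:) (intro rat_vs.span_sum rat_vs.span_scale rat_vs.span_base, auto)
    qed
  qed
  ultimately show ?thesis using inj
    by (auto simp: is_rat_basis_def distinct_map r_def atLeast0LessThan)
qed

lemma power_basis_coordinate:
  assumes K: "number_field K" and \<theta>: "\<theta> \<in> K" "K = range (\<lambda>h. rpoly h \<theta>)" and M: "is_minpoly M \<theta>"
    and w: "degree w < degree M" and i: "i < degree M"
  shows "rat_vs.representation (set (map (\<lambda>i. \<theta> ^ i) [0..<degree M])) (rpoly w \<theta>) (\<theta> ^ i) = coeff w i"
proof -
  let ?bs = "map (\<lambda>i. \<theta> ^ i) [0..<degree M]"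
  have bs: "is_rat_basis K ?bs" by (rule power_basis[OF K \<theta> M])
  have ind: "rat_vs.independent (set ?bs)" and inj: "inj_on (\<lambda>i. \<theta> ^ i) {..<degree M}"
    using bs by (auto simp: is_rat_basis_def distinct_map atLeast0LessThan)
  have base: "\<theta> ^ k \<in> set ?bs" if "k < degree M" for k using that by auto
  have memspan: "of_rat c * \<theta> ^ k \<in> rat_vs.span (set ?bs)" if "k < degree M" for c k
    by (intro rat_vs.span_scale rat_vs.span_base base that)
  have "rpoly w \<theta> = (\<Sum>k\<le>degree w. of_rat (coeff w k) * \<theta> ^ k)" by (rule rpoly_altdef)
  also have "\<dots> = (\<Sum>k<degree M. of_rat (coeff w k) * \<theta> ^ k)"
    using w by (intro sum.mono_neutral_left) (auto simp: coeff_eq_0)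
  finally have "rpoly w \<theta> = (\<Sum>k<degree M. of_rat (coeff w k) * \<theta> ^ k)" .
  hence "rat_vs.representation (set ?bs) (rpoly w \<theta>) (\<theta> ^ i) =
      (\<Sum>k<degree M. rat_vs.representation (set ?bs) (of_rat (coeff w k) * \<theta> ^ k) (\<theta> ^ i))"
    using ind memspan by (simp only:) (subst rat_vs.representation_sum, auto)
  also have "\<dots> = (\<Sum>k<degree M. coeff w k * (if \<theta> ^ i = \<theta> ^ k then 1 else 0))"
    using ind base
    by (intro sum.cong refl)
       (simp add: rat_vs.representation_scale rat_vs.span_base rat_vs.representation_basis)
  also have "\<dots> = (\<Sum>k<degree M. coeff w k * (if k = i then 1 else 0))"
    using inj i by (intro sum.cong refl) (auto dest: inj_onD)
  finally show ?thesis using i by (simp add: if_distrib[of "\<lambda>t. _ * t"] cong: if_cong)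
qed

text \<open>
In the power basis of \<open>\<theta>\<close>, multiplication by \<open>u(\<theta>)\<close> has an integer matrix \<open>A\<close>, whose column \<open>j\<close>
consists of the coefficients of \<open>u * t ^ j\<close> reduced modulo \<open>g\<close>.  At a root \<open>n\<close> of \<open>g\<close> modulo \<open>p\<close> the
reduction does not change the value, so the row vector of the powers \<open>n ^ i\<close> is a left eigenvector
of \<open>A\<close> modulo \<open>p\<close>, with eigenvalue \<open>u(n)\<close>.
\<close>

lemma norm_of_int_poly:
  fixes g :: "int poly"
  assumes K: "number_field K" and \<theta>: "\<theta> \<in> K" "K = range (\<lambda>h. rpoly h \<theta>)"
    and M: "is_minpoly (of_int_poly g) \<theta>" and g: "lead_coeff g = 1"
  obtains A :: "int mat" where
    "A \<in> carrier_mat (degree g) (degree g)"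
    "field_norm K (poly (of_int_poly u) \<theta>) = of_int (det A)"
    "\<And>n j. j < degree g \<Longrightarrow> poly g n dvd (\<Sum>i<degree g. A $$ (i, j) * n ^ i) - poly u n * n ^ j"
proof -
  define r where "r = degree g"
  have r: "r > 0" using is_minpolyD(5)[OF M] by (simp add: r_def)
  have "\<exists>q w. u * monom 1 j = q * g + w \<and> (w = 0 \<or> degree w < degree g) \<and> (\<forall>i. coeff w i \<in> UNIV)" for j
    by (rule monic_division) (use g in auto)
  hence "\<exists>q w. u * monom 1 j = q * g + w \<and> degree w < r" for j
    using r unfolding r_def by (metis degree_0)
  then obtain q w where qw: "\<And>j. u * monom 1 j = q j * g + w j" "\<And>j. degree (w j) < r" by metis
  define A where "A = mat r r (\<lambda>(i, j). coeff (w j) i)"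
  have A: "A \<in> carrier_mat r r" by (simp add: A_def)
  let ?bs = "map (\<lambda>i. \<theta> ^ i) [0..<degree (of_int_poly g :: rat poly)]"
  have len: "degree (of_int_poly g :: rat poly) = r" by (simp add: r_def)
  have bs: "is_rat_basis K ?bs" by (rule power_basis[OF K \<theta> M])
  have uK: "poly (of_int_poly u) \<theta> \<in> K"
    unfolding rpoly_of_int_poly[symmetric] by (rule number_field_rpoly[OF K \<theta>(1)])
  have "mult_matrix ?bs (poly (of_int_poly u) \<theta>) = of_int_hom.mat_hom A"
  proof (rule eq_matI)
    fix i j assume "i < dim_row (of_int_hom.mat_hom A :: rat mat)" "j < dim_col (of_int_hom.mat_hom A :: rat mat)"
    hence ij: "i < r" "j < r" using A by auto
    have "poly (of_int_poly u) \<theta> * \<theta> ^ j = rpoly (of_int_poly (u * monom 1 j)) \<theta>"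
      by (simp add: rpoly_of_int_poly of_int_poly_hom.hom_mult poly_monom)
    also have "\<dots> = rpoly (of_int_poly (w j)) \<theta>"
      unfolding qw(1) using is_minpolyD(3)[OF M]
      by (simp add: rpoly_of_int_poly of_int_poly_hom.hom_mult of_int_poly_hom.hom_add)
    finally have "poly (of_int_poly u) \<theta> * \<theta> ^ j = rpoly (of_int_poly (w j)) \<theta>" .
    hence "rat_vs.representation (set ?bs) (poly (of_int_poly u) \<theta> * \<theta> ^ j) (\<theta> ^ i) = of_int (coeff (w j) i)"
      using power_basis_coordinate[OF K \<theta> M, of "of_int_poly (w j)" i] qw(2)[of j] ij len by simp
    thus "mult_matrix ?bs (poly (of_int_poly u) \<theta>) $$ (i, j) = of_int_hom.mat_hom A $$ (i, j)"
      using ij len by (simp add: mult_matrix_def A_def)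
  qed (use A len in \<open>simp_all add: mult_matrix_def\<close>)
  hence norm: "field_norm K (poly (of_int_poly u) \<theta>) = of_int (det A)"
    using field_norm_eq[OF K bs uK] by (simp add: of_int_hom.hom_det)
  have "poly g n dvd (\<Sum>i<r. A $$ (i, j) * n ^ i) - poly u n * n ^ j" if j: "j < r" for n j
  proof -
    have "(\<Sum>i<r. A $$ (i, j) * n ^ i) = (\<Sum>i<r. coeff (w j) i * n ^ i)"
      using j by (intro sum.cong) (auto simp: A_def)
    also have "\<dots> = (\<Sum>i\<le>degree (w j). coeff (w j) i * n ^ i)"
      using qw(2)[of j] by (intro sum.mono_neutral_right) (auto simp: coeff_eq_0)
    also have "\<dots> = poly (w j) n" by (simp add: poly_altdef)
    also have "w j = u * monom 1 j - q j * g" using qw(1)[of j] by simp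
    also have "poly \<dots> n - poly u n * n ^ j = poly g n * (- poly (q j) n)" by (simp add: poly_monom)
    finally show ?thesis by simp
  qed
  thus ?thesis using that A norm unfolding r_def by blast
qed

text \<open>
All the arithmetic of \<open>K\<close> that the sieve needs.  The polynomial \<open>U x\<close> represents \<open>D * x\<close> in the power
basis, so that \<open>x \<mapsto> U x (n) / D\<close> is reduction at the degree one prime given by a root \<open>n\<close> of \<open>g\<close>
modulo \<open>p\<close>; the factor \<open>1 / D\<close> is a unit modulo \<open>p\<close> and is left out.  The norm of \<open>x\<close> is an integer
because the powers of the norm have the bounded denominator \<open>D ^ r\<close>.  Its divisibility by \<open>p\<close> and by
\<open>p\<^sup>2\<close> follows from one, respectively two, kernel vectors of the multiplication matrix modulo \<open>p\<close>.
\<close>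

lemma number_field_model:
  fixes K :: "'a :: field_char_0 set"
  assumes K: "number_field K"
  obtains g :: "int poly" and D :: int and U :: "'a \<Rightarrow> int poly" and N :: "'a \<Rightarrow> int" and \<theta> :: 'a
  where "degree g = field_degree K" "lead_coeff g = 1" "is_minpoly (of_int_poly g) \<theta>" "D \<noteq> 0"
    "\<And>x y. x \<in> ring_of_integers K \<Longrightarrow> y \<in> ring_of_integers K \<Longrightarrow> U (x - y) = U x - U y"
    "\<And>x y. x \<in> ring_of_integers K \<Longrightarrow> y \<in> ring_of_integers K \<Longrightarrow> x - y \<in> ring_of_integers K"
    "\<And>x. x \<in> ring_of_integers K \<Longrightarrow> field_norm K x = of_int (N x)"
    "\<And>x. x \<in> ring_of_integers K \<Longrightarrow> x \<noteq> 0 \<Longrightarrow> N x \<noteq> 0"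
    "\<And>x p n. x \<in> ring_of_integers K \<Longrightarrow> prime p \<Longrightarrow> \<not> p dvd D \<Longrightarrow> p dvd poly g n \<Longrightarrow>
       p dvd poly (U x) n \<Longrightarrow> p dvd N x"
    "\<And>x p n m. x \<in> ring_of_integers K \<Longrightarrow> prime p \<Longrightarrow> \<not> p dvd D \<Longrightarrow> p dvd poly g n \<Longrightarrow> p dvd poly g m \<Longrightarrow>
       \<not> p dvd n - m \<Longrightarrow> p dvd poly (U x) n \<Longrightarrow> p dvd poly (U x) m \<Longrightarrow> p\<^sup>2 dvd N x"
proof -
  obtain \<theta> where \<theta>: "algebraic_int \<theta>" "\<theta> \<in> K" "K = range (\<lambda>h. rpoly h \<theta>)"
    using number_field_primitive_element[OF K] .
  obtain M where M: "is_minpoly M \<theta>" using ex_minpoly[OF \<theta>(1)] by blast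
  obtain g where g: "M = of_int_poly g" "lead_coeff g = 1" using minpoly_integral[OF M \<theta>(1)] by blast
  note M' = M[unfolded g(1)]
  define r where "r = degree g"
  have r: "r > 0" using is_minpolyD(5)[OF M'] by (simp add: r_def)
  have deg: "field_degree K = r"
    using field_degree_eq[OF power_basis[OF K \<theta>(2,3) M']] by (simp add: r_def)
  let ?O = "ring_of_integers K"
  obtain D :: int where D: "D \<noteq> 0" "\<And>h. algebraic_int (rpoly h \<theta>) \<Longrightarrow>
      (\<exists>u. degree u < r \<and> of_int D * rpoly h \<theta> = poly (of_int_poly u) \<theta>)"
    using integral_coordinates[OF M \<theta>(1)] by (auto simp: g(1) r_def)
  have "\<exists>u. x \<in> ?O \<longrightarrow> degree u < r \<and> of_int D * x = poly (of_int_poly u) \<theta>" for x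
  proof (cases "x \<in> ?O")
    case True
    then obtain h where "x = rpoly h \<theta>" "algebraic_int x" using \<theta>(3) by (auto simp: ring_of_integers_def)
    thus ?thesis using D(2)[of h] by blast
  qed auto
  then obtain U where U: "\<And>x. x \<in> ?O \<Longrightarrow> degree (U x) < r"
    "\<And>x. x \<in> ?O \<Longrightarrow> of_int D * x = poly (of_int_poly (U x)) \<theta>" by metis
  have O_diff: "x - y \<in> ?O" if "x \<in> ?O" "y \<in> ?O" for x y
    using that by (auto simp: ring_of_integers_def intro: algebraic_int_diff number_field_closed[OF K])
  have O_power: "x ^ j \<in> ?O" if "x \<in> ?O" for x j
    using that field_norm_power[OF K, of x j] by (auto simp: ring_of_integers_def intro: algebraic_int_power)
  have OK: "x \<in> K" if "x \<in> ?O" for x using that by (simp add: ring_of_integers_def)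
  have U_diff: "U (x - y) = U x - U y" if xy: "x \<in> ?O" "y \<in> ?O" for x y
  proof -
    define u where "u = U (x - y) - (U x - U y)"
    have "degree u < r"
      unfolding u_def using U(1)[OF xy(1)] U(1)[OF xy(2)] U(1)[OF O_diff[OF xy]]
      by (intro degree_diff_less)
    have "rpoly (of_int_poly u) \<theta> = 0"
      unfolding u_def rpoly_of_int_poly
      using U(2)[OF xy(1)] U(2)[OF xy(2)] U(2)[OF O_diff[OF xy]]
      by (simp add: of_int_poly_hom.hom_minus of_int_poly_hom.hom_add algebra_simps)
    hence "of_int_poly g dvd (of_int_poly u :: rat poly)" using is_minpolyD(2)[OF M'] by blast
    hence "(of_int_poly u :: rat poly) = 0"
      using dvd_imp_degree_le[of "of_int_poly g" "of_int_poly u :: rat poly"] \<open>degree u < r\<close>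
      by (auto simp: r_def)
    thus ?thesis by (simp add: u_def)
  qed
  have norm_D: "field_norm K (poly (of_int_poly (U x)) \<theta>) = of_int (D ^ r) * field_norm K x"
    if "x \<in> ?O" for x
  proof -
    have "(of_int D :: 'a) = of_rat (of_int D)" by simp
    hence "field_norm K (of_int D * x) = of_int D ^ r * field_norm K x"
      using field_norm_mult[OF K number_field_closed(3)[OF K, of "of_int D"] OK[OF that]]
        field_norm_of_rat[OF K, of "of_int D"] deg by simp
    thus ?thesis using U(2)[OF that] by simp
  qed
  have "\<exists>k. of_int (D ^ r) * field_norm K x ^ j = (of_int k :: rat)" if "x \<in> ?O" for x j
  proof -
    obtain A where "field_norm K (poly (of_int_poly (U (x ^ j))) \<theta>) = of_int (det A)"
      using norm_of_int_poly[OF K \<theta>(2,3) M' g(2)] by metis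
    thus ?thesis using norm_D[OF O_power[OF that]] field_norm_power[OF K OK[OF that], of j] by auto
  qed
  hence "\<exists>k. x \<in> ?O \<longrightarrow> field_norm K x = of_int k" for x
    using rat_bounded_powers_imp_int[of "D ^ r" "field_norm K x"] D(1) by auto
  then obtain N where N: "\<And>x. x \<in> ?O \<Longrightarrow> field_norm K x = of_int (N x)" by metis
  have N0: "N x \<noteq> 0" if "x \<in> ?O" "x \<noteq> 0" for x
    using N[OF that(1)] field_norm_nonzero[OF K OK[OF that(1)] that(2)] by auto
  have main: "p dvd N x \<and> (p dvd poly g m \<longrightarrow> \<not> p dvd n - m \<longrightarrow> p dvd poly (U x) m \<longrightarrow> r \<ge> 2 \<longrightarrow> p\<^sup>2 dvd N x)"
    if x: "x \<in> ?O" and p: "prime p" "\<not> p dvd D" and n: "p dvd poly g n" "p dvd poly (U x) n" for x p n m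
  proof -
    obtain A where A: "A \<in> carrier_mat r r" "field_norm K (poly (of_int_poly (U x)) \<theta>) = of_int (det A)"
      "\<And>n j. j < r \<Longrightarrow> poly g n dvd (\<Sum>i<r. A $$ (i, j) * n ^ i) - poly (U x) n * n ^ j"
      using norm_of_int_poly[OF K \<theta>(2,3) M' g(2), of "U x"] unfolding r_def by metis
    have "(of_int (D ^ r * N x) :: rat) = of_int (det A)"
      using A(2) norm_D[OF x] N[OF x] by simp
    hence DN: "D ^ r * N x = det A" by (simp only: of_int_eq_iff)
    have cop: "coprime (p ^ k) (D ^ r)" for k using p by (simp add: prime_imp_coprime)
    \<comment> \<open>The powers of \<open>n\<close> form a left kernel vector of \<open>A\<close> modulo \<open>p\<close>, hence the transpose.\<close>
    define B where "B = transpose_mat A"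
    have B: "B \<in> carrier_mat r r" "det B = det A" using A(1) by (simp_all add: B_def det_transpose)
    define v where "v = (\<lambda>n :: int. vec r (\<lambda>i. n ^ i))"
    have v: "v n \<in> carrier_vec r" for n by (simp add: v_def)
    have ker: "p dvd (B *\<^sub>v v n) $ j" if "j < r" "p dvd poly g n" "p dvd poly (U x) n" for n j
    proof -
      have "(B *\<^sub>v v n) $ j = (\<Sum>i<r. A $$ (i, j) * n ^ i)"
        using A(1) that by (simp add: B_def v_def scalar_prod_def atLeast0LessThan)
      moreover have "p dvd ((\<Sum>i<r. A $$ (i, j) * n ^ i) - poly (U x) n * n ^ j) + poly (U x) n * n ^ j"
        using A(3)[OF that(1), of n] that by (intro dvd_add) (auto intro: dvd_trans)
      ultimately show ?thesis by simp
    qed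
    have "p dvd det B"
      by (rule dvd_det_of_kernel[OF B(1) r v[of n]]) (use r n ker in \<open>auto simp: v_def\<close>)
    hence 1: "p dvd N x" using cop[of 1] DN B(2) by (metis coprime_dvd_mult_right_iff power_one_right)
    have "p\<^sup>2 dvd N x" if m: "p dvd poly g m" "\<not> p dvd n - m" "p dvd poly (U x) m" and r2: "r \<ge> 2"
    proof -
      \<comment> \<open>The entry of index 0 cancels, and the entry of index 1 is \<open>n - m\<close>, a unit modulo \<open>p\<close>.\<close>
      define w where "w = v n - v m"
      have w: "w \<in> carrier_vec r" by (simp add: w_def v_def)
      have "coprime p (n - m)" using p(1) m(2) by (rule prime_imp_coprime)
      hence w1: "coprime (w $ 1) p" using r2 by (simp add: w_def v_def coprime_commute)
      have "p dvd (B *\<^sub>v w) $ j" if "j < r" for j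
      proof -
        have "B *\<^sub>v w = B *\<^sub>v v n - B *\<^sub>v v m"
          unfolding w_def by (rule mult_minus_distrib_mat_vec[OF B(1) v v])
        thus ?thesis using ker[OF that n] ker[OF that m(1,3)] B(1) that by simp
      qed
      hence "p\<^sup>2 dvd det B"
        by (intro sq_dvd_det_of_kernel[OF B(1) r2 v[of n] _ _ w _ w1])
           (use r n ker in \<open>auto simp: v_def w_def\<close>)
      thus ?thesis using cop[of 2] DN B(2) by (metis coprime_dvd_mult_right_iff)
    qed
    thus ?thesis using 1 by blast
  qed
  have r1: "r \<ge> 2" if "p dvd poly g n" "p dvd poly g m" "\<not> p dvd n - m" for p n m
  proof (rule ccontr)
    assume "\<not> r \<ge> 2"
    hence "degree g = 1" using r by (simp add: r_def)
    hence "g = [:coeff g 0, 1:]"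
      using g(2) by (intro poly_eqI) (auto simp: coeff_pCons coeff_eq_0 split: nat.splits)
    then obtain c where "g = [:c, 1:]" by blast
    hence "poly g n - poly g m = n - m" by simp
    thus False using that by (metis dvd_diff)
  qed
  show ?thesis
  proof (rule that[of g \<theta> D U N])
    show "degree g = field_degree K" using deg by (simp add: r_def)
    show "p dvd N x" if "x \<in> ?O" "prime p" "\<not> p dvd D" "p dvd poly g n" "p dvd poly (U x) n" for x p n
      using main[OF that] by blast
    show "p\<^sup>2 dvd N x" if "x \<in> ?O" "prime p" "\<not> p dvd D" "p dvd poly g n" "p dvd poly g m"
      "\<not> p dvd n - m" "p dvd poly (U x) n" "p dvd poly (U x) m" for x p n m
      using main[OF that(1-4,7)] r1[OF that(4-6)] that(5,6,8) by blast
  qed (fact g(2) M' D(1) U_diff O_diff N N0)+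
qed

section \<open>Prime divisors of the values of a polynomial\<close>

lemma prime_power_dvd_cofactor:
  fixes p :: int
  assumes p: "prime p" and "p ^ a dvd x * y" "\<not> p ^ m dvd x"
  shows "p ^ (Suc a - m) dvd y"
proof -
  have x0: "x \<noteq> 0" using assms(3) by auto
  define v where "v = multiplicity p x"
  obtain x' where x': "x = p ^ v * x'" "\<not> p dvd x'"
    using multiplicity_decompose'[of x p] x0 p unfolding v_def by (metis not_prime_unit)
  have lt: "v < m" using assms(3) unfolding v_def by (metis multiplicity_dvd' not_less)
  have "p ^ (Suc a - m) dvd x' * y" if "Suc a - m > 0"
  proof -
    have "p ^ (Suc a - m) * p ^ v dvd p ^ a"
      unfolding power_add[symmetric] using lt that by (intro le_imp_power_dvd) auto
    also have "p ^ a dvd x * y" by (rule assms(2))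
    also have "x * y = x' * y * p ^ v" by (simp add: x'(1))
    finally show ?thesis using p by simp
  qed
  moreover have "coprime (p ^ (Suc a - m)) x'"
    using p x'(2) by (simp add: prime_imp_coprime)
  ultimately show ?thesis by (cases "Suc a - m > 0") (auto simp: coprime_dvd_mult_right_iff)
qed

text \<open>
A \<open>p\<close>-adic form of the bound for the number of roots, uniform in \<open>p\<close>: a monic polynomial of degree \<open>d\<close> cannot be divisible by a power of \<open>p\<close> beyond \<open>d * (m - 1)\<close> at \<open>d + 1\<close>
points that are incongruent modulo \<open>p ^ m\<close>.  The induction splits off the factor \<open>t - s\<close>, which
absorbs at most \<open>m - 1\<close> factors \<open>p\<close> at every other point.
\<close>

lemma monic_poly_incongruent_values:
  fixes F :: "int poly" and p :: int
  assumes p: "prime p" and m: "m > 0"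
  shows "lead_coeff F = 1 \<Longrightarrow> finite S \<Longrightarrow> card S = Suc (degree F) \<Longrightarrow>
     (\<And>u v. u \<in> S \<Longrightarrow> v \<in> S \<Longrightarrow> u \<noteq> v \<Longrightarrow> \<not> p ^ m dvd u - v) \<Longrightarrow>
     \<exists>n\<in>S. \<not> p ^ Suc (degree F * (m - 1)) dvd poly F n"
proof (induction "degree F" arbitrary: F S)
  case 0
  hence "F = 1" by (auto elim!: degree_eq_zeroE simp: one_pCons)
  moreover obtain n where "n \<in> S" using 0 by (metis card.empty ex_in_conv nat.distinct(1))
  ultimately show ?case using p by (auto simp: not_prime_unit)
next
  case (Suc d)
  obtain s where s: "s \<in> S" using Suc.prems by (metis card.empty ex_in_conv nat.distinct(1))
  define G where "G = synthetic_div F s"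
  have F: "F = [:poly F s:] + [:- s, 1:] * G"
    using synthetic_div_correct'[of s F] by (simp add: G_def add.commute)
  have dG: "degree G = d" using Suc.hyps(2) by (simp add: G_def degree_synthetic_div)
  have "coeff F (Suc d) = coeff G d"
    using dG by (subst F) (simp add: coeff_pCons coeff_eq_0)
  hence lG: "lead_coeff G = 1" using dG Suc by simp
  show ?case
  proof (rule ccontr)
    assume "\<not> ?thesis"
    hence all: "p ^ Suc (Suc d * (m - 1)) dvd poly F n" if "n \<in> S" for n
      using that Suc.hyps(2) by auto
    have "\<exists>n\<in>S - {s}. \<not> p ^ Suc (degree G * (m - 1)) dvd poly G n"
      using Suc.prems s dG Suc.hyps(2) lG by (intro Suc.hyps(1)) auto
    then obtain n where n: "n \<in> S" "n \<noteq> s" "\<not> p ^ Suc (d * (m - 1)) dvd poly G n"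
      using dG by auto
    have "poly F n - poly F s = (n - s) * poly G n" by (subst F) (simp add: algebra_simps)
    hence "p ^ Suc (Suc d * (m - 1)) dvd (n - s) * poly G n"
      using all[OF n(1)] all[OF s] by (metis dvd_diff)
    hence "p ^ (Suc (Suc (Suc d * (m - 1))) - m) dvd poly G n"
      using Suc.prems(4)[OF n(1) s n(2)] by (intro prime_power_dvd_cofactor[OF p])
    moreover have "Suc (Suc (Suc d * (m - 1))) - m = Suc (d * (m - 1))" using m by (cases m) auto
    ultimately have "p ^ Suc (d * (m - 1)) dvd poly G n" by (simp only:)
    thus False using n(3) by blast
  qed
qed

text \<open>
Cut the interval into blocks of length \<open>p ^ m\<close>; distinct points of one block are incongruent modulo
\<open>p ^ m\<close>, so that a block contains at most \<open>degree F\<close> points of the set.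
\<close>

lemma card_prime_power_dvd_values:
  fixes F :: "int poly" and p :: nat
  assumes p: "prime p" and m: "m > 0" and F: "lead_coeff F = 1" and j: "degree F * (m - 1) < j"
  shows "card {k. k < y \<and> int p ^ j dvd poly F (a + int k)} \<le> degree F * (y div p ^ m + 1)"
proof -
  define S where "S = {k. k < y \<and> int p ^ j dvd poly F (a + int k)}"
  define blk where "blk = (\<lambda>b. {k \<in> S. k div p ^ m = b})"
  have ip: "prime (int p)" using p by simp
  have fin: "finite S" by (simp add: S_def)
  have "card (blk b) \<le> degree F" for b
  proof (rule ccontr)
    assume "\<not> card (blk b) \<le> degree F"
    then obtain T where T: "T \<subseteq> blk b" "card T = Suc (degree F)"
      by (meson not_less_eq_eq obtain_subset_with_card_n)
    define T' where "T' = (\<lambda>k. a + int k) ` T"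
    have finT: "finite T" using T by (metis card.infinite nat.distinct(1))
    have "card T' = Suc (degree F)" unfolding T'_def using T(2)
      by (subst card_image) (auto intro!: inj_onI)
    moreover have "\<not> int p ^ m dvd u - v" if uv: "u \<in> T'" "v \<in> T'" "u \<noteq> v" for u v
    proof
      assume d: "int p ^ m dvd u - v"
      obtain k l where kl: "k \<in> T" "l \<in> T" "u = a + int k" "v = a + int l"
        using uv by (auto simp: T'_def)
      have "int (p ^ m) dvd int k - int l" using d kl by simp
      hence "int k mod int (p ^ m) = int l mod int (p ^ m)" by (simp add: mod_eq_dvd_iff)
      hence "k mod p ^ m = l mod p ^ m" by (metis of_nat_eq_iff of_nat_mod)
      moreover have "k div p ^ m = l div p ^ m" using kl T(1) by (auto simp: blk_def)
      ultimately have "k = l" by (metis div_mult_mod_eq)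
      thus False using kl uv by simp
    qed
    ultimately obtain n where n: "n \<in> T'" "\<not> int p ^ Suc (degree F * (m - 1)) dvd poly F n"
      using monic_poly_incongruent_values[OF ip m F, of T'] finT by (auto simp: T'_def)
    obtain k where k: "k \<in> S" "n = a + int k" using n(1) T(1) by (auto simp: T'_def blk_def)
    have "int p ^ j dvd poly F n" using k by (simp add: S_def)
    thus False using n(2) j by (metis Suc_leI power_le_dvd)
  qed
  moreover have "S \<subseteq> (\<Union>b\<in>{..y div p ^ m}. blk b)"
    by (auto simp: blk_def S_def intro!: div_le_mono)
  hence "card S \<le> card (\<Union>b\<in>{..y div p ^ m}. blk b)"
    using fin by (intro card_mono) (auto simp: blk_def)
  hence "card S \<le> (\<Sum>b\<in>{..y div p ^ m}. card (blk b))"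
    using card_UN_le[of "{..y div p ^ m}" blk] by simp
  ultimately have "card S \<le> (\<Sum>b\<in>{..y div p ^ m}. degree F)"
    by (meson order.trans sum_mono)
  thus ?thesis by (simp add: S_def mult.commute)
qed

lemma sum_geometric_le:
  fixes x :: real
  assumes "0 \<le> x" "x \<le> 1 / 2"
  shows "(\<Sum>q<J. x ^ Suc q) \<le> 2 * x"
proof -
  have "(\<Sum>q<J. x ^ Suc q) \<le> 2 * x - 2 * x ^ Suc J"
  proof (induction J)
    case (Suc J)
    have "x ^ Suc (Suc J) \<le> x ^ Suc J / 2"
      using mult_right_mono[OF assms(2), of "x ^ Suc J"] assms(1) by simp
    thus ?case using Suc by simp
  qed simp
  thus ?thesis using assms(1) by (smt (verit) zero_le_power)
qed

text \<open>
Sum the preceding bound over the exponents \<open>Suc i\<close>, taking \<open>m = i div d + 1\<close>, which is the largest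
\<open>m\<close> that the exponent admits.  The first term comes from a geometric series, and the second from
the \<open>+ 1\<close> in each of the \<open>O(ln H / ln p)\<close> exponents that occur.
\<close>

lemma sum_multiplicity_values_le:
  fixes F :: "int poly" and p :: nat
  assumes p: "prime p" and F: "lead_coeff F = 1" and d: "degree F > 0"
    and pos: "\<And>k. k < y \<Longrightarrow> poly F (a + int k) > 0"
    and H: "\<And>k. k < y \<Longrightarrow> poly F (a + int k) \<le> int H" and H0: "H > 0"
  shows "(\<Sum>k<y. real (multiplicity p (nat (poly F (a + int k))))) * ln (real p)
    \<le> 2 * real (degree F)^2 * real y * (ln (real p) / real p) + real (degree F) * ln (real H)"
proof -
  define d where "d = degree F"
  have d0: "d > 0" using \<open>degree F > 0\<close> by (simp add: d_def)
  have p1: "p > 1" using p by (rule prime_gt_1_nat)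
  define f where "f = (\<lambda>k. nat (poly F (a + int k)))"
  have f: "f k > 0" "f k \<le> H" if "k < y" for k using pos[OF that] H[OF that] by (auto simp: f_def)
  define J where "J = nat \<lfloor>ln (real H) / ln (real p)\<rfloor>"
  have lp: "ln (real p) > 0" using p1 by simp
  have Jle: "real J * ln (real p) \<le> ln (real H)"
  proof -
    have "ln (real H) / ln (real p) \<ge> 0" using H0 lp by simp
    hence "real J \<le> ln (real H) / ln (real p)" by (simp add: J_def)
    thus ?thesis using lp by (simp add: field_simps)
  qed
  have mult: "multiplicity p (f k) = card {i. i < J \<and> p ^ Suc i dvd f k}" if k: "k < y" for k
  proof -
    let ?v = "multiplicity p (f k)"
    have iff: "p ^ i dvd f k \<longleftrightarrow> i \<le> ?v" for i
      using f(1)[OF k] p by (intro power_dvd_iff_le_multiplicity) (auto simp: not_prime_unit)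
    have "p ^ ?v \<le> H" using f[OF k] iff[of ?v] by (meson dvd_imp_le le_refl order.trans)
    hence "ln (real p ^ ?v) \<le> ln (real H)" using p1 H0
      by (subst ln_le_cancel_iff) (auto simp flip: of_nat_power)
    hence "real ?v \<le> ln (real H) / ln (real p)" using p1 lp by (simp add: ln_realpow field_simps)
    hence "?v \<le> J" unfolding J_def by linarith
    hence "{i. i < J \<and> p ^ Suc i dvd f k} = {..<?v}" unfolding iff by auto
    thus ?thesis by simp
  qed
  have "(\<Sum>k<y. multiplicity p (f k)) = (\<Sum>k<y. \<Sum>i<J. of_bool (p ^ Suc i dvd f k))"
  proof (rule sum.cong)
    fix k assume "k \<in> {..<y}"
    hence "multiplicity p (f k) = card ({..<J} \<inter> {i. p ^ Suc i dvd f k})"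
      by (subst mult) (auto intro: arg_cong[where f = card])
    thus "multiplicity p (f k) = (\<Sum>i<J. of_bool (p ^ Suc i dvd f k))" by simp
  qed simp
  also have "\<dots> = (\<Sum>i<J. \<Sum>k<y. of_bool (p ^ Suc i dvd f k))" by (rule sum.swap)
  also have "\<dots> \<le> (\<Sum>i<J. d * (y div p ^ Suc (i div d) + 1))"
  proof (rule sum_mono)
    fix i
    have "{k. k < y \<and> p ^ Suc i dvd f k} = {k. k < y \<and> int p ^ Suc i dvd poly F (a + int k)}"
    proof (rule Collect_cong, rule conj_cong)
      fix k assume "k < y"
      hence "poly F (a + int k) = int (f k)" using pos[of k] by (simp add: f_def)
      thus "p ^ Suc i dvd f k \<longleftrightarrow> int p ^ Suc i dvd poly F (a + int k)"
        by (simp only: of_nat_power[symmetric] of_nat_dvd_iff)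
    qed simp
    moreover have "(\<Sum>k<y. of_bool (p ^ Suc i dvd f k)) = card {k. k < y \<and> p ^ Suc i dvd f k}"
      by (simp add: Collect_conj_eq lessThan_def)
    moreover have "d * (Suc (i div d) - 1) < Suc i" by (simp add: less_Suc_eq_le)
    ultimately show "(\<Sum>k<y. of_bool (p ^ Suc i dvd f k)) \<le> d * (y div p ^ Suc (i div d) + 1)"
      using card_prime_power_dvd_values[OF p _ F, of "Suc (i div d)" "Suc i" y a]
      unfolding d_def[symmetric] by simp
  qed
  finally have "real (\<Sum>k<y. multiplicity p (f k)) \<le> real (\<Sum>i<J. d * (y div p ^ Suc (i div d) + 1))"
    by (rule of_nat_mono)
  also have "\<dots> = (\<Sum>i<J. real d * (real (y div p ^ Suc (i div d)) + 1))" by (simp add: algebra_simps)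
  also have "\<dots> \<le> (\<Sum>i<J. real d * (real y * (1 / real p) ^ Suc (i div d) + 1))"
  proof (intro sum_mono mult_left_mono add_mono)
    fix i
    have "y div p ^ Suc (i div d) * p ^ Suc (i div d) \<le> y" by (rule div_times_less_eq_dividend)
    hence "real (y div p ^ Suc (i div d)) * real (p ^ Suc (i div d)) \<le> real y"
      by (metis of_nat_le_iff of_nat_mult)
    hence "real (y div p ^ Suc (i div d)) \<le> real y / real (p ^ Suc (i div d))"
      using p1 by (subst pos_le_divide_eq) auto
    thus "real (y div p ^ Suc (i div d)) \<le> real y * (1 / real p) ^ Suc (i div d)"
      by (simp add: power_divide)
  qed auto
  also have "\<dots> = real d * real y * (\<Sum>i<J. (1 / real p) ^ Suc (i div d)) + real d * real J"
    by (simp add: sum.distrib distrib_left sum_distrib_left mult_ac)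
  also have "(\<Sum>i<J. (1 / real p) ^ Suc (i div d)) \<le> (\<Sum>i<J * d. (1 / real p) ^ Suc (i div d))"
    using d0 by (intro sum_mono2) (auto intro: less_le_trans)
  also have "\<dots> = (\<Sum>q<J. \<Sum>i\<in>{q * d..<q * d + d}. (1 / real p) ^ Suc (i div d))"
    by (rule sum.nat_group[symmetric])
  also have "\<dots> = (\<Sum>q<J. \<Sum>i\<in>{q * d..<q * d + d}. (1 / real p) ^ Suc q)"
  proof (intro sum.cong refl)
    fix q i assume "i \<in> {q * d..<q * d + d}"
    hence "i div d = q" by (intro div_nat_eqI) (auto simp: algebra_simps)
    thus "(1 / real p) ^ Suc (i div d) = (1 / real p) ^ Suc q" by simp
  qed
  also have "\<dots> = real d * (\<Sum>q<J. (1 / real p) ^ Suc q)" by (simp add: sum_distrib_left)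
  also have "(\<Sum>q<J. (1 / real p) ^ Suc q) \<le> 2 * (1 / real p)"
    using p1 by (intro sum_geometric_le) (auto simp: field_simps)
  finally have "real (\<Sum>k<y. multiplicity p (f k)) \<le> real d * real y * (real d * (2 * (1 / real p))) + real d * real J"
    using d0 by (simp add: mult_left_mono)
  hence "real (\<Sum>k<y. multiplicity p (f k)) * ln (real p) \<le>
     (real d * real y * (real d * (2 * (1 / real p))) + real d * real J) * ln (real p)"
    using lp by (intro mult_right_mono) auto
  also have "\<dots> = 2 * real d ^ 2 * real y * (ln (real p) / real p) + real d * (real J * ln (real p))"
    by (simp add: field_simps power2_eq_square)
  also have "\<dots> \<le> 2 * real d ^ 2 * real y * (ln (real p) / real p) + real d * ln (real H)"
    using Jle by (intro add_left_mono mult_left_mono) auto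
  finally show ?thesis by (simp add: f_def d_def)
qed

lemma prime_power_dvd_fact:
  fixes p :: nat
  assumes p: "p > 0"
  shows "p ^ k dvd fact (k * p)"
proof (induction k)
  case (Suc k)
  have "fact (Suc k * p) = Suc k * p * fact (Suc k * p - 1)"
    using p by (subst fact_reduce) auto
  moreover have "(fact (k * p) :: nat) dvd fact (Suc k * p - 1)" using p by (intro fact_dvd) simp
  moreover from this Suc have "p ^ k dvd fact (Suc k * p - 1)" by (metis dvd_trans)
  hence "p * p ^ k dvd Suc k * p * fact (Suc k * p - 1)" by (intro mult_dvd_mono) auto
  ultimately show ?case by (simp only: power_Suc)
qed simp

lemma prod_dvd_if_pairwise_coprime:
  fixes f :: "'i \<Rightarrow> 'a :: semiring_gcd"
  assumes "finite A" "\<And>i. i \<in> A \<Longrightarrow> f i dvd c"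
    "\<And>i j. i \<in> A \<Longrightarrow> j \<in> A \<Longrightarrow> i \<noteq> j \<Longrightarrow> coprime (f i) (f j)"
  shows "prod f A dvd c"
  using assms
proof (induction A)
  case (insert i A)
  have "coprime (f i) (prod f A)" using insert by (intro prod_coprime_right) auto
  moreover have "prod f A dvd c" using insert by auto
  ultimately show ?case using insert.prems(1)[of i] insert.hyps by (simp add: divides_mult)
qed simp

text \<open>
The upper half of Mertens' theorem, in a weak form: \<open>p ^ (z div p)\<close> divides \<open>z!\<close> for every prime \<open>p\<close>,
and \<open>z! \<le> z ^ z\<close>.  Rounding costs the factor 2.
\<close>

lemma sum_ln_prime_over_prime_le:
  fixes z :: nat
  assumes z: "z > 0"
  shows "(\<Sum>p | prime p \<and> p \<le> z. ln (real p) / real p) \<le> 2 * ln (real z)"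
proof -
  let ?P = "{p. prime p \<and> p \<le> z}"
  have fin: "finite ?P" by simp
  have "(\<Prod>p\<in>?P. p ^ (z div p)) dvd (fact z :: nat)"
  proof (rule prod_dvd_if_pairwise_coprime)
    show "finite ?P" by (rule fin)
  next
    fix p assume p: "p \<in> ?P"
    hence "p ^ (z div p) dvd (fact (z div p * p) :: nat)"
      by (intro prime_power_dvd_fact) (auto simp: prime_gt_0_nat)
    also have "(fact (z div p * p) :: nat) dvd fact z" by (intro fact_dvd) simp
    finally show "p ^ (z div p) dvd (fact z :: nat)" .
  next
    fix p q assume "p \<in> ?P" "q \<in> ?P" "p \<noteq> q"
    thus "coprime (p ^ (z div p)) (q ^ (z div q))" by (simp add: primes_coprime)
  qed
  hence "(\<Prod>p\<in>?P. p ^ (z div p)) \<le> (fact z :: nat)" by (intro dvd_imp_le) auto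
  also have "\<dots> \<le> z ^ z" using fact_le_power[of z, where ?'a = nat] by simp
  finally have "real (\<Prod>p\<in>?P. p ^ (z div p)) \<le> real (z ^ z)" by (simp only: of_nat_le_iff)
  moreover have pos: "(\<Prod>p\<in>?P. real p ^ (z div p)) > 0"
    by (intro prod_pos) (auto simp: prime_gt_0_nat)
  ultimately have "ln (\<Prod>p\<in>?P. real p ^ (z div p)) \<le> ln (real z ^ z)"
    using z by (subst ln_le_cancel_iff) auto
  also have "ln (\<Prod>p\<in>?P. real p ^ (z div p)) = (\<Sum>p\<in>?P. real (z div p) * ln (real p))"
    using fin by (subst ln_prod) (auto simp: ln_realpow prime_gt_0_nat)
  also have "ln (real z ^ z) = real z * ln (real z)" using z by (simp add: ln_realpow)
  finally have A: "(\<Sum>p\<in>?P. real (z div p) * ln (real p)) \<le> real z * ln (real z)" .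
  have "real z / 2 * (\<Sum>p\<in>?P. ln (real p) / real p) = (\<Sum>p\<in>?P. (real z / real p / 2) * ln (real p))"
    by (simp add: sum_distrib_left field_simps)
  also have "\<dots> \<le> (\<Sum>p\<in>?P. real (z div p) * ln (real p))"
  proof (intro sum_mono mult_right_mono)
    fix p assume p: "p \<in> ?P"
    hence p0: "p > 0" by (simp add: prime_gt_0_nat)
    have "1 \<le> z div p" using p p0 by (simp add: Suc_le_eq div_greater_zero_iff)
    moreover have "z < p * (z div p) + p" using p0 by (metis add.commute add_less_cancel_left div_mult_mod_eq mod_less_divisor mult.commute)
    ultimately have "z \<le> 2 * (p * (z div p))"
      by (smt (verit) add_mono_thms_linordered_semiring(2) le_trans less_imp_le mult.right_neutral mult_2 mult_le_mono2 nat_less_le)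
    hence "real z \<le> 2 * (real p * real (z div p))" by (metis of_nat_le_iff of_nat_mult of_nat_numeral)
    thus "real z / real p / 2 \<le> real (z div p)" using p0 by (simp add: field_simps)
    show "0 \<le> ln (real p)" using p0 by simp
  qed
  also note A
  finally show ?thesis using z by (simp add: field_simps)
qed

text \<open>
Since \<open>ln p / p\<close> decreases for \<open>p \<ge> 3\<close>, the primes of \<open>S\<close> beyond \<open>z\<close> contribute at most
\<open>ln z / z\<close> each, and there are at most \<open>z\<close> of them.
\<close>

lemma sum_ln_prime_over_prime_card_le:
  fixes z :: nat and S :: "nat set"
  assumes z: "z \<ge> 3" and S: "finite S" "\<And>p. p \<in> S \<Longrightarrow> prime p" "card S \<le> z"
  shows "(\<Sum>p\<in>S. ln (real p) / real p) \<le> 3 * ln (real z)"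
proof -
  let ?A = "{p \<in> S. p \<le> z}" and ?B = "{p \<in> S. p > z}"
  have "(\<Sum>p\<in>S. ln (real p) / real p) = (\<Sum>p\<in>?A \<union> ?B. ln (real p) / real p)"
    by (intro sum.cong) auto
  also have "\<dots> = (\<Sum>p\<in>?A. ln (real p) / real p) + (\<Sum>p\<in>?B. ln (real p) / real p)"
    using S(1) by (intro sum.union_disjoint) auto
  also have "(\<Sum>p\<in>?A. ln (real p) / real p) \<le> (\<Sum>p | prime p \<and> p \<le> z. ln (real p) / real p)"
    using S(2) by (intro sum_mono2) (auto simp: Suc_le_eq dest: prime_gt_0_nat)
  also have "\<dots> \<le> 2 * ln (real z)" using z by (intro sum_ln_prime_over_prime_le) simp
  also have "(\<Sum>p\<in>?B. ln (real p) / real p) \<le> (\<Sum>p\<in>?B. ln (real z) / real z)"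
  proof (rule sum_mono)
    fix p assume "p \<in> ?B"
    moreover have "exp 1 \<le> real z" using z exp_le by linarith
    ultimately show "ln (real p) / real p \<le> ln (real z) / real z" by (intro ln_x_over_x_mono) auto
  qed
  also have "\<dots> = real (card ?B) * (ln (real z) / real z)" by simp
  also have "\<dots> \<le> real z * (ln (real z) / real z)"
  proof -
    have "card ?B \<le> card S" using S(1) by (intro card_mono) auto
    thus ?thesis using S(3) z by (intro mult_right_mono) auto
  qed
  also have "\<dots> = ln (real z)" using z by simp
  finally show ?thesis by simp
qed

text \<open>
The elementary part of Stirling's formula; the induction step is \<open>ln (1 + 1 / n) \<le> 1 / n\<close>.
\<close>

lemma ln_fact_ge: "real n * ln (real n) - real n \<le> ln (fact n)"
proof (induction n)
  case (Suc n)
  show ?case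
  proof (cases "n = 0")
    case False
    hence n: "real n > 0" by simp
    have "1 + 1 / real n = real (Suc n) / real n" using n by (simp add: field_simps)
    hence "ln (real (Suc n)) - ln (real n) = ln (1 + 1 / real n)" using n by (simp add: ln_div)
    also have "\<dots> \<le> 1 / real n" using n by (intro ln_add_one_self_le_self) auto
    finally have "real n * (ln (real (Suc n)) - ln (real n)) \<le> real n * (1 / real n)"
      using n by (intro mult_left_mono) auto
    also have "\<dots> = 1" using n by simp
    finally have 1: "real n * (ln (real (Suc n)) - ln (real n)) \<le> 1" .
    have "(fact (Suc n) :: real) = real (Suc n) * fact n" by (rule fact_Suc)
    hence 2: "ln (fact (Suc n)) = ln (real (Suc n)) + ln (fact n)"
      by (simp only: ln_mult_pos fact_gt_zero of_nat_0_less_iff zero_less_Suc)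
    have 3: "real (Suc n) * x - real (Suc n) = x + real n * (x - y) + (real n * y - real n) - 1" for x y
      by (simp add: algebra_simps)
    show ?thesis using Suc 1 2 3[of "ln (real (Suc n))" "ln (real n)"] by linarith
  qed simp
qed simp

lemma ln_eq_sum_prime_divisors:
  fixes n :: nat
  assumes "n > 0" "finite S" "\<And>p. p \<in> S \<Longrightarrow> prime p" "\<And>p. prime p \<Longrightarrow> p dvd n \<Longrightarrow> p \<in> S"
  shows "ln (real n) = (\<Sum>p\<in>S. real (multiplicity p n) * ln (real p))"
proof -
  have "real n = real (\<Prod>p\<in>prime_factors n. p ^ multiplicity p n)"
    using prime_factorization_nat[OF assms(1)] by simp
  also have "\<dots> = (\<Prod>p\<in>prime_factors n. real p ^ multiplicity p n)" by simp
  finally have "ln (real n) = ln (\<Prod>p\<in>prime_factors n. real p ^ multiplicity p n)" by simp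
  also have "\<dots> = (\<Sum>p\<in>prime_factors n. real (multiplicity p n) * ln (real p))"
    by (subst ln_prod) (auto simp: ln_realpow prime_gt_0_nat in_prime_factors_iff)
  also have "\<dots> = (\<Sum>p\<in>S. real (multiplicity p n) * ln (real p))"
    using assms by (intro sum.mono_neutral_left)
      (auto simp: in_prime_factors_iff not_dvd_imp_multiplicity_0)
  finally show ?thesis .
qed

lemma monic_int_poly_growth:
  fixes F :: "int poly"
  assumes F: "lead_coeff F = 1" and d: "degree F > 0"
  obtains n0 :: nat where "\<And>n :: int. n \<ge> int n0 \<Longrightarrow> n \<le> 2 * poly F n \<and> poly F n \<le> n ^ Suc (degree F)"
proof -
  let ?R = "of_int_poly F :: real poly"
  define P where "P = Polynomial.smult 2 ?R - [:0, 1:]"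
  define Q where "Q = monom 1 (Suc (degree F)) - ?R"
  have degR: "degree ?R = degree F" and lR: "coeff ?R (degree F) = 1"
    using F by simp_all
  have cP: "coeff P (degree F) \<ge> 1"
    using lR d by (simp add: P_def coeff_pCons split: nat.split)
  have "degree P \<le> degree F"
    unfolding P_def using degR d by (intro degree_diff_le) (auto intro: order.trans[OF degree_smult_le])
  moreover have "degree P \<ge> degree F" using cP by (intro le_degree) auto
  ultimately have "lead_coeff P > 0" using cP by simp
  from poly_pinfty_gt_lc[OF this] obtain x1 where x1: "\<And>x. x \<ge> x1 \<Longrightarrow> poly P x \<ge> lead_coeff P" by blast
  have cQ: "coeff Q (Suc (degree F)) = 1" using degR by (simp add: Q_def coeff_eq_0)
  have "degree Q \<le> Suc (degree F)"
    unfolding Q_def using degR by (intro degree_diff_le) (auto simp: degree_monom_eq)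
  moreover have "degree Q \<ge> Suc (degree F)" using cQ by (intro le_degree) auto
  ultimately have "lead_coeff Q > 0" using cQ by simp
  from poly_pinfty_gt_lc[OF this] obtain x2 where x2: "\<And>x. x \<ge> x2 \<Longrightarrow> poly Q x \<ge> lead_coeff Q" by blast
  have "n \<le> 2 * poly F n \<and> poly F n \<le> n ^ Suc (degree F)" if n: "n \<ge> int (nat \<lceil>max x1 x2\<rceil>)" for n :: int
  proof -
    have nx: "real_of_int n \<ge> x1" "real_of_int n \<ge> x2" using n by linarith+
    have e: "poly ?R (of_int n) = of_int (poly F n)" by simp
    have "poly P (of_int n) > 0" using x1[OF nx(1)] \<open>lead_coeff P > 0\<close> by linarith
    hence "real_of_int n < of_int (2 * poly F n)" by (simp add: P_def e)
    moreover have "poly Q (of_int n) > 0" using x2[OF nx(2)] \<open>lead_coeff Q > 0\<close> by linarith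
    hence "real_of_int (poly F n) < of_int (n ^ Suc (degree F))" by (simp add: Q_def e poly_monom)
    ultimately show ?thesis by (simp only: of_int_less_iff less_imp_le)
  qed
  thus ?thesis using that by blast
qed

text \<open>
Chebyshev's comparison.  The left side is a lower bound for the logarithm of the product of \<open>y\<close>
consecutive values of \<open>F\<close>, which are at least half their argument; the right side bounds the same
logarithm through its prime factorisation if at most \<open>z\<close> primes divide these values.
\<close>

lemma sum_ln_values_le:
  fixes F :: "int poly" and n0 y z :: nat
  assumes F: "lead_coeff F = 1" and d: "degree F > 0"
    and growth: "\<And>n :: int. n \<ge> int n0 \<Longrightarrow> n \<le> 2 * poly F n \<and> poly F n \<le> n ^ Suc (degree F)"
    and z: "z \<ge> 3"
    and card: "card {p. prime p \<and> p \<le> (n0 + 1 + y) ^ Suc (degree F) \<and> (\<exists>n. int p dvd poly F n)} \<le> z"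
  shows "real y * ln (real y) - 2 * real y \<le>
    6 * real (degree F)^2 * real y * ln (real z)
      + real z * (real (degree F) * (real (Suc (degree F)) * ln (real (n0 + 1 + y))))"
proof -
  define d where "d = degree F"
  define a where "a = int (n0 + 1)"
  define H where "H = (n0 + 1 + y) ^ Suc d"
  define f where "f = (\<lambda>k. nat (poly F (a + int k)))"
  have pos: "poly F (a + int k) > 0" for k using growth[of "a + int k"] by (simp add: a_def)
  have le_H: "poly F (a + int k) \<le> int H" if "k < y" for k
  proof -
    have "poly F (a + int k) \<le> (a + int k) ^ Suc d"
      using growth[of "a + int k"] by (simp add: a_def d_def)
    also have "\<dots> \<le> int (n0 + 1 + y) ^ Suc d" using that by (intro power_mono) (auto simp: a_def)
    finally show ?thesis unfolding H_def of_nat_power .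
  qed
  have H0: "H > 0" by (simp add: H_def)
  have f: "f k > 0" for k using pos[of k] by (simp add: f_def)
  have fH: "f k \<le> H" if "k < y" for k using le_H[OF that] pos[of k] by (simp add: f_def)
  define S where "S = {p. prime p \<and> p \<le> H \<and> (\<exists>n. int p dvd poly F n)}"
  have finS: "finite S" by (rule finite_subset[of _ "{..H}"]) (auto simp: S_def)
  have cardS: "card S \<le> z" using card by (simp add: S_def H_def d_def)
  have inS: "p \<in> S" if "prime p" "p dvd f k" "k < y" for p k
  proof -
    have "int p dvd int (f k)" using that(2) by simp
    hence "int p dvd poly F (a + int k)" using pos[of k] by (simp add: f_def)
    moreover have "p \<le> H" using that f[of k] fH[of k] dvd_imp_le[of p "f k"] by linarith
    ultimately show ?thesis using that(1) by (auto simp: S_def)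
  qed
  have primeS: "prime p" if "p \<in> S" for p using that by (simp add: S_def)
  have ln_fact_eq: "ln (fact y) = (\<Sum>k<y. ln (real (Suc k)))"
  proof (induction y)
    case (Suc y)
    have "(fact (Suc y) :: real) = real (Suc y) * fact y" by (rule fact_Suc)
    thus ?case using Suc by (simp add: ln_mult_pos del: fact_Suc of_nat_Suc)
  qed simp
  have "real y * ln (real y) - real y - real y * ln 2 \<le> (\<Sum>k<y. ln (real (Suc k)) - ln 2)"
    using ln_fact_ge[of y] by (simp add: ln_fact_eq sum_subtractf)
  also have "\<dots> \<le> (\<Sum>k<y. ln (real (f k)))"
  proof (rule sum_mono)
    fix k
    have "a + int k \<le> 2 * poly F (a + int k)" using growth[of "a + int k"] by (simp add: a_def)
    hence "int (Suc k) \<le> 2 * int (f k)" using pos[of k] by (simp add: f_def a_def)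
    hence "Suc k \<le> 2 * f k" by linarith
    hence "real (Suc k) \<le> real (2 * f k)" by (simp only: of_nat_le_iff)
    hence "real (Suc k) / 2 \<le> real (f k)" by simp
    hence "ln (real (Suc k) / 2) \<le> ln (real (f k))" by (subst ln_le_cancel_iff) (use f[of k] in auto)
    thus "ln (real (Suc k)) - ln 2 \<le> ln (real (f k))" by (simp add: ln_div del: of_nat_Suc)
  qed
  also have "\<dots> = (\<Sum>k<y. \<Sum>p\<in>S. real (multiplicity p (f k)) * ln (real p))"
    using f finS primeS inS by (intro sum.cong refl ln_eq_sum_prime_divisors) auto
  also have "\<dots> = (\<Sum>p\<in>S. (\<Sum>k<y. real (multiplicity p (f k))) * ln (real p))"
    unfolding sum_distrib_right by (rule sum.swap)
  also have "\<dots> \<le> (\<Sum>p\<in>S. 2 * real d ^ 2 * real y * (ln (real p) / real p) + real d * ln (real H))"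
  proof (rule sum_mono)
    fix p assume "p \<in> S"
    thus "(\<Sum>k<y. real (multiplicity p (f k))) * ln (real p) \<le>
        2 * real d ^ 2 * real y * (ln (real p) / real p) + real d * ln (real H)"
      unfolding f_def d_def using pos le_H H0 d F
      by (intro sum_multiplicity_values_le) (auto simp: primeS)
  qed
  also have "\<dots> = 2 * real d ^ 2 * real y * (\<Sum>p\<in>S. ln (real p) / real p) + real (card S) * (real d * ln (real H))"
    by (simp add: sum.distrib sum_distrib_left)
  also have "\<dots> \<le> 2 * real d ^ 2 * real y * (3 * ln (real z)) + real z * (real d * ln (real H))"
    using sum_ln_prime_over_prime_card_le[OF z finS primeS cardS] cardS H0
    by (intro add_mono mult_left_mono mult_right_mono) auto
  also have "ln (real H) = real (Suc d) * ln (real (n0 + 1 + y))"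
    unfolding H_def of_nat_power by (rule ln_realpow)
  finally have "real y * ln (real y) - real y - real y * ln 2 \<le>
     2 * real d ^ 2 * real y * (3 * ln (real z)) + real z * (real d * (real (Suc d) * ln (real (n0 + 1 + y))))" .
  moreover have "real y * ln 2 \<le> real y * 1" using ln_2_less_1 by (intro mult_left_mono) auto
  ultimately show ?thesis unfolding d_def by (simp add: algebra_simps)
qed

text \<open>
If fewer than \<open>y powr \<delta>\<close> primes occurred, Chebyshev's comparison would bound \<open>y ln y - 2 y\<close> by
\<open>6 d\<^sup>2 \<delta> y ln y\<close> plus terms of lower order; the choice \<open>\<delta> = 1 / (24 d\<^sup>2)\<close> makes this impossible for
large \<open>y\<close>.
\<close>

lemma prime_divisors_of_initial_values:
  fixes F :: "int poly"
  assumes F: "lead_coeff F = 1" and d: "degree F > 0"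
  obtains n0 :: nat and \<delta> :: real where "\<delta> > 0"
    "eventually (\<lambda>y :: nat. real y powr \<delta> \<le>
       real (card {p. prime p \<and> p \<le> (n0 + 1 + y) ^ Suc (degree F) \<and> (\<exists>n. int p dvd poly F n)})) sequentially"
proof -
  obtain n0 :: nat where n0: "\<And>n :: int. n \<ge> int n0 \<Longrightarrow> n \<le> 2 * poly F n \<and> poly F n \<le> n ^ Suc (degree F)"
    using monic_int_poly_growth[OF F d] by blast
  define d where "d = real (degree F)"
  have d1: "d \<ge> 1" using \<open>degree F > 0\<close> by (simp add: d_def)
  define \<delta> where "\<delta> = 1 / (24 * d^2)"
  have \<delta>: "\<delta> > 0" "\<delta> \<le> 1 / 2" "6 * d^2 * \<delta> = 1 / 4"
  proof -
    have dd: "d^2 \<ge> 1" using d1 by (simp add: one_le_power)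
    show "\<delta> > 0" "6 * d^2 * \<delta> = 1 / 4" using d1 by (simp_all add: \<delta>_def)
    show "\<delta> \<le> 1 / 2" unfolding \<delta>_def using dd by (subst divide_le_eq) auto
  qed
  define c where "c = d * (d + 1)"
  define b where "b = real n0 + 1"
  have c: "c > 0" "b > 0" using d1 by (simp_all add: c_def b_def)
  have "eventually (\<lambda>y :: real. sqrt y * (c * ln (b + y)) + 2 * y < 3 / 4 * (y * ln y)) at_top"
    using c by real_asymp
  hence ev1: "eventually (\<lambda>y :: nat. sqrt (real y) * (c * ln (b + real y)) + 2 * real y < 3 / 4 * (real y * ln (real y))) sequentially"
    by (rule eventually_compose_filterlim[OF _ filterlim_real_sequentially])
  have "eventually (\<lambda>y :: real. y powr \<delta> \<ge> 3) at_top" using \<delta>(1) by real_asymp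
  hence ev2: "eventually (\<lambda>y :: nat. real y powr \<delta> \<ge> 3) sequentially"
    by (rule eventually_compose_filterlim[OF _ filterlim_real_sequentially])
  have "eventually (\<lambda>y :: nat. real y powr \<delta> \<le>
       real (card {p. prime p \<and> p \<le> (n0 + 1 + y) ^ Suc (degree F) \<and> (\<exists>n. int p dvd poly F n)})) sequentially"
    using ev1 ev2 eventually_ge_at_top[of 1]
  proof eventually_elim
    case (elim y)
    let ?S = "{p. prime p \<and> p \<le> (n0 + 1 + y) ^ Suc (degree F) \<and> (\<exists>n. int p dvd poly F n)}"
    define z where "z = nat \<lfloor>real y powr \<delta>\<rfloor>"
    have y: "real y \<ge> 1" using elim by simp
    have z: "z \<ge> 3" "real z \<le> real y powr \<delta>" "real y powr \<delta> < real z + 1"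
      using elim(2) unfolding z_def by linarith+
    show ?case
    proof (rule ccontr)
      assume "\<not> ?case"
      hence "card ?S \<le> z" using z(3) by linarith
      from sum_ln_values_le[OF F \<open>degree F > 0\<close> n0 z(1) this]
      have main: "real y * ln (real y) - 2 * real y \<le> 6 * d^2 * real y * ln (real z) + real z * (c * ln (b + real y))"
        by (simp add: d_def c_def b_def algebra_simps)
      have "ln (real z) \<le> \<delta> * ln (real y)"
      proof -
        have "ln (real z) \<le> ln (real y powr \<delta>)" using z y by (subst ln_le_cancel_iff) auto
        thus ?thesis using y by (simp add: ln_powr)
      qed
      hence "6 * d^2 * real y * ln (real z) \<le> 6 * d^2 * real y * (\<delta> * ln (real y))"
        by (intro mult_left_mono) auto
      also have "\<dots> = (6 * d^2 * \<delta>) * (real y * ln (real y))" by (simp add: mult_ac)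
      also have "\<dots> = 1 / 4 * (real y * ln (real y))" unfolding \<delta>(3) ..
      finally have le1: "6 * d^2 * real y * ln (real z) \<le> 1 / 4 * (real y * ln (real y))" .
      have "real z * (c * ln (b + real y)) \<le> sqrt (real y) * (c * ln (b + real y))"
      proof (rule mult_right_mono)
        have "real y powr \<delta> \<le> real y powr (1 / 2)" using y \<delta>(2) by (intro powr_mono) auto
        thus "real z \<le> sqrt (real y)" using z(2) y by (simp add: powr_half_sqrt)
        show "0 \<le> c * ln (b + real y)" using c y by (intro mult_nonneg_nonneg) auto
      qed
      thus False using main le1 elim(1) by linarith
    qed
  qed
  thus ?thesis using that \<delta>(1) by blast
qed

text \<open>
Rescales the previous bound from the number \<open>y\<close> of values to the size \<open>x\<close> of the primes, which is
polynomial in \<open>y\<close>.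
\<close>

lemma many_prime_divisors_of_values:
  fixes F :: "int poly"
  assumes F: "lead_coeff F = 1" and d: "degree F > 0"
  obtains \<delta> :: real where "\<delta> > 0"
    "eventually (\<lambda>x :: real. x powr \<delta> \<le> real (card {p :: nat. prime p \<and> real p \<le> x \<and> (\<exists>n. int p dvd poly F n)})) at_top"
proof -
  define d where "d = degree F"
  define e where "e = 1 / (2 * real (Suc d))"
  have e: "e > 0" by (simp add: e_def)
  obtain n0 :: nat and \<delta> :: real where \<delta>: "\<delta> > 0"
    "eventually (\<lambda>y :: nat. real y powr \<delta> \<le>
       real (card {p. prime p \<and> p \<le> (n0 + 1 + y) ^ Suc d \<and> (\<exists>n. int p dvd poly F n)})) sequentially"
    using prime_divisors_of_initial_values[OF F \<open>degree F > 0\<close>] unfolding d_def .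
  obtain Y where Y: "\<And>y. y \<ge> Y \<Longrightarrow> real y powr \<delta> \<le>
       real (card {p. prime p \<and> p \<le> (n0 + 1 + y) ^ Suc d \<and> (\<exists>n. int p dvd poly F n)})"
    using \<delta>(2) by (auto simp: eventually_at_top_linorder)
  define T where "T = real (max Y (n0 + 4)) + 1"
  have "eventually (\<lambda>x :: real. x powr e \<ge> T) at_top" using e by real_asymp
  hence "eventually (\<lambda>x :: real. x powr (e * \<delta> / 2) \<le>
      real (card {p :: nat. prime p \<and> real p \<le> x \<and> (\<exists>n. int p dvd poly F n)})) at_top"
    using eventually_gt_at_top[of 0]
  proof eventually_elim
    case (elim x)
    define t where "t = x powr e"
    define y where "y = nat \<lfloor>t\<rfloor>"
    have t: "t \<ge> T" using elim by (simp add: t_def)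
    have T: "T \<ge> 5" by (simp add: T_def)
    have yt: "real y \<le> t" "t < real y + 1" using t T by (simp_all add: y_def)
    have yY: "y \<ge> Y" "y \<ge> n0 + 4" using t yt unfolding T_def by linarith+
    have "n0 + 1 + y \<le> y * 2" using yY by simp
    also have "\<dots> \<le> y ^ 2" unfolding power2_eq_square using yY by (intro mult_left_mono) auto
    finally have "(n0 + 1 + y) ^ Suc d \<le> (y ^ 2) ^ Suc d" by (rule power_mono) simp
    hence "real ((n0 + 1 + y) ^ Suc d) \<le> real ((y ^ 2) ^ Suc d)" by (simp only: of_nat_le_iff)
    also have "\<dots> = real y ^ (2 * Suc d)" by (simp only: of_nat_power power_mult)
    also have "\<dots> \<le> t ^ (2 * Suc d)" using yt by (intro power_mono) auto
    also have "\<dots> = t powr real (2 * Suc d)" by (rule powr_realpow[symmetric]) (use t T in linarith)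
    also have "\<dots> = x powr (e * real (2 * Suc d))" by (simp add: t_def powr_powr)
    also have "e * real (2 * Suc d) = 1" by (simp add: e_def field_simps)
    finally have Hx: "real ((n0 + 1 + y) ^ Suc d) \<le> x" using elim by simp
    have sqrt_le: "t powr (1 / 2) \<le> real y"
    proof -
      have "sqrt t \<le> t - 1"
      proof (rule real_le_lsqrt)
        show "t \<le> (t - 1)^2"
          using mult_right_mono[of 4 t "t - 1"] t T by (simp add: power2_eq_square algebra_simps)
      qed (use t T in auto)
      thus ?thesis using yt t T by (simp add: powr_half_sqrt)
    qed
    have "x powr (e * \<delta> / 2) = (t powr (1 / 2)) powr \<delta>" by (simp add: t_def powr_powr mult_ac)
    also have "\<dots> \<le> real y powr \<delta>" using sqrt_le \<delta>(1) by (intro powr_mono2) auto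
    also have "real y powr \<delta> \<le>
       real (card {p. prime p \<and> p \<le> (n0 + 1 + y) ^ Suc d \<and> (\<exists>n. int p dvd poly F n)})"
      by (rule Y[OF yY(1)])
    also have "\<dots> \<le> real (card {p :: nat. prime p \<and> real p \<le> x \<and> (\<exists>n. int p dvd poly F n)})"
    proof (intro of_nat_mono card_mono)
      show "finite {p :: nat. prime p \<and> real p \<le> x \<and> (\<exists>n. int p dvd poly F n)}"
      proof (rule finite_subset)
        show "{p :: nat. prime p \<and> real p \<le> x \<and> (\<exists>n. int p dvd poly F n)} \<subseteq> {..nat \<lfloor>x\<rfloor>}"
          by (auto simp: le_nat_floor)
      qed simp
      have "real p \<le> x" if "p \<le> (n0 + 1 + y) ^ Suc d" for p
      proof -
        have "real p \<le> real ((n0 + 1 + y) ^ Suc d)" using that by (simp only: of_nat_le_iff)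
        thus ?thesis using Hx by (rule order.trans)
      qed
      thus "{p. prime p \<and> p \<le> (n0 + 1 + y) ^ Suc d \<and> (\<exists>n. int p dvd poly F n)} \<subseteq>
        {p. prime p \<and> real p \<le> x \<and> (\<exists>n. int p dvd poly F n)}" by blast
    qed
    finally show ?case .
  qed
  thus ?thesis using that[of "e * \<delta> / 2"] e \<delta>(1) by simp
qed

section \<open>Two roots modulo a prime\<close>

text \<open>
Over the rationals divisibility is the defining property of the minimal polynomial; division by
the monic \<open>F\<close> keeps the quotient integral.
\<close>

lemma minpoly_dvd_int:
  fixes F G :: "int poly"
  assumes M: "is_minpoly (of_int_poly F) \<eta>" and F: "lead_coeff F = 1" and G: "poly (of_int_poly G) \<eta> = 0"
  shows "F dvd G"
proof -
  have "\<exists>q r. G = q * F + r \<and> (r = 0 \<or> degree r < degree F) \<and> (\<forall>i. coeff r i \<in> UNIV)"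
    by (rule monic_division) (use F in auto)
  then obtain q r where qr: "G = q * F + r" "r = 0 \<or> degree r < degree F" by blast
  have F0: "poly (of_int_poly F) \<eta> = 0" using is_minpolyD(3)[OF M] by (simp add: rpoly_of_int_poly)
  have "poly (of_int_poly r) \<eta> = 0"
    using G F0 unfolding qr(1) by (simp add: of_int_poly_hom.hom_add of_int_poly_hom.hom_mult)
  hence "rpoly (of_int_poly r) \<eta> = 0" by (simp add: rpoly_of_int_poly)
  hence "of_int_poly F dvd (of_int_poly r :: rat poly)" using is_minpolyD(2)[OF M] by blast
  moreover have "degree F \<le> degree r" if "r \<noteq> 0"
    using dvd_imp_degree_le[OF calculation] that by simp
  ultimately have "r = 0" using qr(2) by linarith
  thus ?thesis using qr(1) by simp
qed

lemma clear_denominators: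
  fixes f h :: "rat poly"
  obtains e :: nat and f' h' where "e > 0" "Polynomial.smult (of_nat e) f = of_int_poly f'"
    "Polynomial.smult (of_nat e) h = of_int_poly h'"
proof -
  obtain e :: nat where e: "e > 0"
    "\<forall>q\<in>coeff f ` {..degree f} \<union> coeff h ` {..degree h}. \<exists>k :: int. of_nat e * q = of_int k"
    using common_denominator[of "coeff f ` {..degree f} \<union> coeff h ` {..degree h}"] by auto
  have "\<exists>k :: int. coeff (Polynomial.smult (of_nat e) p) i = of_int k" if "p = f \<or> p = h" for p i
  proof (cases "i \<le> degree p")
    case True
    thus ?thesis using e(2) that by auto
  next
    case False
    thus ?thesis by (intro exI[of _ 0]) (simp add: coeff_eq_0)
  qed
  hence "\<exists>p'. Polynomial.smult (of_nat e) p = of_int_poly p'" if "p = f \<or> p = h" for p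
    using that by (intro ex_int_poly) auto
  thus ?thesis using that e(1) by metis
qed

text \<open>
Two conjugates \<open>\<alpha>\<close>, \<open>\<beta>\<close> of \<open>\<theta>\<close> are rational polynomials in one number \<open>\<eta>\<close> with minimal polynomial \<open>F\<close>.
With denominators cleared, the relations \<open>g(\<alpha>) = 0\<close> and \<open>g(\<beta>) = 0\<close> say that \<open>F\<close> divides certain
integer polynomials, so they persist modulo \<open>p\<close> at every root of \<open>F\<close> modulo \<open>p\<close>.  The inequality
\<open>\<alpha> \<noteq> \<beta>\<close> persists through a Bezout identity for \<open>F\<close> and the difference of the two polynomials.  The
exceptional primes divide the denominators involved, which are collected in \<open>E\<close>.
\<close>

lemma two_roots_mod_prime:
  fixes g :: "int poly" and \<theta> :: "'a :: field_char_0"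
  assumes M: "is_minpoly (of_int_poly g) \<theta>" and g: "lead_coeff g = 1" and deg: "degree g \<ge> 2"
    and \<theta>: "algebraic_int \<theta>"
  obtains F :: "int poly" and E :: int where "lead_coeff F = 1" "degree F > 0" "E \<noteq> 0"
    "\<And>p n. prime p \<Longrightarrow> \<not> p dvd E \<Longrightarrow> p dvd poly F n \<Longrightarrow>
       \<exists>n1 n2. p dvd poly g n1 \<and> p dvd poly g n2 \<and> \<not> p dvd n1 - n2"
proof -
  define r where "r = degree g"
  define R where "R = {y :: complex. rpoly (of_int_poly g) y = 0}"
  note sp = is_minpoly_split[OF M, where ?'b = complex, folded R_def]
  have "card R \<ge> 2" using sp(2) deg by simp
  then obtain \<alpha> \<beta> where ab: "\<alpha> \<in> R" "\<beta> \<in> R" "\<alpha> \<noteq> \<beta>"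
    by (metis card_2_iff' obtain_subset_with_card_n subsetD)
  have int: "algebraic_int y" if "y \<in> R" for y
    using is_minpoly_conjugate_int[OF M, of y "[:0, 1:]"] \<theta> that by (simp add: R_def)
  obtain m :: nat and f h where fh: "\<alpha> = rpoly f (\<alpha> + of_nat m * \<beta>)" "\<beta> = rpoly h (\<alpha> + of_nat m * \<beta>)"
    using primitive_element[OF int[OF ab(1)] int[OF ab(2)]] .
  define \<eta> where "\<eta> = \<alpha> + of_nat m * \<beta>"
  have int_\<eta>: "algebraic_int \<eta>" unfolding \<eta>_def
    using int ab by (intro algebraic_int_add algebraic_int_mult) (auto intro: int_imp_algebraic_int)
  obtain M\<eta> where M\<eta>: "is_minpoly M\<eta> \<eta>" using ex_minpoly[OF int_\<eta>] by blast
  obtain F where F: "M\<eta> = of_int_poly F" "lead_coeff F = 1" using minpoly_integral[OF M\<eta> int_\<eta>] by blast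
  note MF = M\<eta>[unfolded F(1)]
  have degF: "degree F > 0" using is_minpolyD(5)[OF MF] by simp
  obtain e :: nat and f' h' where e: "e > 0" "Polynomial.smult (of_nat e) f = of_int_poly f'"
    "Polynomial.smult (of_nat e) h = of_int_poly h'" by (rule clear_denominators)
  have f'\<eta>: "poly (of_int_poly f') \<eta> = of_nat e * \<alpha>"
    unfolding rpoly_of_int_poly[symmetric] e(2)[symmetric] using fh(1) by (simp add: \<eta>_def)
  have h'\<eta>: "poly (of_int_poly h') \<eta> = of_nat e * \<beta>"
    unfolding rpoly_of_int_poly[symmetric] e(3)[symmetric] using fh(2) by (simp add: \<eta>_def)
  \<comment> \<open>\<open>G u\<close> is \<open>e ^ r * g (u / e)\<close>, made integral.\<close>
  define G where "G = (\<lambda>u :: int poly. \<Sum>k\<le>r. Polynomial.smult (coeff g k * int e ^ (r - k)) (u ^ k))"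
  have G: "F dvd G u" if u: "poly (of_int_poly u) \<eta> = of_nat e * y" "y \<in> R" for u y
  proof (rule minpoly_dvd_int[OF MF F(2)])
    have "poly (of_int_poly (G u)) \<eta> = (\<Sum>k\<le>r. of_int (coeff g k) * of_nat e ^ (r - k) * (of_nat e * y) ^ k)"
      by (simp add: G_def of_int_poly_hom.hom_sum poly_sum of_int_hom.map_poly_hom_smult of_int_poly_hom.hom_power u(1))
    also have "\<dots> = (\<Sum>k\<le>r. of_nat e ^ r * (of_int (coeff g k) * y ^ k))"
    proof (intro sum.cong refl)
      fix k assume "k \<in> {..r}"
      hence "(of_nat e :: complex) ^ r = of_nat e ^ (r - k) * of_nat e ^ k" by (simp flip: power_add)
      thus "of_int (coeff g k) * of_nat e ^ (r - k) * (of_nat e * y) ^ k = of_nat e ^ r * (of_int (coeff g k) * y ^ k)"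
        by (simp add: power_mult_distrib mult_ac)
    qed
    also have "\<dots> = of_nat e ^ r * poly (of_int_poly g) y"
      by (simp add: sum_distrib_left[symmetric] poly_altdef r_def)
    also have "\<dots> = 0" using u(2) by (simp add: R_def rpoly_of_int_poly)
    finally show "poly (of_int_poly (G u)) \<eta> = 0" .
  qed
  define w where "w = f' - h'"
  have "rpoly (of_int_poly w) \<eta> \<noteq> 0"
    unfolding rpoly_of_int_poly w_def using f'\<eta> h'\<eta> e(1) ab(3)
    by (simp add: of_int_poly_hom.hom_minus)
  then obtain s t :: "rat poly" where st: "s * of_int_poly F + t * of_int_poly w = 1" using is_minpoly_bezout[OF MF] by blast
  obtain c :: nat and s' t' where c: "c > 0" "Polynomial.smult (of_nat c) s = of_int_poly s'"
    "Polynomial.smult (of_nat c) t = of_int_poly t'" by (rule clear_denominators)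
  have "Polynomial.smult (of_nat c) (s * of_int_poly F + t * of_int_poly w) = of_int_poly (s' * F + t' * w)"
    by (simp add: smult_add_right of_int_poly_hom.hom_add of_int_poly_hom.hom_mult c(2,3)[symmetric])
  hence "of_int_poly (s' * F + t' * w) = (of_int_poly [:int c:] :: rat poly)"
    unfolding st by (simp add: of_int_hom.map_poly_pCons_hom)
  hence bez: "s' * F + t' * w = [:int c:]" by (simp only: of_int_poly_hom.eq_iff)
  show ?thesis
  proof (rule that[OF F(2) degF, of "int e * int c"])
    show "int e * int c \<noteq> 0" using e(1) c(1) by simp
    fix p n assume p: "prime p" "\<not> p dvd int e * int c" "p dvd poly F n"
    have pe: "\<not> p dvd int e" and pc: "\<not> p dvd int c" using p(2) by auto
    have "coprime (int e) p" using p(1) pe by (metis coprime_commute prime_imp_coprime)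
    then obtain e' where e': "[int e * e' = 1] (mod p)" using cong_solve_coprime_int by blast
    have root: "p dvd poly g (e' * poly u n)" if u: "F dvd G u" for u
    proof -
      have "[int e ^ r * poly g (e' * poly u n) = poly (G u) n] (mod p)"
      proof -
        have "int e ^ r * poly g (e' * v) = (\<Sum>k\<le>r. coeff g k * int e ^ (r - k) * ((int e * e') ^ k * v ^ k))" for v
          unfolding poly_altdef r_def[symmetric] sum_distrib_left
        proof (intro sum.cong refl)
          fix k assume "k \<in> {..r}"
          hence "int e ^ r = int e ^ (r - k) * int e ^ k" by (simp flip: power_add)
          thus "int e ^ r * (coeff g k * (e' * v) ^ k) =
            coeff g k * int e ^ (r - k) * ((int e * e') ^ k * v ^ k)"
            by (simp add: power_mult_distrib mult_ac)
        qed
        moreover have "[(\<Sum>k\<le>r. coeff g k * int e ^ (r - k) * ((int e * e') ^ k * poly u n ^ k)) =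
            (\<Sum>k\<le>r. coeff g k * int e ^ (r - k) * (1 ^ k * poly u n ^ k))] (mod p)"
          by (intro cong_sum cong_mult cong_pow e' cong_refl)
        moreover have "poly (G u) n = (\<Sum>k\<le>r. coeff g k * int e ^ (r - k) * (1 ^ k * poly u n ^ k))"
          by (simp add: G_def poly_sum)
        ultimately show ?thesis by simp
      qed
      moreover have "p dvd poly (G u) n" using u p(3) by (auto elim!: dvdE)
      ultimately have "p dvd int e ^ r * poly g (e' * poly u n)" by (simp add: cong_dvd_iff)
      thus ?thesis using p(1) pe by (auto simp: prime_dvd_mult_iff dest: prime_dvd_power)
    qed
    have "\<not> p dvd e' * poly f' n - e' * poly h' n"
    proof
      assume "p dvd e' * poly f' n - e' * poly h' n"
      hence "p dvd e' * poly w n" by (simp add: w_def algebra_simps)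
      moreover have "\<not> p dvd e'"
      proof
        assume "p dvd e'"
        hence "p dvd int e * e'" by simp
        hence "p dvd 1" using e' by (simp add: cong_dvd_iff)
        thus False using p(1) by (simp add: not_prime_unit)
      qed
      ultimately have "p dvd poly w n" using p(1) by (simp add: prime_dvd_mult_iff)
      hence "p dvd poly (s' * F + t' * w) n" using p(3) by simp
      thus False using pc unfolding bez by simp
    qed
    thus "\<exists>n1 n2. p dvd poly g n1 \<and> p dvd poly g n2 \<and> \<not> p dvd n1 - n2"
      using root[OF G[OF f'\<eta> ab(1)]] root[OF G[OF h'\<eta> ab(2)]] by blast
  qed
qed

section \<open>The sieve\<close>

text \<open>
Cauchy's inequality for the sizes of the fibres of \<open>f\<close>.
\<close>

lemma card_sq_le_collisions:
  fixes f :: "'a \<Rightarrow> 'b"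
  assumes A: "finite A" and V: "finite V" "f ` A \<subseteq> V"
  shows "real (card A)^2 \<le> real (card V) * real (card {(a, b). a \<in> A \<and> b \<in> A \<and> f a = f b})"
proof -
  define F where "F = (\<lambda>v. {a \<in> A. f a = v})"
  have finF: "finite (F v)" for v using A by (simp add: F_def)
  have "A = (\<Union>v\<in>V. F v)" using V(2) by (auto simp: F_def)
  hence "card A = (\<Sum>v\<in>V. card (F v))"
    using V(1) finF card_UN_disjoint[of V F] by (auto simp: F_def)
  hence "real (card A)^2 = (\<Sum>v\<in>V. real (card (F v)))^2" by simp
  also have "\<dots> \<le> (\<Sum>v\<in>V. (real (card (F v)))^2) * card V"
    by (rule sum_squared_le_sum_of_squares)
  also have "(\<Sum>v\<in>V. (real (card (F v)))^2) = real (\<Sum>v\<in>V. card (F v \<times> F v))"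
    by (simp add: card_cartesian_product power2_eq_square)
  also have "(\<Sum>v\<in>V. card (F v \<times> F v)) = card (\<Union>v\<in>V. F v \<times> F v)"
    using V(1) finF by (intro card_UN_disjoint[symmetric]) (auto simp: F_def)
  also have "(\<Union>v\<in>V. F v \<times> F v) = {(a, b). a \<in> A \<and> b \<in> A \<and> f a = f b}"
    using V(2) by (auto simp: F_def)
  finally show ?thesis by (simp add: mult.commute)
qed

lemma prime_prod_dvd:
  fixes T V :: "nat set" and q :: int
  assumes T: "finite T" "\<And>p. p \<in> T \<Longrightarrow> prime p" and V: "V \<subseteq> T"
    and 1: "\<And>p. p \<in> T \<Longrightarrow> int p dvd q" and 2: "\<And>p. p \<in> V \<Longrightarrow> (int p)\<^sup>2 dvd q"
  shows "int (\<Prod>T * \<Prod>V) dvd q"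
proof -
  have "(\<Prod>p\<in>T. int p * (if p \<in> V then int p else 1)) dvd q"
  proof (rule prod_dvd_if_pairwise_coprime)
    fix p p' assume "p \<in> T" "p' \<in> T" "p \<noteq> p'"
    hence "coprime (int p) (int p')" using T(2) by (simp add: primes_coprime)
    thus "coprime (int p * (if p \<in> V then int p else 1)) (int p' * (if p' \<in> V then int p' else 1))"
      by simp
  qed (use T(1) 1 2 in \<open>auto simp: power2_eq_square\<close>)
  also have "(\<Prod>p\<in>T. int p * (if p \<in> V then int p else 1)) = (\<Prod>p\<in>T. int p) * (\<Prod>p\<in>V. int p)"
    using T(1) V by (simp add: prod.distrib prod.If_cases Int_absorb1)
  finally show ?thesis by simp
qed

lemma card_dvd_interval_le:
  fixes m :: nat and l :: real
  assumes m: "m > 0" and l: "l \<ge> 0"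
  shows "finite {q :: int. q \<noteq> 0 \<and> \<bar>real_of_int q\<bar> \<le> l \<and> int m dvd q}"
    and "real (card {q :: int. q \<noteq> 0 \<and> \<bar>real_of_int q\<bar> \<le> l \<and> int m dvd q}) \<le> 2 * l / real m"
proof -
  let ?S = "{q :: int. q \<noteq> 0 \<and> \<bar>real_of_int q\<bar> \<le> l \<and> int m dvd q}"
  define n where "n = nat \<lfloor>l / real m\<rfloor>"
  have sub: "?S \<subseteq> (\<lambda>k. int m * k) ` ({- int n..int n} - {0})"
  proof
    fix q assume "q \<in> ?S"
    then obtain k where k: "q = int m * k" "q \<noteq> 0" "\<bar>real_of_int q\<bar> \<le> l" by auto
    have "real m * \<bar>real_of_int k\<bar> \<le> l" using k(1,3) by (simp add: abs_mult)
    hence "\<bar>real_of_int k\<bar> \<le> l / real m" using m by (simp add: field_simps)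
    hence "\<bar>k\<bar> \<le> int n" unfolding n_def by linarith
    thus "q \<in> (\<lambda>k. int m * k) ` ({- int n..int n} - {0})"
      using k by (intro image_eqI[of _ _ k]) auto
  qed
  thus "finite ?S" by (rule finite_subset) auto
  have "card ?S \<le> card ((\<lambda>k. int m * k) ` ({- int n..int n} - {0}))"
    by (rule card_mono[OF _ sub]) auto
  also have "\<dots> \<le> card ({- int n..int n} - {0})" by (rule card_image_le) auto
  also have "\<dots> = 2 * n" by (subst card_Diff_subset) auto
  finally have "real (card ?S) \<le> 2 * real n" by linarith
  also have "real n \<le> l / real m" using l m unfolding n_def by (simp add: floor_le_iff)
  finally show "real (card ?S) \<le> 2 * l / real m" by simp
qed

text \<open>
Every prime \<open>p\<close> of \<open>T\<close> comes with two maps \<open>c p False\<close>, \<open>c p True\<close> to residues modulo \<open>p\<close>.  A subset \<open>U\<close> of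
\<open>T\<close> selects the second map for the primes in \<open>U\<close> and the first map for the others.  Counting the
triples of a pair and a selection under which the pair coincides, once for each selection and once
for each pair, gives the inequality; the factor \<open>3 / 4\<close> is \<open>(1 + 1 / 2) / 2\<close>.
\<close>

lemma two_class_sieve:
  fixes A :: "'a set" and T :: "nat set" and c :: "nat \<Rightarrow> bool \<Rightarrow> 'a \<Rightarrow> nat"
    and N :: "'a \<Rightarrow> 'a \<Rightarrow> int" and B l :: real
  assumes A: "finite A" and T: "finite T" "\<And>p. p \<in> T \<Longrightarrow> prime p"
    and c: "\<And>p e a. p \<in> T \<Longrightarrow> a \<in> A \<Longrightarrow> c p e a < p"
    and N1: "\<And>p e a b. p \<in> T \<Longrightarrow> a \<in> A \<Longrightarrow> b \<in> A \<Longrightarrow> a \<noteq> b \<Longrightarrow> c p e a = c p e b \<Longrightarrow> int p dvd N a b"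
    and N2: "\<And>p a b. p \<in> T \<Longrightarrow> a \<in> A \<Longrightarrow> b \<in> A \<Longrightarrow> a \<noteq> b \<Longrightarrow> c p False a = c p False b \<Longrightarrow>
       c p True a = c p True b \<Longrightarrow> (int p)\<^sup>2 dvd N a b"
    and N0: "\<And>a b. a \<in> A \<Longrightarrow> b \<in> A \<Longrightarrow> a \<noteq> b \<Longrightarrow> N a b \<noteq> 0"
    and Nl: "\<And>a b. a \<in> A \<Longrightarrow> b \<in> A \<Longrightarrow> a \<noteq> b \<Longrightarrow> \<bar>real_of_int (N a b)\<bar> \<le> l"
    and l: "l \<ge> 0"
    and B: "\<And>q. real (card {(a, b). a \<in> A \<and> b \<in> A \<and> a \<noteq> b \<and> N a b = q}) \<le> B"
  shows "real (card A)^2 \<le> real (\<Prod>T) * real (card A) + 2 * B * l * (3 / 4) ^ card T"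
proof -
  define k where "k = card T"
  define M where "M = real (\<Prod>T)"
  have M0: "M > 0" unfolding M_def using T(2) by (simp add: prime_gt_0_nat prod_pos)
  define cls where "cls = (\<lambda>U a. \<lambda>p\<in>T. c p (p \<in> U) a)"
  define P where "P = {(a, b). a \<in> A \<and> b \<in> A \<and> a \<noteq> b}"
  have finP: "finite P" by (rule finite_subset[of _ "A \<times> A"]) (use A in \<open>auto simp: P_def\<close>)
  define coll where "coll = (\<lambda>U. {x \<in> P. cls U (fst x) = cls U (snd x)})"
  define Us where "Us = (\<lambda>x. {U \<in> Pow T. cls U (fst x) = cls U (snd x)})"
  define Vs where "Vs = (\<lambda>x. {V \<in> Pow T. int (\<Prod>T * \<Prod>V) dvd N (fst x) (snd x)})"
  have cls_eq: "c p (p \<in> U) a = c p (p \<in> U) b" if "cls U a = cls U b" "p \<in> T" for U a b p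
    using fun_cong[OF that(1), of p] that(2) by (simp add: cls_def)
  have lower: "real (card A)^2 \<le> M * (real (card A) + real (card (coll U)))" if U: "U \<in> Pow T" for U
  proof -
    have "real (card A)^2 \<le> real (card (PiE T (\<lambda>p. {..<p}))) * real (card {(a, b). a \<in> A \<and> b \<in> A \<and> cls U a = cls U b})"
      by (rule card_sq_le_collisions[OF A]) (use T(1) c in \<open>auto simp: cls_def finite_PiE\<close>)
    also have "card (PiE T (\<lambda>p. {..<p})) = \<Prod>T" using T(1) by (simp add: card_PiE)
    also have "{(a, b). a \<in> A \<and> b \<in> A \<and> cls U a = cls U b} = (\<lambda>a. (a, a)) ` A \<union> coll U"
      by (auto simp: coll_def P_def)
    also have "card \<dots> = card ((\<lambda>a. (a, a)) ` A) + card (coll U)"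
      using A finP by (intro card_Un_disjoint) (auto simp: coll_def P_def)
    also have "card ((\<lambda>a. (a, a)) ` A) = card A" by (rule card_image) (auto intro: inj_onI)
    finally show ?thesis by (simp add: M_def)
  qed
  have Us_le: "card (Us x) \<le> card (Vs x)" if x: "x \<in> P" for x
  proof (cases "Us x = {}")
    case False
    obtain a b where ab: "x = (a, b)" "a \<in> A" "b \<in> A" "a \<noteq> b" using x by (auto simp: P_def)
    obtain U0 where U0: "U0 \<in> Us x" using False by blast
    have pT: "int p dvd N a b" if "p \<in> T" for p
      using cls_eq[of U0 a b p] U0 that ab N1[of p a b] by (auto simp: Us_def)
    define D where "D = {p \<in> T. (int p)\<^sup>2 dvd N a b}"
    \<comment> \<open>At a prime outside \<open>D\<close> only one of the two maps can identify the pair, so the selection is forced there.\<close>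
    have inj: "inj_on (\<lambda>U. U \<inter> D) (Us x)"
    proof (rule inj_onI)
      fix U U' assume UU': "U \<in> Us x" "U' \<in> Us x" "U \<inter> D = U' \<inter> D"
      have "p \<in> U \<longleftrightarrow> p \<in> U'" if p: "p \<in> T" for p
      proof (cases "p \<in> D")
        case True
        thus ?thesis using UU'(3) by blast
      next
        case False
        have same: "cls U a = cls U b" "cls U' a = cls U' b"
          using UU'(1,2) by (simp_all add: Us_def ab(1))
        note cls_eq[OF same(1) p] cls_eq[OF same(2) p]
        moreover have "\<not> (c p False a = c p False b \<and> c p True a = c p True b)"
          using N2[OF p ab(2-4)] False p by (auto simp: D_def)
        ultimately show ?thesis by (cases "p \<in> U"; cases "p \<in> U'") auto
      qed
      thus "U = U'" using UU' by (auto simp: Us_def)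
    qed
    have "V \<in> Vs x" if "V \<subseteq> D" for V
      using that prime_prod_dvd[OF T, of V "N a b"] pT ab by (auto simp: Vs_def D_def)
    hence "(\<lambda>U. U \<inter> D) ` Us x \<subseteq> Vs x" by auto
    moreover have "finite (Vs x)" using T(1) by (simp add: Vs_def)
    ultimately show ?thesis by (rule card_inj_on_le[OF inj])
  qed simp
  have prodV: "real (\<Prod>V) > 0" if "V \<in> Pow T" for V
    using that T(2) by (auto intro!: prod_pos simp: prime_gt_0_nat subset_iff)
  have Vcount: "real (card {x \<in> P. V \<in> Vs x}) \<le> 2 * B * l / M * (1 / real (\<Prod>V))" if V: "V \<in> Pow T" for V
  proof -
    define m where "m = \<Prod>T * \<Prod>V"
    have m0: "m > 0" using M0 prodV[OF V] unfolding m_def M_def by (metis mult_pos_pos of_nat_0_less_iff)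
    define Q where "Q = {q :: int. q \<noteq> 0 \<and> \<bar>real_of_int q\<bar> \<le> l \<and> int m dvd q}"
    note Q = card_dvd_interval_le[OF m0 l, folded Q_def]
    define R where "R = (\<lambda>q. {(a, b). a \<in> A \<and> b \<in> A \<and> a \<noteq> b \<and> N a b = q})"
    have finR: "finite (R q)" for q
      by (rule finite_subset[of _ "A \<times> A"]) (use A in \<open>auto simp: R_def\<close>)
    have "{x \<in> P. V \<in> Vs x} \<subseteq> (\<Union>q\<in>Q. R q)"
      using N0 Nl by (auto simp: Vs_def P_def R_def Q_def m_def)
    hence "card {x \<in> P. V \<in> Vs x} \<le> card (\<Union>q\<in>Q. R q)" using Q(1) finR by (intro card_mono) auto
    also have "\<dots> \<le> (\<Sum>q\<in>Q. card (R q))" by (rule card_UN_le[OF Q(1)])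
    finally have "real (card {x \<in> P. V \<in> Vs x}) \<le> (\<Sum>q\<in>Q. real (card (R q)))"
      by (metis of_nat_le_iff of_nat_sum)
    also have "\<dots> \<le> (\<Sum>q\<in>Q. B)" unfolding R_def by (intro sum_mono B)
    also have "\<dots> = real (card Q) * B" by simp
    also have "\<dots> \<le> 2 * l / real m * B"
      using Q(2) order.trans[OF _ B[of 0]] by (intro mult_right_mono) auto
    finally show ?thesis by (simp add: m_def M_def mult_ac)
  qed
  have B0: "B \<ge> 0" using order.trans[OF _ B[of 0]] by simp
  have "(\<Prod>p\<in>T. 1 / real p + 1) \<le> (\<Prod>p\<in>T. 3 / 2)"
  proof (intro prod_mono conjI)
    fix p assume "p \<in> T"
    hence "p \<ge> 2" using T(2) prime_ge_2_nat by blast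
    hence "1 / real p \<le> 1 / 2" by (intro frac_le) auto
    thus "1 / real p + 1 \<le> 3 / 2" by simp
  qed auto
  also have "\<dots> = (3 / 2) ^ k" by (simp add: k_def)
  finally have le32: "(\<Prod>p\<in>T. 1 / real p + 1) \<le> (3 / 2) ^ k" .
  have "2 ^ k * real (card A)^2 = (\<Sum>U\<in>Pow T. real (card A)^2)"
    using T(1) by (simp add: card_Pow k_def)
  also have "\<dots> \<le> (\<Sum>U\<in>Pow T. M * (real (card A) + real (card (coll U))))"
    by (intro sum_mono lower)
  also have "\<dots> = M * (2 ^ k * real (card A) + real (\<Sum>U\<in>Pow T. card (coll U)))"
    using T(1) by (simp add: sum_distrib_left[symmetric] sum.distrib card_Pow k_def)
  also have "(\<Sum>U\<in>Pow T. card (coll U)) = (\<Sum>x\<in>P. card (Us x))"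
    unfolding coll_def Us_def using T(1) finP by (intro sum_multicount_gen) auto
  also have "\<dots> \<le> (\<Sum>x\<in>P. card (Vs x))" by (intro sum_mono Us_le)
  also have "\<dots> = (\<Sum>V\<in>Pow T. card {x \<in> P. V \<in> Vs x})"
    unfolding Vs_def using T(1) finP by (intro sum_multicount_gen) auto
  finally have "2 ^ k * real (card A)^2 \<le> M * (2 ^ k * real (card A) + (\<Sum>V\<in>Pow T. real (card {x \<in> P. V \<in> Vs x})))"
    using M0 by simp
  also have "\<dots> \<le> M * (2 ^ k * real (card A) + (\<Sum>V\<in>Pow T. 2 * B * l / M * (1 / real (\<Prod>V))))"
    using M0 by (intro mult_left_mono add_left_mono sum_mono Vcount) auto
  also have "(\<Sum>V\<in>Pow T. 2 * B * l / M * (1 / real (\<Prod>V))) = 2 * B * l / M * (\<Sum>V\<in>Pow T. \<Prod>p\<in>V. 1 / real p)"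
    by (simp add: sum_distrib_left prod_dividef)
  also have "(\<Sum>V\<in>Pow T. \<Prod>p\<in>V. 1 / real p) = (\<Prod>p\<in>T. 1 / real p + 1)"
    using prod_add[OF T(1), of "\<lambda>p. 1 / real p" "\<lambda>_. 1"] by simp
  also have "M * (2 ^ k * real (card A) + 2 * B * l / M * (\<Prod>p\<in>T. 1 / real p + 1))
      \<le> M * (2 ^ k * real (card A) + 2 * B * l / M * (3 / 2) ^ k)"
    using M0 B0 l by (intro mult_left_mono add_left_mono le32) auto
  also have "\<dots> = 2 ^ k * (M * real (card A) + 2 * B * l * (3 / 4) ^ k)"
  proof -
    have "(3 / 2 :: real) ^ k = 2 ^ k * (3 / 4) ^ k" by (simp add: power_mult_distrib[symmetric])
    hence eq: "M * (2 * B * l / M * (3 / 2) ^ k) = 2 ^ k * (2 * B * l * (3 / 4) ^ k)"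
      using M0 by simp
    show ?thesis unfolding distrib_left eq by (simp add: mult_ac)
  qed
  finally show ?thesis by (simp add: M_def k_def)
qed

section \<open>The bound\<close>

lemma ln_3_gt_1: "ln (3 :: real) > 1"
proof -
  have "(1 / 3 :: real) < (7 / 8) ^ 8" by (simp add: power_divide)
  also have "(7 / 8 :: real) ^ 8 \<le> exp (- 1 / 8) ^ 8"
    using exp_ge_add_one_self[of "- 1 / 8 :: real"] by (intro power_mono) auto
  also have "exp (- 1 / 8 :: real) ^ 8 = inverse (exp 1)"
    by (simp add: exp_of_nat_mult[symmetric] exp_minus[symmetric])
  finally have "exp 1 < (3 :: real)" by (simp add: field_simps)
  hence "ln (exp 1) < ln (3 :: real)" by (subst ln_less_cancel_iff) auto
  thus ?thesis by simp
qed

text \<open>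
For large \<open>L\<close> the sieve is applied to \<open>k \<approx> \<delta> ln L / (4 ln (ln L))\<close> elements of \<open>G\<close> up to
\<open>z L = (ln L) powr (1 / \<delta>)\<close>.  There are at least \<open>ln L \<ge> k\<close> of them, and their product is at most
\<open>z L ^ k \<le> L powr (1 / 4)\<close>.  For bounded \<open>L\<close> the empty set suffices, because the exponential is then
bounded below.
\<close>

lemma bound_from_sieve:
  fixes G :: "nat set" and \<delta> :: real
  assumes \<delta>: "\<delta> > 0" and prime: "\<And>p. p \<in> G \<Longrightarrow> p > 0"
    and many: "eventually (\<lambda>x :: real. x powr \<delta> \<le> real (card {p \<in> G. real p \<le> x})) at_top"
  shows "\<exists>c>0. \<exists>C>0. \<forall>(n :: nat) (B :: real) (L :: real). B \<ge> 1 \<longrightarrow> L \<ge> 3 \<longrightarrow>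
    (\<forall>T. finite T \<longrightarrow> T \<subseteq> G \<longrightarrow> real n^2 \<le> real (\<Prod>T) * real n + 2 * B * L * (3 / 4) ^ card T) \<longrightarrow>
    real n \<le> C * sqrt (B * L) * exp (- c * (ln L / ln (ln L)))"
proof -
  define \<kappa> where "\<kappa> = \<delta> * ln (4 / 3) / 8"
  have \<kappa>: "\<kappa> > 0" using \<delta> by (simp add: \<kappa>_def)
  \<comment> \<open>The bound \<open>1 / 4\<close> absorbs the diagonal term, \<open>\<kappa> / 2\<close> comes from the square root of \<open>(3 / 4) ^ k\<close>.\<close>
  define c where "c = min (1 / 4) (\<kappa> / 2)"
  have c: "c > 0" "c \<le> 1 / 4" "c \<le> \<kappa> / 2" using \<kappa> by (auto simp: c_def)
  define z where "z = (\<lambda>L :: real. (ln L) powr (1 / \<delta>))"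
  have "filterlim z at_top at_top" unfolding z_def using \<delta> by real_asymp
  from filterlim_iff[THEN iffD1, OF this, rule_format, OF many]
  have ev1: "eventually (\<lambda>L. z L powr \<delta> \<le> real (card {p \<in> G. real p \<le> z L})) at_top" .
  have ev2: "eventually (\<lambda>L :: real. ln (ln L) \<ge> 1) at_top" by real_asymp
  have ev3: "eventually (\<lambda>L :: real. \<delta> / 4 * (ln L / ln (ln L)) \<le> ln L) at_top" by real_asymp
  obtain L0 where L0: "\<And>L. L \<ge> L0 \<Longrightarrow> z L powr \<delta> \<le> real (card {p \<in> G. real p \<le> z L})"
    "\<And>L. L \<ge> L0 \<Longrightarrow> ln (ln L) \<ge> 1" "\<And>L. L \<ge> L0 \<Longrightarrow> \<delta> / 4 * (ln L / ln (ln L)) \<le> ln L"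
    "L0 \<ge> 3"
    using eventually_conj[OF ev1 eventually_conj[OF ev2 eventually_conj[OF ev3 eventually_ge_at_top[of 3]]]]
    unfolding eventually_at_top_linorder by blast
  define C where "C = 4 + 2 * exp (c * (ln L0 / ln (ln 3)))"
  have "C > 0" by (simp add: C_def add_pos_pos)
  moreover have "real n \<le> C * sqrt (B * L) * exp (- c * (ln L / ln (ln L)))"
    if B: "B \<ge> 1" and L: "L \<ge> 3"
      and sieve: "\<And>T. finite T \<Longrightarrow> T \<subseteq> G \<Longrightarrow> real n^2 \<le> real (\<Prod>T) * real n + 2 * B * L * (3 / 4) ^ card T"
    for n :: nat and B L :: real
  proof -
    define E where "E = exp (- c * (ln L / ln (ln L)))"
    have E0: "E > 0" by (simp add: E_def)
    have BL: "B * L \<ge> L" using B L mult_right_mono[of 1 B L] by simp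
    have sBL: "sqrt (B * L) \<ge> sqrt L" using BL by simp
    have "sqrt L \<ge> 1" using L by simp
    hence sL: "sqrt (B * L) \<ge> 1" using sBL by linarith
    have "real n \<le> 2 * sqrt (B * L) * exp (c * (ln L0 / ln (ln 3))) * E \<or> real n \<le> 4 * sqrt (B * L) * E"
    proof (cases "L \<ge> L0")
      case False
      have n: "real n \<le> 2 * sqrt (B * L)"
      proof (cases "n \<le> 2")
        case True
        thus ?thesis using sL by linarith
      next
        case False
        have "real n^2 \<le> real n + 2 * (B * L)" using sieve[of "{}"] by simp
        moreover have "2 * real n \<le> real n^2"
          using False by (simp add: power2_eq_square mult_right_mono)
        ultimately have "real n^2 \<le> 4 * (B * L)" by simp
        hence "real n \<le> sqrt (4 * (B * L))" by (rule real_le_rsqrt)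
        thus ?thesis by (simp add: real_sqrt_mult)
      qed
      have "ln L \<ge> ln 3" using L by simp
      hence "ln (ln L) \<ge> ln (ln 3)" using ln_3_gt_1 by (subst ln_le_cancel_iff) linarith+
      moreover have "ln L \<le> ln L0" using False L by simp
      moreover have "ln (ln (3 :: real)) > 0" using ln_3_gt_1 by simp
      ultimately have "ln L / ln (ln L) \<le> ln L0 / ln (ln 3)"
        using L \<open>L0 \<ge> 3\<close> by (intro frac_le) auto
      hence "c * (ln L / ln (ln L)) \<le> c * (ln L0 / ln (ln 3))" using c(1) by (intro mult_left_mono) auto
      hence "1 \<le> exp (c * (ln L0 / ln (ln 3))) * E" by (simp add: E_def exp_add[symmetric])
      hence "2 * sqrt (B * L) * 1 \<le> 2 * sqrt (B * L) * (exp (c * (ln L0 / ln (ln 3))) * E)"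
        using sL by (intro mult_left_mono) auto
      thus ?thesis using n by (simp add: mult_ac)
    next
      case True
      define l where "l = ln L"
      define Q where "Q = l / ln l"
      have ll: "ln l \<ge> 1" "\<delta> / 4 * Q \<le> l" using L0(2,3)[OF True] by (simp_all add: l_def Q_def)
      have l1: "l > 1" using ln_3_gt_1 L unfolding l_def by (smt (verit) ln_le_cancel_iff)
      have Q0: "Q \<ge> 0" using l1 ll(1) by (simp add: Q_def)
      define k where "k = nat \<lfloor>\<delta> / 4 * Q\<rfloor>"
      have "\<delta> / 4 * Q \<ge> 0" using Q0 \<delta> by simp
      hence k: "real k \<le> \<delta> / 4 * Q" "\<delta> / 4 * Q < real k + 1"
        unfolding k_def by linarith+
      have zd: "z L powr \<delta> = l" using \<delta> l1 by (simp add: z_def powr_powr l_def)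
      have "real k \<le> real (card {p \<in> G. real p \<le> z L})" using L0(1)[OF True] zd k(1) ll(2) by linarith
      hence "k \<le> card {p \<in> G. real p \<le> z L}" by simp
      then obtain T where T: "T \<subseteq> {p \<in> G. real p \<le> z L}" "card T = k" "finite T"
        by (rule obtain_subset_with_card_n)
      have "real (\<Prod>T) = (\<Prod>p\<in>T. real p)" by simp
      also have "\<dots> \<le> (\<Prod>p\<in>T. z L)" using T(1) by (intro prod_mono) auto
      also have "\<dots> = z L ^ k" using T(2) by simp
      also have "z L = exp (ln l / \<delta>)" using l1 by (simp add: z_def powr_def l_def)
      also have "exp (ln l / \<delta>) ^ k = exp (real k * (ln l / \<delta>))" by (rule exp_of_nat_mult[symmetric])
      also have "real k * (ln l / \<delta>) \<le> \<delta> / 4 * Q * (ln l / \<delta>)"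
        using k(1) ll(1) \<delta> by (intro mult_right_mono) auto
      also have "\<delta> / 4 * Q * (ln l / \<delta>) = l / 4" using \<delta> ll(1) by (simp add: Q_def)
      finally have prodT: "real (\<Prod>T) \<le> exp (l / 4)" by simp
      have eL: "exp l = L" using L by (simp add: l_def)
      have cQ: "E = exp (- c * Q)" by (simp add: E_def Q_def l_def)
      show ?thesis
      \<comment> \<open>Either \<open>n\<close> is at most twice the bound \<open>exp (l / 4)\<close> for \<open>\<Prod>T\<close>, or the diagonal term is at most \<open>n\<^sup>2 / 2\<close>.\<close>
      proof (cases "real n \<le> 2 * exp (l / 4)")
        case True
        have "c * Q \<le> 1 / 4 * l"
        proof (rule mult_mono)
          show "Q \<le> l" unfolding Q_def using l1 ll(1) by (simp add: divide_le_eq_1 pos_divide_le_eq)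
        qed (use c Q0 in auto)
        hence "exp (l / 4) \<le> exp (l / 2) * E" unfolding cQ by (simp add: exp_add[symmetric])
        also have "exp (l / 2) = sqrt L"
        proof -
          have "exp (l / 2) ^ 2 = L" using eL by (simp add: power2_eq_square exp_add[symmetric])
          thus ?thesis by (metis exp_ge_zero real_sqrt_unique)
        qed
        also have "sqrt L * E \<le> sqrt (B * L) * E" using sBL E0 by (intro mult_right_mono) auto
        finally have "real n \<le> 2 * (sqrt (B * L) * E)" using True by simp
        also have "\<dots> \<le> 4 * (sqrt (B * L) * E)" using sL E0 by (intro mult_right_mono) auto
        finally show ?thesis by (simp add: mult_ac)
      next
        case False
        have "real (\<Prod>T) * real n \<le> exp (l / 4) * real n" using prodT by (intro mult_right_mono) auto
        also have "\<dots> \<le> (real n / 2) * real n" using False by (intro mult_right_mono) auto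
        finally have "real n^2 \<le> real n^2 / 2 + 2 * B * L * (3 / 4) ^ k"
          using sieve[of T] T by (simp add: power2_eq_square subset_iff)
        hence "real n^2 \<le> 4 * (B * L) * (3 / 4) ^ k" by simp
        also have "(3 / 4 :: real) ^ k \<le> 4 / 3 * exp (- 2 * c * Q)"
        proof -
          have "(3 / 4 :: real) ^ k = exp (- (real k * ln (4 / 3)))"
            by (simp add: exp_minus exp_of_nat_mult power_divide)
          also have "\<dots> \<le> exp (ln (4 / 3) - 2 * c * Q)"
          proof -
            have "2 * c * Q \<le> \<kappa> * Q" using c(3) Q0 by (intro mult_right_mono) auto
            also have "\<kappa> * Q \<le> \<delta> / 4 * Q * ln (4 / 3)"
              using Q0 \<delta> by (simp add: \<kappa>_def field_simps)
            also have "\<dots> \<le> (real k + 1) * ln (4 / 3)" using k(2) by (intro mult_right_mono) auto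
            finally show ?thesis by (simp add: algebra_simps)
          qed
          also have "\<dots> = 4 / 3 * exp (- 2 * c * Q)" by (simp add: exp_diff exp_minus field_simps)
          finally show ?thesis .
        qed
        hence "4 * (B * L) * (3 / 4) ^ k \<le> 4 * (B * L) * (4 / 3 * exp (- 2 * c * Q))"
          using B L by (intro mult_left_mono) auto
        also have "\<dots> \<le> 4 * (B * L) * (4 * exp (- 2 * c * Q))"
          using B L by (intro mult_left_mono mult_right_mono) auto
        also have "\<dots> = (4 * sqrt (B * L) * E)^2"
        proof -
          have "E^2 = exp (- 2 * c * Q)" unfolding cQ by (simp add: power2_eq_square exp_add[symmetric])
          moreover have "sqrt (B * L) ^ 2 = B * L" using B L by simp
          ultimately show ?thesis by (simp add: power_mult_distrib)
        qed
        finally have "real n \<le> 4 * sqrt (B * L) * E"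
          using sL E0 by (elim power2_le_imp_le) auto
        thus ?thesis ..
      qed
    qed
    moreover have "2 * sqrt (B * L) * exp (c * (ln L0 / ln (ln 3))) * E \<le> C * sqrt (B * L) * E"
      "4 * sqrt (B * L) * E \<le> C * sqrt (B * L) * E"
      using sL E0 by (simp_all add: C_def algebra_simps)
    ultimately show ?thesis unfolding E_def by linarith
  qed
  ultimately show ?thesis using c(1) by blast
qed

theorem theorem1p9:
  fixes K :: "'a :: field_char_0 set"
  assumes "number_field K" and "field_degree K \<ge> 2"
  shows "\<exists>c>0. \<exists>C>0. \<forall>(A :: 'a set) (B :: real) (L :: real).
    finite A \<longrightarrow> A \<subseteq> ring_of_integers K \<longrightarrow> card A \<ge> 2 \<longrightarrow>
    (\<forall>q :: int. real (norm_rep_count K A q) \<le> B) \<longrightarrow>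
    L = real_of_rat (Max {\<bar>field_norm K (a - b)\<bar> | a b. a \<in> A \<and> b \<in> A \<and> a \<noteq> b}) \<longrightarrow>
    L \<ge> 3 \<longrightarrow>
    real (card A) \<le> C * sqrt (B * L) * exp (- c * (ln L / ln (ln L)))"
proof -
  let ?O = "ring_of_integers K"
  obtain g :: "int poly" and \<theta> :: 'a and D :: int and U :: "'a \<Rightarrow> int poly" and N :: "'a \<Rightarrow> int" where
    g: "degree g = field_degree K" "lead_coeff g = 1" "is_minpoly (of_int_poly g) \<theta>" and D: "D \<noteq> 0"
    and U: "\<And>x y. x \<in> ?O \<Longrightarrow> y \<in> ?O \<Longrightarrow> U (x - y) = U x - U y"
    and diff: "\<And>x y. x \<in> ?O \<Longrightarrow> y \<in> ?O \<Longrightarrow> x - y \<in> ?O"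
    and N: "\<And>x. x \<in> ?O \<Longrightarrow> field_norm K x = of_int (N x)"
    and N0: "\<And>x. x \<in> ?O \<Longrightarrow> x \<noteq> 0 \<Longrightarrow> N x \<noteq> 0"
    and N1: "\<And>x p n. x \<in> ?O \<Longrightarrow> prime p \<Longrightarrow> \<not> p dvd D \<Longrightarrow> p dvd poly g n \<Longrightarrow>
       p dvd poly (U x) n \<Longrightarrow> p dvd N x"
    and N2: "\<And>x p n m. x \<in> ?O \<Longrightarrow> prime p \<Longrightarrow> \<not> p dvd D \<Longrightarrow> p dvd poly g n \<Longrightarrow> p dvd poly g m \<Longrightarrow>
       \<not> p dvd n - m \<Longrightarrow> p dvd poly (U x) n \<Longrightarrow> p dvd poly (U x) m \<Longrightarrow> p\<^sup>2 dvd N x"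
    by (rule number_field_model[OF assms(1)], rule that, assumption+)
  have "algebraic_int \<theta>"
    unfolding algebraic_int_altdef_ipoly
    using is_minpolyD(3)[OF g(3)] g(2) by (intro exI[of _ g]) (simp add: rpoly_of_int_poly)
  then obtain F :: "int poly" and E :: int where F: "lead_coeff F = 1" "degree F > 0" and E: "E \<noteq> 0"
    and roots: "\<And>p n. prime p \<Longrightarrow> \<not> p dvd E \<Longrightarrow> p dvd poly F n \<Longrightarrow>
       \<exists>n1 n2. p dvd poly g n1 \<and> p dvd poly g n2 \<and> \<not> p dvd n1 - n2"
    using two_roots_mod_prime[OF g(3,2)] assms(2) g(1) by metis
  obtain \<delta> :: real where \<delta>: "\<delta> > 0"
    "eventually (\<lambda>x :: real. x powr \<delta> \<le> real (card {p :: nat. prime p \<and> real p \<le> x \<and> (\<exists>n. int p dvd poly F n)})) at_top"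
    using many_prime_divisors_of_values[OF F] .
  define G where "G = {p :: nat. prime p \<and> \<not> int p dvd D * E \<and> (\<exists>n. int p dvd poly F n)}"
  \<comment> \<open>Discarding the finitely many exceptional primes only costs a factor 2 in the exponent \<open>\<delta>\<close>.\<close>
  define bad where "bad = {p :: nat. p dvd nat \<bar>D * E\<bar>}"
  have "finite bad" unfolding bad_def using D E by (intro finite_divisors_nat) simp
  have "eventually (\<lambda>x :: real. x powr (\<delta> / 2) \<le> x powr \<delta> - real (card bad)) at_top"
    using \<delta>(1) by real_asymp
  hence many: "eventually (\<lambda>x :: real. x powr (\<delta> / 2) \<le> real (card {p \<in> G. real p \<le> x})) at_top"
    using \<delta>(2)
  proof eventually_elim
    case (elim x)
    let ?P = "{p :: nat. prime p \<and> real p \<le> x \<and> (\<exists>n. int p dvd poly F n)}"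
    have fin: "finite {p \<in> G. real p \<le> x}"
      by (rule finite_subset[of _ "{..nat \<lfloor>x\<rfloor>}"]) (auto simp: le_nat_floor)
    have "?P \<subseteq> {p \<in> G. real p \<le> x} \<union> bad" by (auto simp: G_def bad_def nat_dvd_iff)
    hence "card ?P \<le> card ({p \<in> G. real p \<le> x} \<union> bad)" using fin \<open>finite bad\<close> by (intro card_mono) auto
    also have "\<dots> \<le> card {p \<in> G. real p \<le> x} + card bad" by (rule card_Un_le)
    finally have "real (card ?P) \<le> real (card {p \<in> G. real p \<le> x}) + real (card bad)" by linarith
    thus ?case using elim by linarith
  qed
  have "\<exists>n1 n2. p \<in> G \<longrightarrow> int p dvd poly g n1 \<and> int p dvd poly g n2 \<and> \<not> int p dvd n1 - n2" for p
  proof (cases "p \<in> G")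
    case True
    then obtain n where n: "prime (int p)" "\<not> int p dvd D * E" "int p dvd poly F n" by (auto simp: G_def)
    moreover from n(2) have "\<not> int p dvd E" by (metis dvd_mult)
    ultimately show ?thesis using roots[of "int p" n] by blast
  qed auto
  then obtain n1 n2 where n12: "\<And>p. p \<in> G \<Longrightarrow> int p dvd poly g (n1 p) \<and> int p dvd poly g (n2 p) \<and> \<not> int p dvd n1 p - n2 p"
    by metis
  define cls where "cls = (\<lambda>p e a. nat (poly (U a) (if e then n2 p else n1 p) mod int p))"
  have cls_dvd: "int p dvd poly (U (a - b)) (if e then n2 p else n1 p)"
    if "p \<in> G" "a \<in> ?O" "b \<in> ?O" "cls p e a = cls p e b" for p e a b
  proof -
    have "p > 0" using that(1) by (simp add: G_def prime_gt_0_nat)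
    hence "poly (U a) (if e then n2 p else n1 p) mod int p = poly (U b) (if e then n2 p else n1 p) mod int p"
      using that(4) by (simp add: cls_def nat_eq_iff split: if_splits)
    thus ?thesis using U[OF that(2,3)] by (simp add: mod_eq_dvd_iff)
  qed
  obtain c C where cC: "c > 0" "C > 0" "\<And>(n :: nat) (B :: real) (L :: real). B \<ge> 1 \<Longrightarrow> L \<ge> 3 \<Longrightarrow>
    (\<And>T. finite T \<Longrightarrow> T \<subseteq> G \<Longrightarrow> real n^2 \<le> real (\<Prod>T) * real n + 2 * B * L * (3 / 4) ^ card T) \<Longrightarrow>
    real n \<le> C * sqrt (B * L) * exp (- c * (ln L / ln (ln L)))"
    using bound_from_sieve[OF _ _ many] \<delta>(1) by (auto simp: G_def prime_gt_0_nat)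
  have "real (card A) \<le> C * sqrt (B * L) * exp (- c * (ln L / ln (ln L)))"
    if A: "finite A" "A \<subseteq> ?O" "card A \<ge> 2"
      and B: "\<And>q :: int. real (norm_rep_count K A q) \<le> B"
      and L: "L = real_of_rat (Max {\<bar>field_norm K (a - b)\<bar> | a b. a \<in> A \<and> b \<in> A \<and> a \<noteq> b})" "L \<ge> 3"
    for A :: "'a set" and B L :: real
  proof -
    have Ndiff: "field_norm K (a - b) = of_int (N (a - b))" if "a \<in> A" "b \<in> A" for a b
      using N[OF diff] that A(2) by blast
    have count: "norm_rep_count K A q = card {(a, b). a \<in> A \<and> b \<in> A \<and> a \<noteq> b \<and> N (a - b) = q}" for q
      unfolding norm_rep_count_def using Ndiff by (intro arg_cong[where f = card]) auto
    have le_L: "\<bar>real_of_int (N (a - b))\<bar> \<le> L" if ab: "a \<in> A" "b \<in> A" "a \<noteq> b" for a b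
    proof -
      let ?S = "{\<bar>field_norm K (a - b)\<bar> | a b. a \<in> A \<and> b \<in> A \<and> a \<noteq> b}"
      have "?S \<subseteq> (\<lambda>(a, b). \<bar>field_norm K (a - b)\<bar>) ` (A \<times> A)" by auto
      hence "finite ?S" using A(1) by (meson finite_SigmaI finite_imageI finite_subset)
      moreover have "\<bar>field_norm K (a - b)\<bar> \<in> ?S" using ab by blast
      ultimately have "\<bar>field_norm K (a - b)\<bar> \<le> Max ?S" by (rule Max_ge)
      hence "real_of_rat \<bar>field_norm K (a - b)\<bar> \<le> L" unfolding L(1) by (simp add: of_rat_less_eq)
      moreover have "real_of_rat \<bar>field_norm K (a - b)\<bar> = \<bar>real_of_int (N (a - b))\<bar>"
        using Ndiff[OF ab(1,2)] by (simp flip: of_int_abs)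
      ultimately show ?thesis by simp
    qed
    have B1: "B \<ge> 1"
    proof -
      obtain a b where ab: "a \<in> A" "b \<in> A" "a \<noteq> b"
        using A(3) by (metis card_2_iff' obtain_subset_with_card_n subsetD)
      let ?R = "{(a', b'). a' \<in> A \<and> b' \<in> A \<and> a' \<noteq> b' \<and> N (a' - b') = N (a - b)}"
      have "finite ?R" by (rule finite_subset[of _ "A \<times> A"]) (use A(1) in auto)
      moreover have "(a, b) \<in> ?R" using ab by simp
      ultimately have "card ?R > 0" unfolding card_gt_0_iff by blast
      thus ?thesis using B[of "N (a - b)"] unfolding count by linarith
    qed
    have "real (card A)^2 \<le> real (\<Prod>T) * real (card A) + 2 * B * L * (3 / 4) ^ card T"
      if T: "finite T" "T \<subseteq> G" for T
    proof (rule two_class_sieve[where c = cls and N = "\<lambda>a b. N (a - b)"])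
      show "finite A" "finite T" using A T by auto
      show "prime p" if "p \<in> T" for p using that T(2) by (auto simp: G_def)
      show "cls p e a < p" if "p \<in> T" for p e a
      proof -
        have "p > 0" using that T(2) by (auto simp: G_def prime_gt_0_nat)
        thus ?thesis by (simp add: cls_def nat_less_iff)
      qed
      show "L \<ge> 0" using L(2) by simp
      show "real (card {(a, b). a \<in> A \<and> b \<in> A \<and> a \<noteq> b \<and> N (a - b) = q}) \<le> B" for q
        using B[of q] unfolding count .
      fix a b assume ab: "a \<in> A" "b \<in> A" "a \<noteq> b"
      have O: "a \<in> ?O" "b \<in> ?O" "a - b \<in> ?O" using ab A(2) diff by auto
      show "N (a - b) \<noteq> 0" using N0[OF O(3)] ab(3) by simp
      show "\<bar>real_of_int (N (a - b))\<bar> \<le> L" by (rule le_L[OF ab])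
      fix p assume "p \<in> T"
      hence p: "p \<in> G" "prime (int p)" "\<not> int p dvd D" using T(2) by (auto simp: G_def intro: dvd_mult2)
      show "int p dvd N (a - b)" if "cls p e a = cls p e b" for e
        using N1[OF O(3) p(2,3) _ cls_dvd[OF p(1) O(1,2) that]] n12[OF p(1)] by (cases e) auto
      show "(int p)\<^sup>2 dvd N (a - b)" if e: "cls p False a = cls p False b" "cls p True a = cls p True b"
        using N2[OF O(3) p(2,3), of "n1 p" "n2 p"] n12[OF p(1)]
          cls_dvd[OF p(1) O(1,2) e(1)] cls_dvd[OF p(1) O(1,2) e(2)] by simp
    qed
    thus ?thesis by (rule cC(3)[OF B1 L(2)])
  qed
  thus ?thesis using cC(1,2) by blast
qed

end
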